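(* Assume that there is a unique optimal arm, and let $\alpha<0$. Under Thompson sampling with parameter $\alpha$ (that is, with prior $\pi(\mu_i,\sigma_i^2)\propto(\sigma_i^2)^{-1-\alpha}$ for each arm), the expected regret is bounded as $$\mathrm{E}[\mathrm{Regret}(T)]\le \sum_{i:\Delta_i>0}\frac{\Delta_i\log T}{D_{\mathrm{inf}}(\Delta_i,\sigma_i^2)}+\mathrm{O}((\log T)^{4/5})$$ as $T\to\infty$, for fixed $\alpha$ and fixed arm parameters $(\mu_i,\sigma_i^2)$, $i=1,\dots,K$.
   Context: Bandit model. There are $K$ arms. The $n$-th reward from arm $i$ is $X_{i,n}$; all rewards are independent and $X_{i,n}\sim\mathcal{N}(\mu_i,\sigma_i^2)$ with $(\mu_i,\sigma_i^2)\in\mathbb{R}\times(0,\infty)$ unknown to the player. At each round $t=1,2,\dots$ the player pulls one arm $J(t)\in\{1,\dots,K\}$ and receives the next reward of that arm. $N_i(t)$ is the number of times arm $i$ is pulled before the $t$-th round (in rounds $1,\dots,t-1$). Let $\mu^*=\max_i\mu_i$, $\Delta_i=\mu^*-\mu_i$; arm $i$ is optimal if $\Delta_i=0$. The regret is $\mathrm{Regret}(T)=\sum_{t=1}^T\Delta_{J(t)}=\sum_i\Delta_iN_i(T+1)$. Statistics. $\bar{x}_{i,n}=\frac1n\sum_{m=1}^nX_{i,m}$ and $S_{i,n}=\sum_{m=1}^n(X_{i,m}-\bar{x}_{i,n})^2$, with $\hat\theta_{i,n}=(\bar x_{i,n},S_{i,n})$ and $\hat\theta_i(t)=\hat\theta_{i,N_i(t)}$.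 Posterior. Under the (improper) prior $\pi(\mu_i,\sigma_i^2)\propto(\sigma_i^2)^{-1-\alpha}$, the posterior of the mean $\mu_i$ given $n$ samples is the probability density $\pi(\mu_i|\hat\theta_{i,n})\propto\left(1+\frac{n(\mu_i-\bar x_{i,n})^2}{S_{i,n}}\right)^{-\frac n2-\alpha}$; equivalently $\sqrt{\frac{n(n+2\alpha-1)}{S_{i,n}}}(\mu_i-\bar x_{i,n})$ has the Student $t$-distribution with $n+2\alpha-1$ degrees of freedom. Thompson sampling with parameter $\alpha\in\mathbb{R}$. Initialization: pull each arm $n_0=\max\{2,3-\lceil2\alpha\rceil\}$ times (rounds $1,\dots,Kn_0$). Then at each round $t>Kn_0$: given the past, sample $\tilde\mu_i(t)$ from $\pi(\mu_i|\hat\theta_i(t))$ independently for each arm $i$, and pull an arm $i$ maximizing $\tilde\mu_i(t)$. Finally, $D_{\mathrm{inf}}(\Delta,\sigma^2)=\frac12\log\left(1+\frac{\Delta^2}{\sigma^2}\right)$. *)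

theory Defs
  imports "HOL-Probability.Probability" "HOL-Library.Landau_Symbols"
begin

text \<open>
  The \<open>K\<close> arms are the elements of a finite type \<open>'k\<close>, so \<open>K = CARD('k)\<close>. Rounds \<open>t\<close> and reward
  numbers \<open>n\<close> start at 1. The parameter \<open>\<sigma> i\<close> is the standard deviation of arm \<open>i\<close>.
\<close>

definition gap :: "('k::finite \<Rightarrow> real) \<Rightarrow> 'k \<Rightarrow> real" where
  "gap \<mu> i = Max (range \<mu>) - \<mu> i"

definition D_inf :: "real \<Rightarrow> real \<Rightarrow> real" where
  "D_inf \<Delta> v = 1 / 2 * ln (1 + \<Delta>\<^sup>2 / v)"

definition pulls :: "(nat \<Rightarrow> 'a \<Rightarrow> 'k) \<Rightarrow> 'k \<Rightarrow> nat \<Rightarrow> 'a \<Rightarrow> nat" where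
  "pulls J i t \<omega> = card {s \<in> {1..<t}. J s \<omega> = i}"

definition regret :: "('k::finite \<Rightarrow> real) \<Rightarrow> (nat \<Rightarrow> 'a \<Rightarrow> 'k) \<Rightarrow> nat \<Rightarrow> 'a \<Rightarrow> real" where
  "regret \<mu> J T \<omega> = (\<Sum>t = 1..T. gap \<mu> (J t \<omega>))"

definition sample_mean :: "('k \<Rightarrow> nat \<Rightarrow> 'a \<Rightarrow> real) \<Rightarrow> 'k \<Rightarrow> nat \<Rightarrow> 'a \<Rightarrow> real" where
  "sample_mean X i n \<omega> = (\<Sum>m = 1..n. X i m \<omega>) / real n"

definition sum_sq_dev :: "('k \<Rightarrow> nat \<Rightarrow> 'a \<Rightarrow> real) \<Rightarrow> 'k \<Rightarrow> nat \<Rightarrow> 'a \<Rightarrow> real" where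
  "sum_sq_dev X i n \<omega> = (\<Sum>m = 1..n. (X i m \<omega> - sample_mean X i n \<omega>)\<^sup>2)"

text \<open>
  The posterior of the mean given \<open>n\<close> samples with sample mean \<open>x\<close> and sum of squared deviations
  \<open>S\<close>, under the prior proportional to \<open>v powr (- 1 - \<alpha>)\<close> on the mean and the variance \<open>v\<close>. It is a
  probability measure whenever \<open>S > 0\<close> and \<open>n + 2 * \<alpha> > 1\<close>.
\<close>

definition posterior_weight :: "real \<Rightarrow> nat \<Rightarrow> real \<Rightarrow> real \<Rightarrow> real \<Rightarrow> real" where
  "posterior_weight \<alpha> n x S m = (1 + real n * (m - x)\<^sup>2 / S) powr (- real n / 2 - \<alpha>)"

definition posterior :: "real \<Rightarrow> nat \<Rightarrow> real \<Rightarrow> real \<Rightarrow> real measure" where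
  "posterior \<alpha> n x S = density lborel
     (\<lambda>m. ennreal (posterior_weight \<alpha> n x S m / (\<integral>m'. posterior_weight \<alpha> n x S m' \<partial>lborel)))"

definition init_pulls :: "real \<Rightarrow> nat" where
  "init_pulls \<alpha> = nat (max 2 (3 - \<lceil>2 * \<alpha>\<rceil>))"

definition init_rounds :: "'k::finite itself \<Rightarrow> real \<Rightarrow> nat" where
  "init_rounds _ \<alpha> = CARD('k) * init_pulls \<alpha>"

text \<open>
  The sigma-algebra before the posterior sampling in round \<open>t\<close>. It contains the earlier pulls and
  posterior samples together with the whole table of rewards, including those not yet observed:
  conditioning on it expresses that the player's randomization makes no use of unobserved rewards.
\<close>

definition past :: "'a measure \<Rightarrow> real \<Rightarrow> ('k::finite \<Rightarrow> nat \<Rightarrow> 'a \<Rightarrow> real) \<Rightarrow> (nat \<Rightarrow> 'a \<Rightarrow> 'k) \<Rightarrow>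
    ('k \<Rightarrow> nat \<Rightarrow> 'a \<Rightarrow> real) \<Rightarrow> nat \<Rightarrow> 'a measure" where
  "past M \<alpha> X J \<mu>s t = sigma (space M)
     ({X i n -` B \<inter> space M | i n B. 1 \<le> n \<and> B \<in> sets borel}
      \<union> {J s -` A \<inter> space M | s A. 1 \<le> s \<and> s < t}
      \<union> {\<mu>s i s -` B \<inter> space M | i s B. init_rounds TYPE('k) \<alpha> < s \<and> s < t \<and> B \<in> sets borel})"

text \<open>
  Thompson sampling on an arbitrary probability space carrying the rewards \<open>X i n\<close>, the pulled arms
  \<open>J t\<close> and the posterior samples \<open>\<mu>s i t\<close>. The latter are unconstrained during the initialization.
  The order of the initial pulls and the breaking of ties are left open.
\<close>

locale gaussian_thompson_sampling = prob_space M
  for M :: "'a measure"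
    and \<mu> \<sigma> :: "'k::finite \<Rightarrow> real"
    and \<alpha> :: real
    and X :: "'k \<Rightarrow> nat \<Rightarrow> 'a \<Rightarrow> real"
    and J :: "nat \<Rightarrow> 'a \<Rightarrow> 'k"
    and \<mu>s :: "'k \<Rightarrow> nat \<Rightarrow> 'a \<Rightarrow> real" +
  assumes rewards_indep: "indep_vars (\<lambda>_. borel) (\<lambda>(i, n). X i n) (UNIV \<times> {1..})"
    and rewards_normal: "1 \<le> n \<Longrightarrow> distributed M lborel (X i n) (normal_density (\<mu> i) (\<sigma> i))"
    and J_measurable: "1 \<le> t \<Longrightarrow> J t \<in> measurable M (count_space UNIV)"
    and samples_measurable: "init_rounds TYPE('k) \<alpha> < t \<Longrightarrow> \<mu>s i t \<in> borel_measurable M"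
    and initialization:
      "\<omega> \<in> space M \<Longrightarrow> pulls J i (init_rounds TYPE('k) \<alpha> + 1) \<omega> = init_pulls \<alpha>"
    and posterior_sampling:
      "\<lbrakk>init_rounds TYPE('k) \<alpha> < t; \<And>i. B i \<in> sets borel\<rbrakk> \<Longrightarrow>
       AE \<omega> in M.
         real_cond_exp M (past M \<alpha> X J \<mu>s t) (indicator {\<omega>' \<in> space M. \<forall>i. \<mu>s i t \<omega>' \<in> B i}) \<omega> =
         (\<Prod>i\<in>UNIV. measure (posterior \<alpha> (pulls J i t \<omega>)
            (sample_mean X i (pulls J i t \<omega>) \<omega>) (sum_sq_dev X i (pulls J i t \<omega>) \<omega>)) (B i))"
    and pull_maximizer:
      "\<lbrakk>init_rounds TYPE('k) \<alpha> < t; \<omega> \<in> space M\<rbrakk> \<Longrightarrow> \<mu>s i t \<omega> \<le> \<mu>s (J t \<omega>) t \<omega>"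

end

theory Submission imports Defs begin

text \<open>
  The regret is the sum of the gaps times the numbers of pulls, so it suffices to bound the expected
  number of pulls of each suboptimal arm \<open>i\<close>. Let \<open>k\<close> be the optimal arm, \<open>\<epsilon> > 0\<close> a small
  tolerance and \<open>c = \<mu> k - \<epsilon>\<close>. Arm \<open>i\<close> can be pulled after the initialization for one of
  three reasons only.

  First, the statistics of arm \<open>i\<close> may be accurate while its posterior sample exceeds \<open>c\<close>. The
  upper tail of the posterior at distance \<open>y\<close> from the sample mean is at most
  \<open>(1 + n y\<^sup>2 / S) powr (- (n + 2 \<alpha> - 1) / 2) / 2\<close> (\<open>posterior_upper_tail\<close>), and for accurate
  statistics this is an exponential in \<open>(n + 2 \<alpha> - 1) D_inf (\<Delta> - 2 \<epsilon>) (\<sigma>\<^sup>2 + \<epsilon>)\<close>. After about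
  \<open>ln T / D_inf\<close> pulls it is below \<open>1 / T\<close>, so that these rounds contribute the leading term and a
  constant. Secondly, the statistics of arm \<open>i\<close> may be inaccurate; by exponential tail bounds this
  accounts for \<open>O(\<epsilon> powr - 4)\<close> pulls.

  Thirdly, all posterior samples may lie below \<open>c\<close>; this is where the prior matters. Given the
  history, the samples of the arms are independent. Hence the event that all samples are below \<open>c\<close>
  and the event that only the sample of \<open>k\<close> is not below \<open>c\<close> have conditional probabilities in
  ratio \<open>(1 - p) / p\<close>, where \<open>p\<close> is the posterior probability of \<open>{c..}\<close> for arm \<open>k\<close>. On the second
  event arm \<open>k\<close> is pulled, and there is at most one round in which \<open>k\<close> is pulled for the
  \<open>(n + 1)\<close>-st time. So the expected number of rounds of the third kind is at most the sum over
  \<open>n\<close> of the expectations of \<open>(1 - p) / p\<close> after \<open>n\<close> pulls (\<open>prob_low_samples_le\<close>,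
  \<open>sum_prob_low_samples_le\<close>). The critical case is a sample mean below \<open>c\<close>, where \<open>1 / p\<close> is at most of order
  \<open>sqrt n (1 + n y\<^sup>2 / S) powr ((n + 2 \<alpha> - 1) / 2)\<close>. Replacing the true mean by \<open>c\<close> in the law of the
  sample mean gains a factor \<open>exp (- n \<epsilon>\<^sup>2 / (2 \<sigma>\<^sup>2))\<close>. What is left is a negative moment of the
  ratio of \<open>S\<close> to the sum of squares about \<open>c\<close>, in which the powers of \<open>S\<close> cancel up to
  \<open>S powr (- \<alpha> - 1)\<close>; this is integrable at 0 exactly because \<open>\<alpha> < 0\<close>
  (\<open>nn_integral_inverse_beta_moment\<close>). The expectation is therefore of order
  \<open>n exp (- const n \<epsilon>\<^sup>2)\<close>, and its sum over \<open>n\<close> is \<open>O(\<epsilon> powr - 4)\<close>.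

  The perturbation of \<open>D_inf\<close> costs \<open>O(\<epsilon> ln T)\<close>. The choice \<open>\<epsilon> = ln T powr (- 1 / 5)\<close> balances this
  against \<open>\<epsilon> powr - 4\<close>, and both become \<open>ln T powr (4 / 5)\<close>.
\<close>

section \<open>Tails of the Student posterior\<close>

text \<open>
  The unnormalized density of a Student variable with \<open>2 a - 1\<close> degrees of freedom, divided by the
  square root of the number of degrees of freedom. In the posterior after \<open>n\<close> rewards,
  \<open>a = n / 2 + \<alpha>\<close>.
\<close>

definition student_kernel :: "real \<Rightarrow> real \<Rightarrow> real" where
  "student_kernel a v = (1 + v\<^sup>2) powr (- a)"

lemma student_kernel_measurable [measurable]: "student_kernel a \<in> borel_measurable borel"
  unfolding student_kernel_def by measurable

lemma student_kernel_pos: "0 < student_kernel a v"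
  using sum_power2_gt_zero_iff[of 1 v] by (simp add: student_kernel_def)

definition student_mass :: "real \<Rightarrow> ennreal" where
  "student_mass a = (\<integral>\<^sup>+v. ennreal (student_kernel a v) \<partial>lborel)"

lemma nn_integral_inverse_1_plus_square:
  "(\<integral>\<^sup>+x. ennreal (inverse (1 + x\<^sup>2)) \<partial>lborel) = ennreal pi"
proof -
  have i: "integrable lborel (\<lambda>x::real. inverse (1 + x\<^sup>2))"
    using integrable_inverse_1_plus_square by (simp add: set_integrable_def)
  have "(\<integral>x. inverse (1 + x\<^sup>2) \<partial>lborel) = pi"
    using LBINT_inverse_1_plus_square
    by (simp add: interval_lebesgue_integral_def set_lebesgue_integral_def)
  then show ?thesis
    by (subst nn_integral_eq_integral[OF i]) auto
qed

lemma one_plus_mult_le_powr: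
  fixes x a :: real
  assumes "0 \<le> x" "1 \<le> a"
  shows "1 + a * x \<le> (1 + x) powr a"
proof -
  have D: "((\<lambda>x. (1 + x) powr a - (1 + a * x)) has_real_derivative
      a * (1 + y) powr (a - 1) - a) (at y)" if "0 \<le> y" for y
    using that by (auto intro!: derivative_eq_intros)
  have "(1 + 0) powr a - (1 + a * 0) \<le> (1 + x) powr a - (1 + a * x)"
  proof (rule DERIV_nonneg_imp_nondecreasing[OF assms(1)])
    fix y assume y: "0 \<le> y" "y \<le> x"
    have "1 \<le> (1 + y) powr (a - 1)" using y assms by (intro ge_one_powr_ge_zero) auto
    then have "0 \<le> a * (1 + y) powr (a - 1) - a" using assms by (simp add: mult_le_cancel_left1)
    with D[OF y(1)] show "\<exists>z. ((\<lambda>x. (1 + x) powr a - (1 + a * x)) has_real_derivative z) (at y) \<and> 0 \<le> z"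
      by blast
  qed
  then show ?thesis by simp
qed

text \<open>
  By Bernoulli's inequality \<open>(1 + v\<^sup>2) powr a \<ge> 1 + a v\<^sup>2\<close>, so the kernel is dominated by a Cauchy
  density of width \<open>1 / sqrt a\<close>. The decay in \<open>a\<close> matters: with a constant bound instead, the
  estimate of the expected odds would lose a factor \<open>sqrt n\<close> and the total cost would be \<open>\<epsilon> powr - 5\<close>.
\<close>

lemma student_mass_le:
  assumes "1 \<le> a"
  shows "student_mass a \<le> ennreal (pi / sqrt a)"
proof -
  have sa: "0 < sqrt a" using assms by simp
  then have one: "ennreal (1 / sqrt a) * ennreal (sqrt a) = 1"
    by (subst ennreal_mult[symmetric]) auto
  have "student_mass a \<le> (\<integral>\<^sup>+v. ennreal (inverse (1 + (0 + sqrt a * v)\<^sup>2)) \<partial>lborel)"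
    unfolding student_mass_def
  proof (intro nn_integral_mono ennreal_leI)
    fix v :: real
    have "1 + a * v\<^sup>2 \<le> (1 + v\<^sup>2) powr a" using assms by (intro one_plus_mult_le_powr) auto
    moreover have "0 < 1 + a * v\<^sup>2" using assms by (simp add: add_pos_nonneg)
    ultimately have "inverse ((1 + v\<^sup>2) powr a) \<le> inverse (1 + a * v\<^sup>2)" by (intro le_imp_inverse_le)
    then show "student_kernel a v \<le> inverse (1 + (0 + sqrt a * v)\<^sup>2)"
      using assms by (simp add: student_kernel_def powr_minus power_mult_distrib)
  qed
  also have "\<dots> = ennreal (1 / sqrt a) * (ennreal \<bar>sqrt a\<bar> *
      (\<integral>\<^sup>+v. ennreal (inverse (1 + (0 + sqrt a * v)\<^sup>2)) \<partial>lborel))"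
    by (simp only: abs_of_pos[OF sa] mult.assoc[symmetric] one mult_1_left)
  also have "\<dots> = ennreal (1 / sqrt a) * (\<integral>\<^sup>+x. ennreal (inverse (1 + x\<^sup>2)) \<partial>lborel)"
    using sa by (subst nn_integral_real_affine[where c="sqrt a" and t=0, symmetric]) auto
  also have "\<dots> = ennreal (pi / sqrt a)"
    using assms by (simp add: nn_integral_inverse_1_plus_square ennreal_mult[symmetric])
  finally show ?thesis .
qed

lemma student_mass_finite: "1 \<le> a \<Longrightarrow> student_mass a < \<infinity>"
  using student_mass_le[of a] by (simp add: le_less_trans)

lemma student_half_mass:
  "(\<integral>\<^sup>+v. ennreal (student_kernel a v) * indicator {0..} v \<partial>lborel) * 2 = student_mass a"
proof -
  let ?h = "\<integral>\<^sup>+v. ennreal (student_kernel a v) * indicator {0..} v \<partial>lborel"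
  have "student_mass a = (\<integral>\<^sup>+v. ennreal (student_kernel a v) * indicator {0..} v +
      ennreal (student_kernel a v) * indicator {..0} v \<partial>lborel)"
    unfolding student_mass_def
    by (intro nn_integral_cong_AE AE_I[where N="{0}"]) (auto split: split_indicator)
  also have "\<dots> = ?h + (\<integral>\<^sup>+v. ennreal (student_kernel a v) * indicator {..0} v \<partial>lborel)"
    by (rule nn_integral_add) auto
  also have "(\<integral>\<^sup>+v. ennreal (student_kernel a v) * indicator {..0} v \<partial>lborel) = ?h"
    by (subst nn_integral_real_affine[where c="-1" and t=0])
       (auto intro!: nn_integral_cong simp: student_kernel_def split: split_indicator)
  finally show ?thesis by (simp add: mult_2_right)
qed

text \<open>
  The substitution \<open>v = w + sqrt (1 + w\<^sup>2) z\<close> maps \<open>{0..}\<close> onto the tail, and for \<open>w, z \<ge> 0\<close> it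
  satisfies \<open>1 + v\<^sup>2 \<ge> (1 + w\<^sup>2) (1 + z\<^sup>2)\<close>. This bounds the tail by a multiple of the half mass, so
  that the normalizing constant of the density cancels later on.
\<close>

lemma student_upper_tail:
  assumes "0 \<le> w" "1 \<le> a"
  shows "(\<integral>\<^sup>+v. ennreal (student_kernel a v) * indicator {w..} v \<partial>lborel) * 2 \<le>
    ennreal ((1 + w\<^sup>2) powr (1 / 2 - a)) * student_mass a"
proof -
  define r where "r = sqrt (1 + w\<^sup>2)"
  have r: "0 < r" "r\<^sup>2 = 1 + w\<^sup>2" by (auto simp: r_def add_pos_nonneg)
  have r2: "r * (1 + w\<^sup>2) powr (- a) = (1 + w\<^sup>2) powr (1 / 2 - a)"
    using r by (simp add: r_def powr_half_sqrt[symmetric] powr_add[symmetric])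
  have "(\<integral>\<^sup>+v. ennreal (student_kernel a v) * indicator {w..} v \<partial>lborel) =
      ennreal r * (\<integral>\<^sup>+z. ennreal (student_kernel a (w + r * z)) * indicator {w..} (w + r * z) \<partial>lborel)"
    using r by (subst nn_integral_real_affine[where c=r and t=w]) auto
  also have "\<dots> \<le> ennreal r * (\<integral>\<^sup>+z. ennreal ((1 + w\<^sup>2) powr (- a)) *
      (ennreal (student_kernel a z) * indicator {0..} z) \<partial>lborel)"
  proof (intro mult_left_mono nn_integral_mono)
    fix z :: real
    show "ennreal (student_kernel a (w + r * z)) * indicator {w..} (w + r * z) \<le>
      ennreal ((1 + w\<^sup>2) powr (- a)) * (ennreal (student_kernel a z) * indicator {0..} z)"
    proof (cases "0 \<le> z")
      case True
      have "(1 + w\<^sup>2) * (1 + z\<^sup>2) = 1 + w\<^sup>2 + r\<^sup>2 * z\<^sup>2" using r by (simp add: algebra_simps)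
      also have "\<dots> \<le> 1 + (w + r * z)\<^sup>2" using True r assms by (simp add: power2_sum power_mult_distrib)
      finally have "student_kernel a (w + r * z) \<le> ((1 + w\<^sup>2) * (1 + z\<^sup>2)) powr (- a)"
        unfolding student_kernel_def using assms
        by (intro powr_mono2') (auto intro!: mult_pos_pos add_pos_nonneg)
      also have "\<dots> = (1 + w\<^sup>2) powr (- a) * student_kernel a z"
        by (simp add: student_kernel_def powr_mult add_nonneg_nonneg)
      finally show ?thesis using True
        by (simp add: ennreal_mult'[symmetric] ennreal_leI split: split_indicator)
    next
      case False
      then have "\<not> w \<le> w + r * z" using r by (simp add: mult_less_0_iff not_le)
      then show ?thesis by simp
    qed
  qed simp
  also have "\<dots> = ennreal ((1 + w\<^sup>2) powr (1 / 2 - a)) *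
      (\<integral>\<^sup>+v. ennreal (student_kernel a v) * indicator {0..} v \<partial>lborel)"
    using r by (subst nn_integral_cmult) (auto simp: mult.assoc[symmetric] ennreal_mult[symmetric] r2)
  finally show ?thesis
    unfolding student_half_mass[symmetric] mult.assoc[symmetric] by (rule mult_right_mono) simp
qed

text \<open>
  Inserting the factor \<open>v / sqrt (1 + v\<^sup>2) \<le> 1\<close> makes the integrand an exact derivative.
\<close>

lemma student_tail_lower_bound:
  assumes "0 \<le> w" "1 \<le> a"
  shows "ennreal ((1 + w\<^sup>2) powr (1 / 2 - a) / (2 * a - 1)) \<le>
    (\<integral>\<^sup>+v. ennreal (student_kernel a v) * indicator {w..} v \<partial>lborel)"
proof -
  let ?F = "\<lambda>v::real. - ((1 + v\<^sup>2) powr (1 / 2 - a) / (2 * a - 1))"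
  let ?f = "\<lambda>v::real. v * (1 + v\<^sup>2) powr (- a - 1 / 2)"
  have pos: "0 < 1 + v\<^sup>2" for v :: real by (simp add: add_pos_nonneg)
  have "(\<integral>\<^sup>+v. ennreal (?f v) * indicator {w..} v \<partial>lborel) = ennreal (0 - ?F w)"
  proof (rule nn_integral_FTC_atLeast)
    fix v :: real assume v: "w \<le> v"
    show "0 \<le> ?f v" using v assms by simp
    have "(?F has_real_derivative - (2 * v * (1 / 2 - a) * (1 + v\<^sup>2) powr (1 / 2 - a - 1) / (2 * a - 1))) (at v)"
      using assms pos[of v] by (auto intro!: derivative_eq_intros)
    moreover have "- (2 * v * (1 / 2 - a) * (1 + v\<^sup>2) powr (1 / 2 - a - 1) / (2 * a - 1)) =
       (1 + v\<^sup>2) powr (1 / 2 - a - 1) * v * ((2 * a - 1) / (2 * a - 1))"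
      by (simp add: field_simps)
    moreover have "\<dots> = ?f v"
    proof -
      have "(2 * a - 1) / (2 * a - 1) = 1" "1 / 2 - a - 1 = - a - 1 / 2" using assms by auto
      then show ?thesis by (simp only: mult_1_right mult.commute)
    qed
    ultimately show "(?F has_real_derivative ?f v) (at v)" by (simp only:)
  next
    have "filterlim (\<lambda>v::real. 1 + v\<^sup>2) at_top at_top"
      by (intro filterlim_tendsto_add_at_top[OF tendsto_const] filterlim_pow_at_top filterlim_ident) auto
    then have "((\<lambda>v::real. (1 + v\<^sup>2) powr (1 / 2 - a)) \<longlongrightarrow> 0) at_top"
      using assms by (intro tendsto_neg_powr) auto
    from tendsto_minus[OF tendsto_divide[OF this tendsto_const]] show "(?F \<longlongrightarrow> 0) at_top"
      using assms by simp
  qed measurable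
  then have "ennreal ((1 + w\<^sup>2) powr (1 / 2 - a) / (2 * a - 1)) =
      (\<integral>\<^sup>+v. ennreal (?f v) * indicator {w..} v \<partial>lborel)" by simp
  also have "\<dots> \<le> (\<integral>\<^sup>+v. ennreal (student_kernel a v) * indicator {w..} v \<partial>lborel)"
  proof (intro nn_integral_mono mult_right_mono ennreal_leI)
    fix v :: real
    have "v \<le> sqrt (1 + v\<^sup>2)" by (rule real_le_rsqrt) simp
    then have "?f v \<le> sqrt (1 + v\<^sup>2) * (1 + v\<^sup>2) powr (- a - 1 / 2)"
      by (rule mult_right_mono) simp
    also have "\<dots> = student_kernel a v"
      using pos[of v] by (simp add: powr_half_sqrt[symmetric] powr_add[symmetric] student_kernel_def)
    finally show "?f v \<le> student_kernel a v" .
  qed simp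
  finally show ?thesis .
qed

lemma student_mass_pos: "1 \<le> a \<Longrightarrow> 0 < student_mass a"
proof -
  assume a: "1 \<le> a"
  have "0 < ennreal ((1 + 0\<^sup>2) powr (1 / 2 - a) / (2 * a - 1))" using a by simp
  also have "\<dots> \<le> (\<integral>\<^sup>+v. ennreal (student_kernel a v) * indicator {0..} v \<partial>lborel)"
    using a by (intro student_tail_lower_bound) auto
  also have "\<dots> \<le> student_mass a"
    unfolding student_mass_def by (intro nn_integral_mono) (auto split: split_indicator)
  finally show ?thesis .
qed

text \<open>
  In the coordinate \<open>v = sqrt (n / S) (m - x)\<close> the posterior is the normalized Student kernel.
\<close>

lemma emeasure_posterior:
  assumes "0 < n" "0 < S" and a: "1 \<le> real n / 2 + \<alpha>" and [measurable]: "A \<in> sets borel"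
  shows "emeasure (posterior \<alpha> n x S) A =
    (\<integral>\<^sup>+v. ennreal (student_kernel (real n / 2 + \<alpha>) v) * indicator A (x + v / sqrt (real n / S)) \<partial>lborel) /
      student_mass (real n / 2 + \<alpha>)"
proof -
  let ?a = "real n / 2 + \<alpha>" and ?b = "sqrt (real n / S)"
  have b: "0 < ?b" "?b\<^sup>2 = real n / S" using assms by simp_all
  have [measurable]: "posterior_weight \<alpha> n x S \<in> borel_measurable borel"
    unfolding posterior_weight_def by measurable
  have W: "posterior_weight \<alpha> n x S (x + v / ?b) = student_kernel ?a v" for v
    using assms by (simp add: posterior_weight_def student_kernel_def power_divide)
  have aff: "(\<integral>\<^sup>+m. f m \<partial>lborel) = ennreal (1 / ?b) * (\<integral>\<^sup>+v. f (x + v / ?b) \<partial>lborel)"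
    if "f \<in> borel_measurable borel" for f :: "real \<Rightarrow> ennreal"
    using b assms that by (subst nn_integral_real_affine[where c="1 / ?b" and t=x]) auto
  define I where "I = (\<integral>m'. posterior_weight \<alpha> n x S m' \<partial>lborel)"
  define Z where "Z = enn2real (student_mass ?a)"
  have Z: "student_mass ?a = ennreal Z" using student_mass_finite[OF a] by (simp add: Z_def less_top)
  have Z0: "0 < Z" using student_mass_pos[OF a] unfolding Z by simp
  have "I = enn2real (\<integral>\<^sup>+m. ennreal (posterior_weight \<alpha> n x S m) \<partial>lborel)"
    unfolding I_def by (rule integral_eq_nn_integral) (auto simp: posterior_weight_def)
  also have "\<dots> = Z / ?b" using Z0 b
    by (subst aff) (auto simp add: W student_mass_def[symmetric] Z ennreal_mult[symmetric])
  finally have I: "I = Z / ?b" .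
  have Ib: "0 \<le> 1 / I" "0 \<le> 1 / ?b" using Z0 b by (simp_all add: I)
  have "emeasure (posterior \<alpha> n x S) A =
      (\<integral>\<^sup>+m. ennreal (posterior_weight \<alpha> n x S m / I) * indicator A m \<partial>lborel)"
    unfolding posterior_def I_def by (subst emeasure_density) auto
  also have "\<dots> = ennreal (1 / ?b) *
      (\<integral>\<^sup>+v. ennreal (student_kernel ?a v / I) * indicator A (x + v / ?b) \<partial>lborel)"
    by (subst aff) (auto simp: W)
  also have "\<dots> = ennreal (1 / ?b) *
      (\<integral>\<^sup>+v. ennreal (1 / I) * (ennreal (student_kernel ?a v) * indicator A (x + v / ?b)) \<partial>lborel)"
    using Z0 b by (intro arg_cong[where f="\<lambda>t. _ * t"] nn_integral_cong)
      (auto simp: I ennreal_mult[symmetric] student_kernel_pos less_imp_le mult_ac split: split_indicator)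
  also have "\<dots> = ennreal (1 / ?b * (1 / I)) *
      (\<integral>\<^sup>+v. ennreal (student_kernel ?a v) * indicator A (x + v / ?b) \<partial>lborel)"
    using Ib b(1) by (subst nn_integral_cmult) (simp_all only: ennreal_mult less_imp_le mult.assoc, measurable)
  also have "1 / ?b * (1 / I) = inverse Z" using b Z0 assms(1,2) by (simp add: I field_simps)
  finally show ?thesis using Z0 by (simp add: Z divide_ennreal_def inverse_ennreal mult.commute)
qed

context
  fixes n :: nat and S \<alpha> x y :: real
  assumes n: "0 < n" and S: "0 < S" and a: "1 \<le> real n / 2 + \<alpha>"
begin

lemma student_mass_real:
  obtains Z where "0 < Z" "student_mass (real n / 2 + \<alpha>) = ennreal Z" "Z \<le> pi / sqrt (real n / 2 + \<alpha>)"
proof -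
  obtain Z where Z: "0 \<le> Z" "student_mass (real n / 2 + \<alpha>) = ennreal Z"
    using student_mass_finite[OF a] by (cases "student_mass (real n / 2 + \<alpha>)") auto
  moreover from Z have "0 < Z" using student_mass_pos[OF a] by simp
  moreover from Z have "Z \<le> pi / sqrt (real n / 2 + \<alpha>)"
    using student_mass_le[OF a] a by simp
  ultimately show ?thesis using that by blast
qed

lemma prob_space_posterior: "prob_space (posterior \<alpha> n x S)"
proof
  obtain Z where Z: "0 < Z" "student_mass (real n / 2 + \<alpha>) = ennreal Z" using student_mass_real by blast
  have "space (posterior \<alpha> n x S) = UNIV" by (simp add: posterior_def)
  then show "emeasure (posterior \<alpha> n x S) (space (posterior \<alpha> n x S)) = 1"
    using Z by (simp add: emeasure_posterior[OF n S a] student_mass_def[symmetric] divide_ennreal)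
qed

lemma posterior_upper_tail:
  assumes "0 \<le> y"
  shows "measure (posterior \<alpha> n x S) {x + y..} \<le>
    (1 + real n * y\<^sup>2 / S) powr (- (real n + 2 * \<alpha> - 1) / 2) / 2"
proof -
  interpret prob_space "posterior \<alpha> n x S" by (rule prob_space_posterior)
  obtain Z where Z: "0 < Z" "student_mass (real n / 2 + \<alpha>) = ennreal Z" using student_mass_real by blast
  let ?a = "real n / 2 + \<alpha>" and ?w = "y * sqrt (real n / S)"
  have b: "0 < sqrt (real n / S)" using n S by simp
  have iff: "y \<le> v / sqrt (real n / S) \<longleftrightarrow> ?w \<le> v" for v
    using b by (simp add: field_simps)
  have w2: "?w\<^sup>2 = real n * y\<^sup>2 / S" using n S by (simp add: power_mult_distrib)
  have "emeasure (posterior \<alpha> n x S) {x + y..} * 2 =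
     (\<integral>\<^sup>+v. ennreal (student_kernel ?a v) * indicator {?w..} v \<partial>lborel) * 2 / ennreal Z"
    by (simp add: emeasure_posterior[OF n S a] Z indicator_def iff divide_ennreal_def mult_ac)
  also have "\<dots> \<le> ennreal ((1 + ?w\<^sup>2) powr (1 / 2 - ?a)) * ennreal Z / ennreal Z"
    unfolding divide_ennreal_def
    using student_upper_tail[of ?w ?a] assms b a Z by (intro mult_right_mono) auto
  also have "\<dots> = ennreal ((1 + ?w\<^sup>2) powr (1 / 2 - ?a))"
    using Z(1) by (simp add: ennreal_mult[symmetric] divide_ennreal)
  finally have "ennreal (measure (posterior \<alpha> n x S) {x + y..} * 2) \<le> ennreal ((1 + ?w\<^sup>2) powr (1 / 2 - ?a))"
    by (simp add: emeasure_eq_measure ennreal_mult'')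
  then have "measure (posterior \<alpha> n x S) {x + y..} * 2 \<le> (1 + real n * y\<^sup>2 / S) powr (1 / 2 - ?a)"
    unfolding w2 by (subst (asm) ennreal_le_iff) auto
  also have "1 / 2 - ?a = - (real n + 2 * \<alpha> - 1) / 2" by (simp add: field_simps)
  finally show ?thesis by simp
qed

lemma posterior_symmetric: "measure (posterior \<alpha> n x S) {..x - y} = measure (posterior \<alpha> n x S) {x + y..}"
proof -
  let ?a = "real n / 2 + \<alpha>" and ?b = "sqrt (real n / S)"
  have "(\<integral>\<^sup>+v. ennreal (student_kernel ?a v) * indicator {..x - y} (x + v / ?b) \<partial>lborel) =
    (\<integral>\<^sup>+v. ennreal (student_kernel ?a v) * indicator {x + y..} (x + v / ?b) \<partial>lborel)"
    by (subst nn_integral_real_affine[where c="-1" and t=0])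
       (auto intro!: nn_integral_cong simp: student_kernel_def split: split_indicator)
  then show ?thesis by (simp add: measure_def emeasure_posterior[OF n S a])
qed

lemma posterior_upper_tail_ge:
  assumes "0 \<le> y"
  shows "(1 + real n * y\<^sup>2 / S) powr (- (real n + 2 * \<alpha> - 1) / 2) / (2 * pi * sqrt (real n / 2 + \<alpha>)) \<le>
    measure (posterior \<alpha> n x S) {x + y..}"
proof -
  interpret prob_space "posterior \<alpha> n x S" by (rule prob_space_posterior)
  let ?a = "real n / 2 + \<alpha>" and ?w = "y * sqrt (real n / S)"
  obtain Z where Z: "0 < Z" "student_mass ?a = ennreal Z" "Z \<le> pi / sqrt ?a"
    using student_mass_real by blast
  have b: "0 < sqrt (real n / S)" using n S by simp
  have iff: "y \<le> v / sqrt (real n / S) \<longleftrightarrow> ?w \<le> v" for v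
    using b by (simp add: field_simps)
  have w2: "?w\<^sup>2 = real n * y\<^sup>2 / S" using n S by (simp add: power_mult_distrib)
  let ?q = "(1 + ?w\<^sup>2) powr (1 / 2 - ?a)"
  have "ennreal (?q / (2 * ?a - 1) / Z) = ennreal (?q / (2 * ?a - 1)) / ennreal Z"
    using Z a by (subst divide_ennreal) auto
  also have "\<dots> \<le> emeasure (posterior \<alpha> n x S) {x + y..}"
    unfolding emeasure_posterior[OF n S a atLeast_borel] Z divide_ennreal_def
    using student_tail_lower_bound[of ?w ?a] assms b a by (simp add: indicator_def iff mult_right_mono)
  finally have 1: "?q / (2 * ?a - 1) / Z \<le> measure (posterior \<alpha> n x S) {x + y..}"
    by (simp add: emeasure_eq_measure)
  have "(2 * ?a - 1) * Z \<le> 2 * ?a * (pi / sqrt ?a)"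
    using Z a by (intro mult_mono) auto
  also have "\<dots> = 2 * pi * sqrt ?a"
  proof -
    have "2 * ?a * (pi / sqrt ?a) = 2 * pi * (?a / sqrt ?a)" by simp
    then show ?thesis using real_div_sqrt[of ?a] a by simp
  qed
  finally have "?q / (2 * pi * sqrt ?a) \<le> ?q / ((2 * ?a - 1) * Z)"
    using Z a by (intro divide_left_mono mult_pos_pos) auto
  also have "\<dots> \<le> measure (posterior \<alpha> n x S) {x + y..}"
    using 1 by (simp only: divide_divide_eq_left)
  also have "1 / 2 - ?a = - (real n + 2 * \<alpha> - 1) / 2" by (simp add: field_simps)
  finally show ?thesis unfolding w2 .
qed

end

section \<open>Chi-squared laws and rotations of the Gaussian plane\<close>

text \<open>
  The laws of the two statistics of an arm are handled as measures: for standard normal rewards,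
  \<open>sqrt n\<close> times the sample mean and the sum of squared deviations are independent, with law
  \<open>std_normal\<close> and a chi-squared law.
\<close>

abbreviation std_normal :: "real measure" where
  "std_normal \<equiv> density lborel (\<lambda>x. ennreal (std_normal_density x))"

interpretation std_normal: prob_space std_normal
  by (rule prob_space_normal_density) simp

text \<open>
  The chi-squared density with \<open>2 a\<close> degrees of freedom.
\<close>

definition chi_sq_density :: "real \<Rightarrow> real \<Rightarrow> real" where
  "chi_sq_density a s = indicator {0<..} s * s powr (a - 1) * exp (- s / 2) / (2 powr a * Gamma a)"

definition chi_sq :: "real \<Rightarrow> real measure" where
  "chi_sq a = density lborel (\<lambda>s. ennreal (chi_sq_density a s))"

lemma chi_sq_density_measurable [measurable]: "chi_sq_density a \<in> borel_measurable borel"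
  unfolding chi_sq_density_def by measurable

lemma chi_sq_density_nonneg: "0 < a \<Longrightarrow> 0 \<le> chi_sq_density a s"
  by (simp add: chi_sq_density_def Gamma_real_pos less_imp_le)

lemma sets_chi_sq [simp, measurable_cong]: "sets (chi_sq a) = sets borel"
  by (simp add: chi_sq_def)

lemma space_chi_sq [simp]: "space (chi_sq a) = UNIV"
  by (simp add: chi_sq_def)

lemma Gamma_nn_integral_scaled:
  assumes "0 < a" "0 < c"
  shows "(\<integral>\<^sup>+s. ennreal (indicator {0<..} s * s powr (a - 1) * exp (- s * c)) \<partial>lborel) =
    ennreal (Gamma a / c powr a)"
proof -
  have "ennreal (Gamma a) = (\<integral>\<^sup>+t. ennreal (indicator {0<..} t * t powr (a - 1) * exp (- t)) \<partial>lborel)"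
    unfolding Gamma_conv_nn_integral_real[OF assms(1)]
    by (intro nn_integral_cong_AE AE_I[where N="{0}"])
       (auto simp: exp_minus divide_inverse split: split_indicator)
  also have "\<dots> = ennreal c * (\<integral>\<^sup>+s. ennreal (indicator {0<..} (c * s) * (c * s) powr (a - 1) * exp (- (c * s))) \<partial>lborel)"
    using assms by (subst nn_integral_real_affine[where c=c and t=0]) auto
  also have "\<dots> = ennreal c * (\<integral>\<^sup>+s. ennreal (c powr (a - 1)) * ennreal (indicator {0<..} s * s powr (a - 1) * exp (- s * c)) \<partial>lborel)"
    using assms by (intro arg_cong[where f="\<lambda>t. _ * t"] nn_integral_cong)
      (auto simp: ennreal_mult[symmetric] powr_mult zero_less_mult_iff mult_ac split: split_indicator)
  also have "\<dots> = ennreal (c * c powr (a - 1)) * (\<integral>\<^sup>+s. ennreal (indicator {0<..} s * s powr (a - 1) * exp (- s * c)) \<partial>lborel)"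
    using assms by (subst nn_integral_cmult) (auto simp: ennreal_mult mult.assoc)
  also have "c * c powr (a - 1) = c powr a"
    using assms by (simp add: powr_mult_base)
  finally have "ennreal (1 / c powr a) * ennreal (Gamma a) = ennreal (1 / c powr a) * ennreal (c powr a) *
    (\<integral>\<^sup>+s. ennreal (indicator {0<..} s * s powr (a - 1) * exp (- s * c)) \<partial>lborel)"
    by (simp only: mult.assoc)
  moreover have "ennreal (1 / c powr a) * ennreal (c powr a) = 1"
    using assms by (subst ennreal_mult[symmetric]) auto
  moreover have "ennreal (1 / c powr a) * ennreal (Gamma a) = ennreal (Gamma a / c powr a)"
    using assms by (subst ennreal_mult[symmetric]) (auto simp: Gamma_real_pos less_imp_le)
  ultimately show ?thesis by simp
qed

lemma prob_space_chi_sq: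
  assumes "0 < a" shows "prob_space (chi_sq a)"
proof
  have "emeasure (chi_sq a) UNIV = (\<integral>\<^sup>+s. ennreal (chi_sq_density a s) \<partial>lborel)"
    unfolding chi_sq_def by (subst emeasure_density) auto
  also have "\<dots> = (\<integral>\<^sup>+s. ennreal (1 / (2 powr a * Gamma a)) *
      ennreal (indicator {0<..} s * s powr (a - 1) * exp (- s * (1 / 2))) \<partial>lborel)"
    using assms by (intro nn_integral_cong)
      (auto simp: chi_sq_density_def ennreal_mult[symmetric] Gamma_real_pos less_imp_le)
  also have "\<dots> = ennreal (1 / (2 powr a * Gamma a)) * ennreal (Gamma a / (1 / 2) powr a)"
    using Gamma_nn_integral_scaled[OF assms, of "1 / 2"] by (subst nn_integral_cmult) auto
  also have "\<dots> = 1"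
    using Gamma_real_pos[OF assms] by (subst ennreal_mult[symmetric]) (auto simp: powr_divide)
  finally show "emeasure (chi_sq a) (space (chi_sq a)) = 1" by simp
qed

text \<open>
  Two standard normal coordinates, rotated (and reflected) by an orthogonal matrix, are again
  independent and standard normal: the product density depends on \<open>u\<^sup>2 + x\<^sup>2\<close> only, and the plane
  Lebesgue measure is preserved. The latter is seen by substituting one coordinate at a time,
  where the two Jacobian factors \<open>1 / s\<close> and \<open>s\<close> cancel.
\<close>

lemma nn_integral_rotation:
  assumes [measurable]: "case_prod F \<in> borel_measurable (borel \<Otimes>\<^sub>M borel)"
    and cs: "c\<^sup>2 + s\<^sup>2 = 1" "s \<noteq> 0"
  shows "(\<integral>\<^sup>+u. \<integral>\<^sup>+x. F (c * u + s * x) (s * u - c * x) \<partial>std_normal \<partial>std_normal) =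
    (\<integral>\<^sup>+a. \<integral>\<^sup>+b. F a b \<partial>std_normal \<partial>std_normal)"
proof -
  define g where "g a b = ennreal (std_normal_density a) * ennreal (std_normal_density b) * F a b" for a b
  have g[measurable]: "case_prod g \<in> borel_measurable (borel \<Otimes>\<^sub>M borel)" unfolding g_def by measurable
  have dens: "(\<integral>\<^sup>+u. \<integral>\<^sup>+x. f u x \<partial>std_normal \<partial>std_normal) =
     (\<integral>\<^sup>+u. \<integral>\<^sup>+x. ennreal (std_normal_density u) * ennreal (std_normal_density x) * f u x \<partial>lborel \<partial>lborel)"
    if [measurable]: "case_prod f \<in> borel_measurable (borel \<Otimes>\<^sub>M borel)" for f
    by (simp add: nn_integral_density nn_integral_cmult[symmetric] mult.assoc)
  have sq: "(c * u + s * x)\<^sup>2 + (s * u - c * x)\<^sup>2 = u\<^sup>2 + x\<^sup>2" for u x :: real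
  proof -
    have "(c * u + s * x)\<^sup>2 + (s * u - c * x)\<^sup>2 = (c\<^sup>2 + s\<^sup>2) * (u\<^sup>2 + x\<^sup>2)"
      by (simp add: power2_eq_square algebra_simps)
    then show ?thesis using cs by simp
  qed
  have phi: "std_normal_density u * std_normal_density x =
      1 / (2 * pi) * exp (- (u\<^sup>2 + x\<^sup>2) / 2)" for u x
    by (simp add: std_normal_density_def exp_add[symmetric] add_divide_distrib)
  have "(\<integral>\<^sup>+u. \<integral>\<^sup>+x. F (c * u + s * x) (s * u - c * x) \<partial>std_normal \<partial>std_normal) =
      (\<integral>\<^sup>+u. \<integral>\<^sup>+x. g (c * u + s * x) (s * u - c * x) \<partial>lborel \<partial>lborel)"
    by (subst dens) (auto simp: g_def ennreal_mult[symmetric] phi sq)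
  also have "\<dots> = (\<integral>\<^sup>+u. \<integral>\<^sup>+a. ennreal \<bar>1 / s\<bar> * g a (u / s - c * a / s) \<partial>lborel \<partial>lborel)"
  proof (rule nn_integral_cong)
    fix u :: real
    have "c * u + s * (- c * u / s + 1 / s * a) = a" for a using cs by (simp add: field_simps)
    moreover have "s * u - c * (- c * u / s + 1 / s * a) = u / s - c * a / s" for a
    proof -
      have "s * u - c * (- c * u / s + 1 / s * a) = (c\<^sup>2 + s\<^sup>2) * u / s - c * a / s"
        using cs(2) by (simp add: field_simps power2_eq_square)
      then show ?thesis using cs by simp
    qed
    ultimately show "(\<integral>\<^sup>+x. g (c * u + s * x) (s * u - c * x) \<partial>lborel) =
        (\<integral>\<^sup>+a. ennreal \<bar>1 / s\<bar> * g a (u / s - c * a / s) \<partial>lborel)"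
      using cs by (subst nn_integral_real_affine[where c="1 / s" and t="- c * u / s"])
        (auto simp: nn_integral_cmult)
  qed
  also have "\<dots> = (\<integral>\<^sup>+a. \<integral>\<^sup>+u. ennreal \<bar>1 / s\<bar> * g a (u / s - c * a / s) \<partial>lborel \<partial>lborel)"
    by (rule lborel_pair.Fubini') measurable
  also have "\<dots> = (\<integral>\<^sup>+a. \<integral>\<^sup>+b. g a b \<partial>lborel \<partial>lborel)"
  proof (rule nn_integral_cong)
    fix a :: real
    have "(c * a + s * b) / s - c * a / s = b" for b using cs by (simp add: field_simps)
    moreover have "ennreal \<bar>s\<bar> * ennreal \<bar>1 / s\<bar> = 1"
      using cs by (subst ennreal_mult[symmetric]) auto
    ultimately show "(\<integral>\<^sup>+u. ennreal \<bar>1 / s\<bar> * g a (u / s - c * a / s) \<partial>lborel) = (\<integral>\<^sup>+b. g a b \<partial>lborel)"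
      using cs by (subst nn_integral_real_affine[where c=s and t="c * a"])
        (auto simp: nn_integral_cmult mult.assoc[symmetric])
  qed
  also have "\<dots> = (\<integral>\<^sup>+a. \<integral>\<^sup>+b. F a b \<partial>std_normal \<partial>std_normal)"
    unfolding dens[OF assms(1)] g_def ..
  finally show ?thesis .
qed

text \<open>
  Integrating over the parabolas \<open>s + u\<^sup>2 = r\<close> scales like \<open>r powr (a - 1 / 2)\<close>, up to a constant
  that does not depend on \<open>G\<close>. Evaluating both sides at \<open>G r = exp (- r / 2)\<close> identifies this
  constant. The identity serves twice: it yields the convolution of a chi-squared law with the
  square of a normal variable, and the negative moment that decides the influence of the prior.
\<close>

lemma nn_integral_plus_square_powr:
  fixes G :: "real \<Rightarrow> ennreal"
  assumes [measurable]: "G \<in> borel_measurable borel" and a: "0 < a"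
  shows "(\<integral>\<^sup>+s. \<integral>\<^sup>+u. ennreal (indicator {0<..} s * s powr (a - 1)) * G (s + u\<^sup>2) \<partial>lborel \<partial>lborel) =
    ennreal (sqrt pi * Gamma a / Gamma (a + 1 / 2)) *
      (\<integral>\<^sup>+r. ennreal (indicator {0<..} r * r powr (a - 1 / 2)) * G r \<partial>lborel)"
proof -
  define c where "c = (\<integral>\<^sup>+u. ennreal (indicator {0<..} (1 - u\<^sup>2) * (1 - u\<^sup>2) powr (a - 1)) \<partial>lborel)"
  let ?L = "\<lambda>G. \<integral>\<^sup>+s. \<integral>\<^sup>+u. ennreal (indicator {0<..} s * s powr (a - 1)) * G (s + u\<^sup>2) \<partial>lborel \<partial>lborel"
  let ?R = "\<lambda>G. \<integral>\<^sup>+r. ennreal (indicator {0<..} r * r powr (a - 1 / 2)) * G r \<partial>lborel"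
  have main: "?L G = c * ?R G" if [measurable]: "G \<in> borel_measurable borel" for G :: "real \<Rightarrow> ennreal"
  proof -
    have "?L G = (\<integral>\<^sup>+u. \<integral>\<^sup>+s. ennreal (indicator {0<..} s * s powr (a - 1)) * G (s + u\<^sup>2) \<partial>lborel \<partial>lborel)"
      by (rule lborel_pair.Fubini') measurable
    also have "\<dots> = (\<integral>\<^sup>+u. \<integral>\<^sup>+r. ennreal (indicator {0<..} (r - u\<^sup>2) * (r - u\<^sup>2) powr (a - 1)) * G r \<partial>lborel \<partial>lborel)"
    proof (rule nn_integral_cong)
      fix u :: real
      show "(\<integral>\<^sup>+s. ennreal (indicator {0<..} s * s powr (a - 1)) * G (s + u\<^sup>2) \<partial>lborel) =
        (\<integral>\<^sup>+r. ennreal (indicator {0<..} (r - u\<^sup>2) * (r - u\<^sup>2) powr (a - 1)) * G r \<partial>lborel)"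
        by (subst nn_integral_real_affine[where c=1 and t="- u\<^sup>2"]) auto
    qed
    also have "\<dots> = (\<integral>\<^sup>+r. \<integral>\<^sup>+u. ennreal (indicator {0<..} (r - u\<^sup>2) * (r - u\<^sup>2) powr (a - 1)) * G r \<partial>lborel \<partial>lborel)"
      by (rule lborel_pair.Fubini') measurable
    also have "\<dots> = (\<integral>\<^sup>+r. c * (ennreal (indicator {0<..} r * r powr (a - 1 / 2)) * G r) \<partial>lborel)"
    proof (rule nn_integral_cong)
      fix r :: real
      show "(\<integral>\<^sup>+u. ennreal (indicator {0<..} (r - u\<^sup>2) * (r - u\<^sup>2) powr (a - 1)) * G r \<partial>lborel) =
        c * (ennreal (indicator {0<..} r * r powr (a - 1 / 2)) * G r)"
      proof (cases "0 < r")
        case True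
        have e: "r - (sqrt r * u)\<^sup>2 = r * (1 - u\<^sup>2)" for u
          using True by (simp add: power_mult_distrib algebra_simps)
        have "(\<integral>\<^sup>+u. ennreal (indicator {0<..} (r - u\<^sup>2) * (r - u\<^sup>2) powr (a - 1)) \<partial>lborel) =
            ennreal (sqrt r) * (\<integral>\<^sup>+u. ennreal (indicator {0<..} (r - (sqrt r * u)\<^sup>2) * (r - (sqrt r * u)\<^sup>2) powr (a - 1)) \<partial>lborel)"
          using True by (subst nn_integral_real_affine[where c="sqrt r" and t=0]) auto
        also have "\<dots> = ennreal (sqrt r) * (\<integral>\<^sup>+u. ennreal (r powr (a - 1)) *
            ennreal (indicator {0<..} (1 - u\<^sup>2) * (1 - u\<^sup>2) powr (a - 1)) \<partial>lborel)"
          unfolding e using True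
          by (intro arg_cong[where f="\<lambda>t. _ * t"] nn_integral_cong)
             (auto simp: ennreal_mult[symmetric] powr_mult zero_less_mult_iff split: split_indicator)
        also have "\<dots> = ennreal (sqrt r * r powr (a - 1)) * c"
          using True by (subst nn_integral_cmult) (auto simp: c_def ennreal_mult mult.assoc)
        also have "sqrt r * r powr (a - 1) = r powr (a - 1 / 2)"
          using True by (simp add: powr_half_sqrt[symmetric] powr_add[symmetric])
        finally show ?thesis using True by (subst nn_integral_multc) (auto simp: mult_ac)
      next
        case False
        then have "indicator {0<..} (r - u\<^sup>2) = (0::real)" for u
          by (auto simp: indicator_def not_less intro: order_trans)
        then show ?thesis using False by simp
      qed
    qed
    also have "\<dots> = c * ?R G" by (rule nn_integral_cmult) measurable
    finally show ?thesis .
  qed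
  have gauss: "(\<integral>\<^sup>+u. ennreal (exp (- (u\<^sup>2) / 2)) \<partial>lborel) = ennreal (sqrt (2 * pi))"
  proof -
    have "(\<integral>\<^sup>+u. ennreal (exp (- (u\<^sup>2) / 2)) \<partial>lborel) = (\<integral>\<^sup>+u. ennreal (sqrt (2 * pi)) * ennreal (std_normal_density u) \<partial>lborel)"
      by (intro nn_integral_cong) (auto simp: std_normal_density_def ennreal_mult[symmetric])
    also have "\<dots> = ennreal (sqrt (2 * pi)) * emeasure std_normal UNIV"
      by (subst nn_integral_cmult) (auto simp: emeasure_density)
    finally show ?thesis using std_normal.emeasure_space_1 by simp
  qed
  let ?e = "\<lambda>r::real. ennreal (exp (- r / 2))"
  have "?L ?e = (\<integral>\<^sup>+s. ennreal (indicator {0<..} s * s powr (a - 1) * exp (- s * (1 / 2))) * ennreal (sqrt (2 * pi)) \<partial>lborel)"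
    unfolding gauss[symmetric]
    by (subst nn_integral_cmult[symmetric])
       (auto intro!: nn_integral_cong simp: ennreal_mult[symmetric] exp_add[symmetric] add_divide_distrib mult_ac)
  also have "\<dots> = ennreal (Gamma a / (1 / 2) powr a) * ennreal (sqrt (2 * pi))"
    using Gamma_nn_integral_scaled[OF a, of "1 / 2"] by (subst nn_integral_multc) auto
  also have "\<dots> = ennreal (Gamma a / (1 / 2) powr a * sqrt (2 * pi))"
    using a by (subst ennreal_mult) (simp_all add: Gamma_real_pos less_imp_le)
  finally have L: "?L ?e = ennreal (Gamma a / (1 / 2) powr a * sqrt (2 * pi))" .
  have "?R ?e = (\<integral>\<^sup>+r. ennreal (indicator {0<..} r * r powr (a + 1 / 2 - 1) * exp (- r * (1 / 2))) \<partial>lborel)"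
    by (intro nn_integral_cong) (auto simp: ennreal_mult[symmetric])
  also have "\<dots> = ennreal (Gamma (a + 1 / 2) / (1 / 2) powr (a + 1 / 2))"
    by (rule Gamma_nn_integral_scaled) (use a in auto)
  finally have R: "?R ?e = ennreal (Gamma (a + 1 / 2) / (1 / 2) powr (a + 1 / 2))" .
  define k where "k = Gamma (a + 1 / 2) / (1 / 2) powr (a + 1 / 2)"
  have k: "0 < k" using a by (simp add: k_def Gamma_real_pos)
  have "c = c * ennreal k * ennreal (1 / k)"
    using k by (simp add: mult.assoc ennreal_mult[symmetric])
  also have "c * ennreal k = ennreal (Gamma a / (1 / 2) powr a * sqrt (2 * pi))"
    using main[of ?e] L R by (simp add: k_def)
  also have "\<dots> * ennreal (1 / k) = ennreal (Gamma a / (1 / 2) powr a * sqrt (2 * pi) / k)"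
    using a k by (subst ennreal_mult[symmetric]) (auto simp: Gamma_real_pos less_imp_le)
  also have "Gamma a / (1 / 2) powr a * sqrt (2 * pi) / k = sqrt pi * Gamma a / Gamma (a + 1 / 2)"
  proof -
    have "(1 / 2) powr (a + 1 / 2) = (1 / 2) powr a * (1 / sqrt 2 :: real)"
      by (simp add: powr_add powr_half_sqrt real_sqrt_divide)
    then show ?thesis by (simp add: k_def real_sqrt_mult)
  qed
  finally show ?thesis using main[of G] by simp
qed

lemma nn_integral_indicator_UN_incseq:
  assumes "f \<in> borel_measurable M" "incseq A" "\<And>n::nat. A n \<in> sets M"
  shows "(\<integral>\<^sup>+x. f x * indicator (\<Union>n. A n) x \<partial>M) = (SUP n. \<integral>\<^sup>+x. f x * indicator (A n) x \<partial>M)"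
  using SUP_emeasure_incseq[of A "density M f"] assms
  by (simp add: emeasure_density image_subset_iff sets.countable_UN)

text \<open>
  The square of a standard normal variable has one degree of freedom. The substitution
  \<open>s = v\<^sup>2\<close> is available on bounded intervals; monotone limits extend it to the half line.
\<close>

lemma nn_integral_std_normal_square:
  fixes F :: "real \<Rightarrow> ennreal"
  assumes [measurable]: "F \<in> borel_measurable borel"
  shows "(\<integral>\<^sup>+v. F (v\<^sup>2) \<partial>std_normal) = (\<integral>\<^sup>+s. F s \<partial>chi_sq (1 / 2))"
proof -
  define f where "f s = F s * ennreal (exp (- s / 2) / (sqrt s * sqrt (2 * pi)))" for s
  have [measurable]: "f \<in> borel_measurable borel" unfolding f_def by measurable
  define h where "h v = F (v\<^sup>2) * ennreal (std_normal_density v)" for v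
  have [measurable]: "h \<in> borel_measurable borel" unfolding h_def by measurable
  have fin: "(\<integral>\<^sup>+s. f s * indicator {0..(real n + 1)\<^sup>2} s \<partial>lborel) =
      (\<integral>\<^sup>+v. 2 * h v * indicator {0..real n + 1} v \<partial>lborel)" for n :: nat
  proof -
    have "(\<integral>\<^sup>+s. f s * indicator {0\<^sup>2..(real n + 1)\<^sup>2} s \<partial>lborel) =
      (\<integral>\<^sup>+v. f (v\<^sup>2) * ennreal (2 * v) * indicator {0..real n + 1} v \<partial>lborel)"
      by (rule nn_integral_substitution_aux[where g="\<lambda>x. x\<^sup>2"])
         (auto intro!: derivative_eq_intros continuous_intros)
    also have "\<dots> = (\<integral>\<^sup>+v. 2 * h v * indicator {0..real n + 1} v \<partial>lborel)"
    proof (intro nn_integral_cong_AE AE_I[where N="{0}"])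
      show "{v \<in> space lborel. \<not> f (v\<^sup>2) * ennreal (2 * v) * indicator {0..real n + 1} v =
          2 * h v * indicator {0..real n + 1} v} \<subseteq> {0}"
      proof
        fix v :: real
        assume v: "v \<in> {v \<in> space lborel. \<not> f (v\<^sup>2) * ennreal (2 * v) * indicator {0..real n + 1} v =
          2 * h v * indicator {0..real n + 1} v}"
        { assume v0: "0 < v"
          have "ennreal (exp (- v\<^sup>2 / 2) / (sqrt (v\<^sup>2) * sqrt (2 * pi))) * ennreal (2 * v) =
             ennreal (2 * std_normal_density v)"
            using v0 by (subst ennreal_mult[symmetric]) (auto simp: std_normal_density_def field_simps)
          then have "f (v\<^sup>2) * ennreal (2 * v) = 2 * h v"
            by (simp add: f_def h_def mult.assoc ennreal_mult mult.left_commute)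
          then have False using v by simp }
        moreover have "0 \<le> v" using v by (auto split: split_indicator_asm)
        ultimately show "v \<in> {0}" by force
      qed
    qed auto
    finally show ?thesis by simp
  qed
  have U1: "(\<Union>n. {0..(real n + 1)\<^sup>2}) = {0::real..}"
  proof (intro equalityI subsetI)
    fix s :: real assume s: "s \<in> {0..}"
    obtain n :: nat where n: "s \<le> real n" using real_arch_simple by blast
    have "s \<le> (real n + 1)\<^sup>2" using n self_le_power[of "real n + 1" 2] by simp
    with s show "s \<in> (\<Union>n. {0..(real n + 1)\<^sup>2})" by auto
  qed auto
  have lim1: "(\<integral>\<^sup>+s. f s * indicator {0..} s \<partial>lborel) = (SUP n. \<integral>\<^sup>+s. f s * indicator {0..(real n + 1)\<^sup>2} s \<partial>lborel)"
    unfolding U1[symmetric]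
    by (rule nn_integral_indicator_UN_incseq) (auto simp: incseq_def intro: order_trans power_mono)
  have U2: "(\<Union>n. {0..real n + 1}) = {0::real..}"
  proof (intro equalityI subsetI)
    fix s :: real assume s: "s \<in> {0..}"
    obtain n :: nat where n: "s \<le> real n" using real_arch_simple by blast
    with s have "s \<in> {0..real n + 1}" by simp
    then show "s \<in> (\<Union>n. {0..real n + 1})" by blast
  qed auto
  have lim2: "(\<integral>\<^sup>+v. 2 * h v * indicator {0..} v \<partial>lborel) = (SUP n. \<integral>\<^sup>+v. 2 * h v * indicator {0..real n + 1} v \<partial>lborel)"
    unfolding U2[symmetric]
    by (rule nn_integral_indicator_UN_incseq) (auto simp: incseq_def)
  have "(\<integral>\<^sup>+v. F (v\<^sup>2) \<partial>std_normal) = (\<integral>\<^sup>+v. h v \<partial>lborel)"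
    by (subst nn_integral_density) (simp_all add: h_def[abs_def] mult.commute)
  also have "\<dots> = (\<integral>\<^sup>+v. h v * indicator {0..} v + h v * indicator {..0} v \<partial>lborel)"
    by (intro nn_integral_cong_AE AE_I[where N="{0}"]) (auto split: split_indicator)
  also have "\<dots> = (\<integral>\<^sup>+v. h v * indicator {0..} v \<partial>lborel) + (\<integral>\<^sup>+v. h v * indicator {..0} v \<partial>lborel)"
    by (rule nn_integral_add) auto
  also have "(\<integral>\<^sup>+v. h v * indicator {..0} v \<partial>lborel) = (\<integral>\<^sup>+v. h v * indicator {0..} v \<partial>lborel)"
    by (subst nn_integral_real_affine[where c="-1" and t=0])
       (auto intro!: nn_integral_cong simp: h_def std_normal_density_def split: split_indicator)
  also have "(\<integral>\<^sup>+v. h v * indicator {0..} v \<partial>lborel) + (\<integral>\<^sup>+v. h v * indicator {0..} v \<partial>lborel) =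
     (\<integral>\<^sup>+v. 2 * h v * indicator {0..} v \<partial>lborel)"
    by (subst nn_integral_add[symmetric]) (auto intro!: nn_integral_cong simp: mult_2 distrib_right)
  also have "\<dots> = (\<integral>\<^sup>+s. f s * indicator {0..} s \<partial>lborel)"
    unfolding lim1 lim2 fin ..
  also have "\<dots> = (\<integral>\<^sup>+s. ennreal (chi_sq_density (1 / 2) s) * F s \<partial>lborel)"
  proof (intro nn_integral_cong_AE AE_I[where N="{0}"])
    show "{s \<in> space lborel. f s * indicator {0..} s \<noteq> ennreal (chi_sq_density (1 / 2) s) * F s} \<subseteq> {0}"
    proof safe
      fix s :: real assume s: "f s * indicator {0..} s \<noteq> ennreal (chi_sq_density (1 / 2) s) * F s"
      have "exp (- s / 2) / (sqrt s * sqrt (2 * pi)) = chi_sq_density (1 / 2) s" if "0 < s"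
        using that
        by (simp add: chi_sq_density_def powr_minus powr_half_sqrt Gamma_one_half_real real_sqrt_mult field_simps)
      then have "0 < s \<Longrightarrow> False" using s by (simp add: f_def mult.commute)
      moreover have "s < 0 \<Longrightarrow> False" using s by (simp add: chi_sq_density_def)
      ultimately show "s = 0" by (cases s "0::real" rule: linorder_cases) auto
    qed
  qed auto
  also have "\<dots> = (\<integral>\<^sup>+s. F s \<partial>chi_sq (1 / 2))"
    unfolding chi_sq_def by (subst nn_integral_density) auto
  finally show ?thesis .
qed

text \<open>
  Adding the square of an independent standard normal variable adds one degree of freedom.
\<close>

lemma nn_integral_chi_sq_add_square:
  fixes F :: "real \<Rightarrow> ennreal"
  assumes [measurable]: "F \<in> borel_measurable borel" and a: "0 < a"
  shows "(\<integral>\<^sup>+s. \<integral>\<^sup>+v. F (s + v\<^sup>2) \<partial>std_normal \<partial>chi_sq a) = (\<integral>\<^sup>+r. F r \<partial>chi_sq (a + 1 / 2))"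
proof -
  define C where "C = 1 / (2 powr a * Gamma a * sqrt (2 * pi))"
  have C: "0 < C" using a by (simp add: C_def Gamma_real_pos)
  let ?G = "\<lambda>r. ennreal (exp (- r / 2)) * F r"
  have d: "ennreal (chi_sq_density a s) * (ennreal (std_normal_density v) * F (s + v\<^sup>2)) =
     ennreal C * (ennreal (indicator {0<..} s * s powr (a - 1)) * ?G (s + v\<^sup>2))" for s v
  proof -
    have "chi_sq_density a s * std_normal_density v =
        C * (indicator {0<..} s * s powr (a - 1) * exp (- (s + v\<^sup>2) / 2))"
    proof -
      have "exp (- (s + v\<^sup>2) / 2) = exp (- s / 2) * exp (- v\<^sup>2 / 2)"
        by (simp add: exp_add[symmetric] add_divide_distrib)
      then show ?thesis by (simp add: chi_sq_density_def std_normal_density_def C_def)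
    qed
    then have "ennreal (chi_sq_density a s) * ennreal (std_normal_density v) =
       ennreal C * (ennreal (indicator {0<..} s * s powr (a - 1)) * ennreal (exp (- (s + v\<^sup>2) / 2)))"
      using C a by (simp add: ennreal_mult[symmetric] chi_sq_density_nonneg)
    then show ?thesis by (simp only: mult.assoc[symmetric])
  qed
  have "(\<integral>\<^sup>+s. \<integral>\<^sup>+v. F (s + v\<^sup>2) \<partial>std_normal \<partial>chi_sq a) =
     (\<integral>\<^sup>+s. \<integral>\<^sup>+v. ennreal (chi_sq_density a s) * (ennreal (std_normal_density v) * F (s + v\<^sup>2)) \<partial>lborel \<partial>lborel)"
    unfolding chi_sq_def
    by (simp add: nn_integral_density nn_integral_cmult[symmetric])
  also have "\<dots> = (\<integral>\<^sup>+s. ennreal C * (\<integral>\<^sup>+v. ennreal (indicator {0<..} s * s powr (a - 1)) * ?G (s + v\<^sup>2) \<partial>lborel) \<partial>lborel)"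
    unfolding d by (intro nn_integral_cong nn_integral_cmult) measurable
  also have "\<dots> = ennreal C * (\<integral>\<^sup>+s. \<integral>\<^sup>+v. ennreal (indicator {0<..} s * s powr (a - 1)) * ?G (s + v\<^sup>2) \<partial>lborel \<partial>lborel)"
    by (rule nn_integral_cmult) measurable
  also have "\<dots> = ennreal (C * (sqrt pi * Gamma a / Gamma (a + 1 / 2))) *
      (\<integral>\<^sup>+r. ennreal (indicator {0<..} r * r powr (a - 1 / 2)) * ?G r \<partial>lborel)"
    using C a by (subst nn_integral_plus_square_powr, measurable)
      (subst ennreal_mult, simp_all add: Gamma_real_pos less_imp_le mult.assoc)
  also have "\<dots> = (\<integral>\<^sup>+r. ennreal (chi_sq_density (a + 1 / 2) r) * F r \<partial>lborel)"
  proof (subst nn_integral_cmult[symmetric], measurable, intro nn_integral_cong)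
    fix r :: real
    have "C * (sqrt pi * Gamma a / Gamma (a + 1 / 2)) * (indicator {0<..} r * r powr (a - 1 / 2) * exp (- r / 2)) =
        chi_sq_density (a + 1 / 2) r"
      using Gamma_real_pos[OF a]
      by (simp add: C_def chi_sq_density_def real_sqrt_mult powr_add powr_half_sqrt)
    moreover have "0 \<le> C * (sqrt pi * Gamma a / Gamma (a + 1 / 2))"
      using C a by (simp add: Gamma_real_pos less_imp_le)
    ultimately have "ennreal (C * (sqrt pi * Gamma a / Gamma (a + 1 / 2))) *
       (ennreal (indicator {0<..} r * r powr (a - 1 / 2)) * ennreal (exp (- r / 2))) =
       ennreal (chi_sq_density (a + 1 / 2) r)"
      by (simp add: ennreal_mult[symmetric])
    then show "ennreal (C * (sqrt pi * Gamma a / Gamma (a + 1 / 2))) *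
       (ennreal (indicator {0<..} r * r powr (a - 1 / 2)) * ?G r) =
       ennreal (chi_sq_density (a + 1 / 2) r) * F r"
      by (simp only: mult.assoc[symmetric])
  qed
  also have "\<dots> = (\<integral>\<^sup>+r. F r \<partial>chi_sq (a + 1 / 2))"
    unfolding chi_sq_def by (subst nn_integral_density) auto
  finally show ?thesis .
qed

section \<open>The joint law of sample mean and sum of squared deviations\<close>

lemma (in prob_space) nn_integral_indep_var:
  assumes ind: "indep_var S X T Y" and [measurable]: "case_prod h \<in> borel_measurable (S \<Otimes>\<^sub>M T)"
  shows "(\<integral>\<^sup>+\<omega>. h (X \<omega>) (Y \<omega>) \<partial>M) = (\<integral>\<^sup>+\<omega>. \<integral>\<^sup>+\<omega>'. h (X \<omega>) (Y \<omega>') \<partial>M \<partial>M)"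
proof -
  have [measurable]: "X \<in> measurable M S" "Y \<in> measurable M T"
    and eq: "distr M S X \<Otimes>\<^sub>M distr M T Y = distr M (S \<Otimes>\<^sub>M T) (\<lambda>x. (X x, Y x))"
    using ind by (auto simp: indep_var_distribution_eq)
  interpret Y: prob_space "distr M T Y" by (rule prob_space_distr) simp
  have "(\<integral>\<^sup>+\<omega>. h (X \<omega>) (Y \<omega>) \<partial>M) = (\<integral>\<^sup>+p. case_prod h p \<partial>distr M (S \<Otimes>\<^sub>M T) (\<lambda>x. (X x, Y x)))"
    by (subst nn_integral_distr) auto
  also have "\<dots> = (\<integral>\<^sup>+x. \<integral>\<^sup>+y. h x y \<partial>distr M T Y \<partial>distr M S X)"
    by (simp add: eq[symmetric] Y.nn_integral_fst[symmetric])
  also have "\<dots> = (\<integral>\<^sup>+\<omega>. \<integral>\<^sup>+y. h (X \<omega>) y \<partial>distr M T Y \<partial>M)"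
    by (subst nn_integral_distr) auto
  also have "\<dots> = (\<integral>\<^sup>+\<omega>. \<integral>\<^sup>+\<omega>'. h (X \<omega>) (Y \<omega>') \<partial>M \<partial>M)"
  proof (rule nn_integral_cong)
    fix \<omega> assume [measurable]: "\<omega> \<in> space M"
    have "X \<omega> \<in> space S" by (rule measurable_space[where M=M]) measurable
    then show "(\<integral>\<^sup>+y. h (X \<omega>) y \<partial>distr M T Y) = (\<integral>\<^sup>+\<omega>'. h (X \<omega>) (Y \<omega>') \<partial>M)"
      by (subst nn_integral_distr) auto
  qed
  finally show ?thesis .
qed

lemma (in prob_space) indep_sets_reindex:
  assumes "inj_on f I" "indep_sets F (f ` I)"
  shows "indep_sets (\<lambda>i. F (f i)) I"
  unfolding indep_sets_def
proof (intro conjI ballI allI impI)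
  fix J A assume J: "J \<subseteq> I" "J \<noteq> {}" "finite J" and A: "A \<in> Pi J (\<lambda>i. F (f i))"
  have inj: "inj_on f J" using assms(1) J(1) by (rule inj_on_subset)
  define A' where "A' = A \<circ> the_inv_into J f"
  have A': "A' (f j) = A j" if "j \<in> J" for j
    using that inj by (simp add: A'_def the_inv_into_f_f)
  have "prob (\<Inter>j\<in>f ` J. A' j) = (\<Prod>j\<in>f ` J. prob (A' j))"
    using J A by (intro indep_setsD[OF assms(2)]) (auto simp: A' Pi_iff)
  then show "prob (\<Inter>j\<in>J. A j) = (\<Prod>j\<in>J. prob (A j))"
    using inj by (simp add: prod.reindex A')
qed (use assms in \<open>auto simp: indep_sets_def\<close>)

lemma (in prob_space) indep_vars_reindex:
  assumes "inj_on f I" "indep_vars M' X (f ` I)"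
  shows "indep_vars (\<lambda>i. M' (f i)) (\<lambda>i. X (f i)) I"
  using assms unfolding indep_vars_def2 by (auto intro!: indep_sets_reindex[of f I])

definition scaled_sum :: "(nat \<Rightarrow> 'a \<Rightarrow> real) \<Rightarrow> nat \<Rightarrow> 'a \<Rightarrow> real" where
  "scaled_sum Z n \<omega> = (\<Sum>m = 1..n. Z m \<omega>) / sqrt (real n)"

definition residual_sum :: "(nat \<Rightarrow> 'a \<Rightarrow> real) \<Rightarrow> nat \<Rightarrow> 'a \<Rightarrow> real" where
  "residual_sum Z n \<omega> = (\<Sum>m = 1..n. (Z m \<omega>)\<^sup>2) - (scaled_sum Z n \<omega>)\<^sup>2"

text \<open>
  Appending an observation acts on the pair of the scaled sum and the new observation by an
  orthogonal matrix: its first coordinate is the new scaled sum, and the square of its second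
  coordinate is the increment of the residual sum of squares. This is what makes an induction on
  the sample size work.
\<close>

lemma scaled_sum_Suc:
  assumes "1 \<le> n"
  shows "scaled_sum Z (Suc n) \<omega> = sqrt (real n) / sqrt (real (Suc n)) * scaled_sum Z n \<omega> + 1 / sqrt (real (Suc n)) * Z (Suc n) \<omega>"
  using assms by (simp add: scaled_sum_def add_divide_distrib)

lemma residual_sum_Suc:
  assumes "1 \<le> n"
  shows "residual_sum Z (Suc n) \<omega> = residual_sum Z n \<omega> +
    (1 / sqrt (real (Suc n)) * scaled_sum Z n \<omega> - sqrt (real n) / sqrt (real (Suc n)) * Z (Suc n) \<omega>)\<^sup>2"
proof -
  define c where "c = sqrt (real n) / sqrt (real (Suc n))"
  define s where "s = 1 / sqrt (real (Suc n))"
  define u where "u = scaled_sum Z n \<omega>"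
  define z where "z = Z (Suc n) \<omega>"
  have cs: "c\<^sup>2 + s\<^sup>2 = 1"
    by (simp add: c_def s_def power_divide add_divide_distrib[symmetric])
  have "(c * u + s * z)\<^sup>2 + (s * u - c * z)\<^sup>2 = (c\<^sup>2 + s\<^sup>2) * (u\<^sup>2 + z\<^sup>2)"
    by (simp add: power2_eq_square algebra_simps)
  also have "\<dots> = u\<^sup>2 + z\<^sup>2" by (simp add: cs)
  finally have "(s * u - c * z)\<^sup>2 = u\<^sup>2 + z\<^sup>2 - (c * u + s * z)\<^sup>2" by simp
  then show ?thesis
    unfolding residual_sum_def scaled_sum_Suc[OF assms] c_def[symmetric] s_def[symmetric]
      u_def[symmetric] z_def[symmetric] by (simp add: z_def)
qed

context prob_space
begin

context
  fixes Z :: "nat \<Rightarrow> 'a \<Rightarrow> real"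
  assumes ind: "indep_vars (\<lambda>_. borel) Z {1..}"
    and std: "\<And>n. 1 \<le> n \<Longrightarrow> distributed M lborel (Z n) std_normal_density"
begin

private lemma Z_measurable: "1 \<le> n \<Longrightarrow> Z n \<in> borel_measurable M"
  using distributed_measurable[OF std[of n]] by simp

private lemma nn_integral_Z:
  assumes "1 \<le> n" and [measurable]: "g \<in> borel_measurable borel"
  shows "(\<integral>\<^sup>+\<omega>. g (Z n \<omega>) \<partial>M) = (\<integral>\<^sup>+x. g x \<partial>std_normal)"
proof -
  have [measurable]: "Z n \<in> borel_measurable M" using assms by (simp add: Z_measurable)
  have "distr M borel (Z n) = std_normal"
    using distributed_distr_eq_density[OF std[OF assms(1)]] by (simp cong: distr_cong)
  then show ?thesis by (simp add: nn_integral_distr[symmetric, of "Z n" M borel])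
qed

private lemma nn_integral_Suc:
  assumes F[measurable]: "case_prod F \<in> borel_measurable (borel \<Otimes>\<^sub>M borel)" and n: "1 \<le> n"
  shows "(\<integral>\<^sup>+\<omega>. F (scaled_sum Z (Suc n) \<omega>) (residual_sum Z (Suc n) \<omega>) \<partial>M) =
    (\<integral>\<^sup>+\<omega>. \<integral>\<^sup>+x. F (sqrt (real n) / sqrt (real (Suc n)) * scaled_sum Z n \<omega> + 1 / sqrt (real (Suc n)) * x)
       (residual_sum Z n \<omega> + (1 / sqrt (real (Suc n)) * scaled_sum Z n \<omega> - sqrt (real n) / sqrt (real (Suc n)) * x)\<^sup>2)
       \<partial>std_normal \<partial>M)"
proof -
  have "indep_var (PiM {1..n} (\<lambda>_. borel)) (\<lambda>\<omega>. \<lambda>i\<in>{1..n}. Z i \<omega>)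
      (PiM {Suc n} (\<lambda>_. borel)) (\<lambda>\<omega>. \<lambda>i\<in>{Suc n}. Z i \<omega>)"
    by (rule indep_var_restrict[OF ind]) auto
  note iv = this
  define c where "c = sqrt (real n) / sqrt (real (Suc n))"
  define d where "d = 1 / sqrt (real (Suc n))"
  define U where "U f = (\<Sum>m = 1..n. f m) / sqrt (real n)" for f :: "nat \<Rightarrow> real"
  define R where "R f = (\<Sum>m = 1..n. (f m)\<^sup>2) - (U f)\<^sup>2" for f :: "nat \<Rightarrow> real"
  have [measurable]: "U \<in> borel_measurable (PiM {1..n} (\<lambda>_. borel))"
    "R \<in> borel_measurable (PiM {1..n} (\<lambda>_. borel))"
    unfolding R_def U_def by measurable
  define H where "H f g = F (c * U f + d * g (Suc n)) (R f + (d * U f - c * g (Suc n))\<^sup>2)" for f g :: "nat \<Rightarrow> real"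
  have H: "case_prod H \<in> borel_measurable (PiM {1..n} (\<lambda>_. borel) \<Otimes>\<^sub>M PiM {Suc n} (\<lambda>_. borel))"
    unfolding H_def by measurable
  have UR: "U (\<lambda>i\<in>{1..n}. Z i \<omega>) = scaled_sum Z n \<omega>" "R (\<lambda>i\<in>{1..n}. Z i \<omega>) = residual_sum Z n \<omega>" for \<omega>
    by (simp_all add: U_def R_def scaled_sum_def residual_sum_def)
  have "(\<integral>\<^sup>+\<omega>. F (scaled_sum Z (Suc n) \<omega>) (residual_sum Z (Suc n) \<omega>) \<partial>M) =
    (\<integral>\<^sup>+\<omega>. \<integral>\<^sup>+\<omega>'. F (c * scaled_sum Z n \<omega> + d * Z (Suc n) \<omega>')
       (residual_sum Z n \<omega> + (d * scaled_sum Z n \<omega> - c * Z (Suc n) \<omega>')\<^sup>2) \<partial>M \<partial>M)"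
    unfolding scaled_sum_Suc[OF n] residual_sum_Suc[OF n] c_def[symmetric] d_def[symmetric]
    using nn_integral_indep_var[OF iv H] unfolding H_def UR by simp
  also have "\<dots> = (\<integral>\<^sup>+\<omega>. \<integral>\<^sup>+x. F (c * scaled_sum Z n \<omega> + d * x)
       (residual_sum Z n \<omega> + (d * scaled_sum Z n \<omega> - c * x)\<^sup>2) \<partial>std_normal \<partial>M)"
    by (intro nn_integral_cong nn_integral_Z) (use n in auto)
  finally show ?thesis unfolding c_def d_def .
qed

text \<open>
  Induction on the sample size. The new observation is independent of the earlier ones, so the
  recursion for the two statistics is an orthogonal transformation of a standard normal plane; its
  second coordinate contributes one degree of freedom to the residual sum. The induction starts
  at \<open>n = 2\<close>, since for \<open>n = 1\<close> the residual sum is 0 and has no density.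
\<close>

lemma normal_sample_law:
  assumes "2 \<le> n" and "case_prod F \<in> borel_measurable (borel \<Otimes>\<^sub>M borel)"
  shows "(\<integral>\<^sup>+\<omega>. F (scaled_sum Z n \<omega>) (residual_sum Z n \<omega>) \<partial>M) =
    (\<integral>\<^sup>+u. \<integral>\<^sup>+s. F u s \<partial>chi_sq ((real n - 1) / 2) \<partial>std_normal)"
  using assms
proof (induction n arbitrary: F rule: nat_induct_at_least)
  case base
  note F[measurable] = base
  have r: "(sqrt (1 / 2))\<^sup>2 + (sqrt (1 / 2))\<^sup>2 = (1::real)" by (simp add: power_divide)
  have "(\<integral>\<^sup>+\<omega>. F (scaled_sum Z 2 \<omega>) (residual_sum Z 2 \<omega>) \<partial>M) =
    (\<integral>\<^sup>+\<omega>. \<integral>\<^sup>+x. F (sqrt (1 / 2) * Z 1 \<omega> + sqrt (1 / 2) * x) ((sqrt (1 / 2) * Z 1 \<omega> - sqrt (1 / 2) * x)\<^sup>2)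
       \<partial>std_normal \<partial>M)"
    using nn_integral_Suc[OF F, of 1]
    by (simp add: scaled_sum_def residual_sum_def numeral_2_eq_2[symmetric] real_sqrt_divide)
  also have "\<dots> = (\<integral>\<^sup>+u. \<integral>\<^sup>+x. F (sqrt (1 / 2) * u + sqrt (1 / 2) * x) ((sqrt (1 / 2) * u - sqrt (1 / 2) * x)\<^sup>2)
       \<partial>std_normal \<partial>std_normal)"
    by (rule nn_integral_Z) measurable
  also have "\<dots> = (\<integral>\<^sup>+a. \<integral>\<^sup>+b. F a (b\<^sup>2) \<partial>std_normal \<partial>std_normal)"
    by (rule nn_integral_rotation[OF _ r, of "\<lambda>a b. F a (b\<^sup>2)"]) auto
  also have "\<dots> = (\<integral>\<^sup>+u. \<integral>\<^sup>+s. F u s \<partial>chi_sq ((real 2 - 1) / 2) \<partial>std_normal)"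
    by (intro nn_integral_cong) (subst nn_integral_std_normal_square, auto)
  finally show ?case .
next
  case (Suc n)
  note F[measurable] = Suc.prems
  have n: "1 \<le> n" using Suc.hyps by simp
  define k where "k = (real n - 1) / 2"
  have k: "0 < k" "(real (Suc n) - 1) / 2 = k + 1 / 2" using Suc.hyps by (auto simp: k_def field_simps)
  define c where "c = sqrt (real n) / sqrt (real (Suc n))"
  define d where "d = 1 / sqrt (real (Suc n))"
  have cd: "c\<^sup>2 + d\<^sup>2 = 1" "d \<noteq> 0"
    by (simp_all add: c_def d_def power_divide add_divide_distrib[symmetric])
  interpret chi: prob_space "chi_sq k" using k by (intro prob_space_chi_sq)
  interpret P: pair_sigma_finite "chi_sq k" std_normal ..
  have "(\<integral>\<^sup>+\<omega>. F (scaled_sum Z (Suc n) \<omega>) (residual_sum Z (Suc n) \<omega>) \<partial>M) =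
      (\<integral>\<^sup>+\<omega>. \<integral>\<^sup>+x. F (c * scaled_sum Z n \<omega> + d * x) (residual_sum Z n \<omega> + (d * scaled_sum Z n \<omega> - c * x)\<^sup>2) \<partial>std_normal \<partial>M)"
    unfolding c_def d_def by (rule nn_integral_Suc[OF F n])
  also have "\<dots> = (\<integral>\<^sup>+u. \<integral>\<^sup>+s. \<integral>\<^sup>+x. F (c * u + d * x) (s + (d * u - c * x)\<^sup>2) \<partial>std_normal \<partial>chi_sq k \<partial>std_normal)"
    unfolding k_def by (rule Suc.IH) measurable
  also have "\<dots> = (\<integral>\<^sup>+s. \<integral>\<^sup>+u. \<integral>\<^sup>+x. F (c * u + d * x) (s + (d * u - c * x)\<^sup>2) \<partial>std_normal \<partial>std_normal \<partial>chi_sq k)"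
    by (rule P.Fubini') measurable
  also have "\<dots> = (\<integral>\<^sup>+s. \<integral>\<^sup>+a. \<integral>\<^sup>+b. F a (s + b\<^sup>2) \<partial>std_normal \<partial>std_normal \<partial>chi_sq k)"
    by (rule nn_integral_cong, rule nn_integral_rotation[OF _ cd, of "\<lambda>a b. F a (_ + b\<^sup>2)"]) measurable
  also have "\<dots> = (\<integral>\<^sup>+a. \<integral>\<^sup>+s. \<integral>\<^sup>+b. F a (s + b\<^sup>2) \<partial>std_normal \<partial>chi_sq k \<partial>std_normal)"
    by (rule P.Fubini'[symmetric]) measurable
  also have "\<dots> = (\<integral>\<^sup>+a. \<integral>\<^sup>+r. F a r \<partial>chi_sq (k + 1 / 2) \<partial>std_normal)"
    by (rule nn_integral_cong, rule nn_integral_chi_sq_add_square) (use k in auto)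
  finally show ?case unfolding k .
qed

end

end

lemma sum_sq_dev_eq:
  assumes "1 \<le> n"
  shows "sum_sq_dev X i n \<omega> = (\<Sum>m = 1..n. (X i m \<omega>)\<^sup>2) - (\<Sum>m = 1..n. X i m \<omega>)\<^sup>2 / real n"
proof -
  define x where "x = sample_mean X i n \<omega>"
  have x: "(\<Sum>m = 1..n. X i m \<omega>) = real n * x" using assms by (simp add: x_def sample_mean_def)
  have "sum_sq_dev X i n \<omega> = (\<Sum>m = 1..n. (X i m \<omega>)\<^sup>2 - 2 * x * X i m \<omega> + x\<^sup>2)"
    unfolding sum_sq_dev_def x_def[symmetric] by (intro sum.cong) (auto simp: power2_eq_square algebra_simps)
  also have "\<dots> = (\<Sum>m = 1..n. (X i m \<omega>)\<^sup>2) - 2 * x * (\<Sum>m = 1..n. X i m \<omega>) + real n * x\<^sup>2"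
    by (simp add: sum.distrib sum_subtractf sum_distrib_left)
  also have "\<dots> = (\<Sum>m = 1..n. (X i m \<omega>)\<^sup>2) - 2 * x * (real n * x) + real n * x\<^sup>2"
    unfolding x ..
  also have "\<dots> = (\<Sum>m = 1..n. (X i m \<omega>)\<^sup>2) - (real n * x)\<^sup>2 / real n"
    using assms by (simp add: power2_eq_square)
  finally show ?thesis unfolding x .
qed

context gaussian_thompson_sampling
begin

lemma arm_statistics_law:
  assumes \<sigma>: "0 < \<sigma> i" and n: "2 \<le> n"
    and F[measurable]: "case_prod F \<in> borel_measurable (borel \<Otimes>\<^sub>M borel)"
  shows "(\<integral>\<^sup>+\<omega>. F (sample_mean X i n \<omega>) (sum_sq_dev X i n \<omega>) \<partial>M) =
    (\<integral>\<^sup>+u. \<integral>\<^sup>+s. F (\<mu> i + \<sigma> i * u / sqrt (real n)) ((\<sigma> i)\<^sup>2 * s) \<partial>chi_sq ((real n - 1) / 2) \<partial>std_normal)"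
proof -
  define Z where "Z m \<omega> = (X i m \<omega> - \<mu> i) / \<sigma> i" for m \<omega>
  have "indep_vars (\<lambda>j. borel) (\<lambda>m. (\<lambda>(i, n). X i n) (i, m)) {1..}"
    by (rule indep_vars_reindex[OF _ indep_vars_subset[OF rewards_indep]]) (auto simp: inj_on_def)
  then have "indep_vars (\<lambda>j. borel) (\<lambda>m. X i m) {1..}" by simp
  from indep_vars_compose2[OF this, of "\<lambda>_ x. (x - \<mu> i) / \<sigma> i" "\<lambda>_. borel"]
  have ind: "indep_vars (\<lambda>_. borel) Z {1..}" by (simp add: Z_def[abs_def])
  have std: "distributed M lborel (Z m) std_normal_density" if "1 \<le> m" for m
    using rewards_normal[OF that, of i] normal_standard_normal_convert[OF \<sigma>, of "X i m" "\<mu> i"]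
    by (simp add: Z_def[abs_def])
  have XZ: "X i m \<omega> = \<mu> i + \<sigma> i * Z m \<omega>" for m \<omega> using \<sigma> by (simp add: Z_def)
  have S: "(\<Sum>m = 1..n. X i m \<omega>) = real n * \<mu> i + \<sigma> i * (\<Sum>m = 1..n. Z m \<omega>)" for \<omega>
    by (simp add: XZ sum.distrib sum_distrib_left)
  have mean: "sample_mean X i n \<omega> = \<mu> i + \<sigma> i * scaled_sum Z n \<omega> / sqrt (real n)" for \<omega>
    using n unfolding sample_mean_def S scaled_sum_def
    by (simp add: add_divide_distrib)
  have dev: "sum_sq_dev X i n \<omega> = (\<sigma> i)\<^sup>2 * residual_sum Z n \<omega>" for \<omega>
  proof -
    have "(\<Sum>m = 1..n. (X i m \<omega>)\<^sup>2) = real n * (\<mu> i)\<^sup>2 + 2 * \<mu> i * \<sigma> i * (\<Sum>m = 1..n. Z m \<omega>) + (\<sigma> i)\<^sup>2 * (\<Sum>m = 1..n. (Z m \<omega>)\<^sup>2)"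
      by (simp add: XZ power2_sum power_mult_distrib sum.distrib sum_distrib_left algebra_simps)
    moreover have "r * a\<^sup>2 + 2 * a * b * s + b\<^sup>2 * q - (r * a + b * s)\<^sup>2 / r = b\<^sup>2 * (q - s\<^sup>2 / r)" if "0 < r" for r a b s q :: real
      using that by (simp add: field_simps power2_eq_square)
    ultimately have "sum_sq_dev X i n \<omega> = (\<sigma> i)\<^sup>2 * ((\<Sum>m = 1..n. (Z m \<omega>)\<^sup>2) - (\<Sum>m = 1..n. Z m \<omega>)\<^sup>2 / real n)"
      using n by (simp only: sum_sq_dev_eq[of n] S)
    then show ?thesis using n unfolding residual_sum_def scaled_sum_def
      by (simp add: power_divide)
  qed
  show ?thesis unfolding mean dev
    using normal_sample_law[OF ind std n, of "\<lambda>u s. F (\<mu> i + \<sigma> i * u / sqrt (real n)) ((\<sigma> i)\<^sup>2 * s)"]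
    by simp
qed

end

section \<open>Tail bounds and the expected inverse posterior probability\<close>

text \<open>
  For \<open>v < 0 \<le> e\<close> the normal density at \<open>v - e\<close> is at most \<open>exp (- e\<^sup>2 / 2)\<close> times the density at
  \<open>v\<close>. This change of measure moves the true mean to the threshold \<open>c\<close>, and it also gives the
  Gaussian tail bound.
\<close>

lemma std_normal_shift_le:
  assumes [measurable]: "f \<in> borel_measurable borel" and e: "0 \<le> e"
  shows "(\<integral>\<^sup>+u. f (u + e) * indicator {..< - e} u \<partial>std_normal) \<le> ennreal (exp (- e\<^sup>2 / 2)) * (\<integral>\<^sup>+v. f v \<partial>std_normal)"
proof -
  have "(\<integral>\<^sup>+u. f (u + e) * indicator {..< - e} u \<partial>std_normal) =
      (\<integral>\<^sup>+u. ennreal (std_normal_density u) * (f (u + e) * indicator {..< - e} u) \<partial>lborel)"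
    by (subst nn_integral_density) auto
  also have "\<dots> = (\<integral>\<^sup>+v. ennreal (std_normal_density (v - e)) * (f v * indicator {..< 0} v) \<partial>lborel)"
    by (subst nn_integral_real_affine[where c=1 and t="- e"])
       (auto intro!: nn_integral_cong split: split_indicator)
  also have "\<dots> \<le> (\<integral>\<^sup>+v. ennreal (exp (- e\<^sup>2 / 2)) * (ennreal (std_normal_density v) * f v) \<partial>lborel)"
  proof (intro nn_integral_mono)
    fix v :: real
    show "ennreal (std_normal_density (v - e)) * (f v * indicator {..< 0} v) \<le>
      ennreal (exp (- e\<^sup>2 / 2)) * (ennreal (std_normal_density v) * f v)"
    proof (cases "v < 0")
      case True
      have "v * e \<le> 0" using True e by (simp add: mult_nonpos_nonneg)
      then have "- (v - e)\<^sup>2 / 2 \<le> - e\<^sup>2 / 2 + - v\<^sup>2 / 2"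
        by (simp add: power2_diff field_simps)
      then have "exp (- (v - e)\<^sup>2 / 2) \<le> exp (- e\<^sup>2 / 2) * exp (- v\<^sup>2 / 2)"
        unfolding exp_add[symmetric] by (rule exp_le_cancel_iff[THEN iffD2])
      then have "1 / sqrt (2 * pi) * exp (- (v - e)\<^sup>2 / 2) \<le> 1 / sqrt (2 * pi) * (exp (- e\<^sup>2 / 2) * exp (- v\<^sup>2 / 2))"
        by (rule mult_left_mono) simp
      then have "std_normal_density (v - e) \<le> exp (- e\<^sup>2 / 2) * std_normal_density v"
        by (simp add: std_normal_density_def mult_ac)
      then show ?thesis using True
        by (simp add: mult.assoc[symmetric] ennreal_mult[symmetric] mult_right_mono ennreal_leI)
    qed simp
  qed
  also have "\<dots> = ennreal (exp (- e\<^sup>2 / 2)) * (\<integral>\<^sup>+v. f v \<partial>std_normal)"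
    by (subst nn_integral_cmult) (auto simp: nn_integral_density)
  finally show ?thesis .
qed

lemma std_normal_lower_tail:
  assumes "0 \<le> e" shows "emeasure std_normal {..< - e} \<le> ennreal (exp (- e\<^sup>2 / 2))"
  using std_normal_shift_le[of "\<lambda>_. 1" e] assms std_normal.emeasure_space_1 by simp

lemma std_normal_upper_tail:
  assumes "0 \<le> e" shows "emeasure std_normal {e <..} \<le> ennreal (exp (- e\<^sup>2 / 2))"
proof -
  have "emeasure std_normal {e <..} = emeasure std_normal {..< - e}"
    by (simp add: emeasure_density, subst nn_integral_real_affine[where c="-1" and t=0])
       (auto intro!: nn_integral_cong simp: std_normal_density_def split: split_indicator)
  then show ?thesis using std_normal_lower_tail[OF assms] by simp
qed

lemma AE_chi_sq_pos: "0 < a \<Longrightarrow> AE s in chi_sq a. 0 < s"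
  unfolding chi_sq_def by (subst AE_density) (auto simp: chi_sq_density_def indicator_def)

text \<open>
  Chernoff's bound with the exponential moment at \<open>\<delta> / 8\<close>. The parameter \<open>b\<close> is separated from
  \<open>a\<close> because the deviations of \<open>n\<close> rewards have \<open>n - 1\<close> degrees of freedom, but are compared
  with multiples of \<open>n\<close>.
\<close>

lemma chi_sq_upper_tail:
  assumes a: "0 < a" "a \<le> b" and d: "0 \<le> \<delta>" "\<delta> \<le> 1"
  shows "emeasure (chi_sq a) {2 * b * (1 + \<delta>)..} \<le> ennreal (exp (- b * \<delta>\<^sup>2 / 8))"
proof -
  define l where "l = \<delta> / 8"
  have l: "0 \<le> l" "l \<le> 1 / 4" using d by (auto simp: l_def)
  define t where "t = 2 * b * (1 + \<delta>)"
  have G: "0 < 2 powr a * Gamma a" using a by (simp add: Gamma_real_pos)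
  have "emeasure (chi_sq a) {t..} = (\<integral>\<^sup>+s. ennreal (chi_sq_density a s) * indicator {t..} s \<partial>lborel)"
    unfolding chi_sq_def by (simp add: emeasure_density)
  also have "\<dots> \<le> (\<integral>\<^sup>+s. ennreal (exp (- l * t) / (2 powr a * Gamma a)) *
      ennreal (indicator {0<..} s * s powr (a - 1) * exp (- s * (1 / 2 - l))) \<partial>lborel)"
  proof (intro nn_integral_mono)
    fix s :: real
    show "ennreal (chi_sq_density a s) * indicator {t..} s \<le> ennreal (exp (- l * t) / (2 powr a * Gamma a)) *
      ennreal (indicator {0<..} s * s powr (a - 1) * exp (- s * (1 / 2 - l)))"
    proof (cases "t \<le> s")
      case True
      have "l * t \<le> l * s" using True l by (intro mult_left_mono)
      then have "exp (- s / 2) \<le> exp (- l * t) * exp (- s * (1 / 2 - l))"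
        by (simp add: exp_add[symmetric] algebra_simps)
      then have "indicator {0<..} s * s powr (a - 1) * exp (- s / 2) \<le>
         indicator {0<..} s * s powr (a - 1) * (exp (- l * t) * exp (- s * (1 / 2 - l)))"
        by (intro mult_left_mono) auto
      then have "chi_sq_density a s \<le> exp (- l * t) / (2 powr a * Gamma a) *
         (indicator {0<..} s * s powr (a - 1) * exp (- s * (1 / 2 - l)))"
        unfolding chi_sq_density_def using G by (simp add: divide_right_mono mult_ac)
      then show ?thesis using True G
        by (simp add: ennreal_mult[symmetric] ennreal_leI del: ennreal_mult'' )
    qed simp
  qed
  also have "\<dots> = ennreal (exp (- l * t) / (2 powr a * Gamma a)) * ennreal (Gamma a / (1 / 2 - l) powr a)"
    using a l by (subst nn_integral_cmult, measurable) (subst Gamma_nn_integral_scaled, auto)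
  also have "\<dots> = ennreal (exp (- l * t) * (1 - 2 * l) powr (- a))"
  proof (subst ennreal_mult[symmetric])
    have h: "(1 / 2 - l) powr a = (1 - 2 * l) powr a / 2 powr a"
    proof -
      have "1 / 2 - l = (1 - 2 * l) / 2" by simp
      then show ?thesis using powr_divide[of "1 - 2 * l" 2 a] l by (simp only:)
    qed
    have f: "E / (p * g) * (g / (q / p)) = E * inverse q" if "0 < p" "0 < g" "0 < q" for E p g q :: real
      using that by (simp add: field_simps)
    have "exp (- l * t) / (2 powr a * Gamma a) * (Gamma a / (1 / 2 - l) powr a) =
        exp (- l * t) * (1 - 2 * l) powr (- a)"
      unfolding h powr_minus by (rule f) (use Gamma_real_pos[OF a(1)] l in auto)
    then show "ennreal (exp (- l * t) / (2 powr a * Gamma a) * (Gamma a / (1 / 2 - l) powr a)) =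
      ennreal (exp (- l * t) * (1 - 2 * l) powr (- a))" by (simp only:)
    show "0 \<le> exp (- l * t) / (2 powr a * Gamma a)" using G by (intro divide_nonneg_nonneg) auto
    show "0 \<le> Gamma a / (1 / 2 - l) powr a"
      using Gamma_real_pos[OF a(1)] by (intro divide_nonneg_nonneg) auto
  qed
  also have "\<dots> \<le> ennreal (exp (- b * \<delta>\<^sup>2 / 8))"
  proof (rule ennreal_leI)
    have ln: "- (2 * l) - 2 * (2 * l)\<^sup>2 \<le> ln (1 - 2 * l)"
      using ln_one_minus_pos_lower_bound[of "2 * l"] l by simp
    have "ln (1 - 2 * l) \<le> 0" using l by simp
    then have "- a * ln (1 - 2 * l) \<le> - b * ln (1 - 2 * l)" using a by (simp add: mult_right_mono_neg)
    also have "\<dots> = b * - ln (1 - 2 * l)" by simp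
    also have "\<dots> \<le> b * (2 * l + 2 * (2 * l)\<^sup>2)" using a ln by (intro mult_left_mono) auto
    finally have "- l * t + - a * ln (1 - 2 * l) \<le> - l * t + b * (2 * l + 2 * (2 * l)\<^sup>2)" by simp
    also have "\<dots> = - b * \<delta>\<^sup>2 / 8" by (simp add: l_def t_def power2_eq_square algebra_simps)
    finally have "exp (- l * t) * exp (- a * ln (1 - 2 * l)) \<le> exp (- b * \<delta>\<^sup>2 / 8)"
      unfolding exp_add[symmetric] by (rule exp_le_cancel_iff[THEN iffD2])
    then show "exp (- l * t) * (1 - 2 * l) powr (- a) \<le> exp (- b * \<delta>\<^sup>2 / 8)"
      using l by (simp only: powr_def) simp
  qed
  finally show ?thesis unfolding t_def .
qed

text \<open>
  Log-convexity of the Gamma function at the midpoint of \<open>x\<close> and \<open>x + 1\<close>.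
\<close>

lemma Gamma_half_shift_le:
  fixes x :: real assumes x: "0 < x"
  shows "Gamma (x + 1 / 2) \<le> sqrt x * Gamma x"
proof -
  have conv: "(ln \<circ> Gamma) (x + 1 / 2) \<le> (1 - 1 / 2) * (ln \<circ> Gamma) x + (1 / 2) * (ln \<circ> Gamma) (x + 1)"
  proof -
    have "(ln \<circ> Gamma) ((1 - 1 / 2) *\<^sub>R x + (1 / 2) *\<^sub>R (x + 1)) \<le>
      (1 - 1 / 2) * (ln \<circ> Gamma) x + (1 / 2) * (ln \<circ> Gamma) (x + 1)"
    by (rule convex_onD[OF log_convex_Gamma_real]) (use x in auto)
    moreover have "(1 - 1 / 2) *\<^sub>R x + (1 / 2) *\<^sub>R (x + 1) = x + 1 / 2" by (simp add: field_simps)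
    ultimately show ?thesis by (simp only:)
  qed
  have "Gamma (x + 1) = x * Gamma x"
    using x by (metis Gamma_plus1 nonpos_Ints_nonpos not_le)
  note G = \<open>Gamma (x + 1) = x * Gamma x\<close>
  have "ln (x * Gamma x) = ln x + ln (Gamma x)" "ln (sqrt x * Gamma x) = ln x / 2 + ln (Gamma x)"
    using x Gamma_real_pos[OF x] by (simp_all add: ln_mult_pos ln_sqrt del: Gamma_real_pos)
  with conv have "ln (Gamma (x + 1 / 2)) \<le> ln (sqrt x * Gamma x)"
    by (simp add: G add_divide_distrib)
  then show ?thesis using x by (subst (asm) ln_le_cancel_iff) (auto simp: Gamma_real_pos)
qed

text \<open>
  With \<open>v\<close> standard normal and \<open>s\<close> chi-squared, \<open>s / (s + v\<^sup>2)\<close> is beta distributed, and this is its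
  moment of order \<open>- (n + 2 \<alpha> - 1) / 2\<close>. After multiplication by the densities, all powers of \<open>s\<close>
  are absorbed in \<open>s + v\<^sup>2\<close> except for \<open>s powr (- \<alpha> - 1)\<close>, whose integrability at 0 is the point
  where \<open>\<alpha> < 0\<close> is essential. The quotient of Gamma functions that remains grows like \<open>sqrt n\<close>.
\<close>

lemma nn_integral_inverse_beta_moment:
  assumes \<alpha>: "\<alpha> < 0" and n: "2 \<le> n"
  shows "(\<integral>\<^sup>+v. \<integral>\<^sup>+s. ennreal ((1 + v\<^sup>2 / s) powr ((real n + 2 * \<alpha> - 1) / 2)) \<partial>chi_sq ((real n - 1) / 2) \<partial>std_normal) \<le>
    ennreal (Gamma (- \<alpha>) / Gamma (1 / 2 - \<alpha>) * sqrt (real n))"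
proof -
  define a where "a = (real n - 1) / 2"
  define e where "e = (real n + 2 * \<alpha> - 1) / 2"
  have a: "0 < a" "e = a + \<alpha>" using n by (auto simp: a_def e_def field_simps)
  define C where "C = 1 / (2 powr a * Gamma a * sqrt (2 * pi))"
  have C: "0 < C" using a by (simp add: C_def Gamma_real_pos)
  let ?G = "\<lambda>r::real. ennreal (r powr e * exp (- r / 2))"
  interpret chi: prob_space "chi_sq a" using a by (intro prob_space_chi_sq)
  interpret P: pair_sigma_finite "chi_sq a" std_normal ..
  have d: "ennreal (chi_sq_density a s) * (ennreal (std_normal_density v) * ennreal ((1 + v\<^sup>2 / s) powr e)) =
     ennreal C * (ennreal (indicator {0<..} s * s powr (- \<alpha> - 1)) * ?G (s + v\<^sup>2))" for s v
  proof (cases "0 < s")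
    case True
    have 1: "s powr (a - 1) = s powr e * s powr (- \<alpha> - 1)"
      using True by (simp add: powr_add[symmetric] a)
    have 2: "s powr e * (1 + v\<^sup>2 / s) powr e = (s + v\<^sup>2) powr e"
    proof -
      have "s * (1 + v\<^sup>2 / s) = s + v\<^sup>2" using True by (simp add: distrib_left)
      then show ?thesis by (metis powr_mult)
    qed
    have "exp (- (s + v\<^sup>2) / 2) = exp (- s / 2) * exp (- v\<^sup>2 / 2)"
      by (simp add: exp_add[symmetric] add_divide_distrib)
    then have "chi_sq_density a s * (std_normal_density v * (1 + v\<^sup>2 / s) powr e) =
       C * (s powr (- \<alpha> - 1) * ((s powr e * (1 + v\<^sup>2 / s) powr e) * exp (- (s + v\<^sup>2) / 2)))"
      using True by (simp add: chi_sq_density_def std_normal_density_def C_def 1)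
    then show ?thesis unfolding 2
      using True a C by (simp add: ennreal_mult[symmetric] chi_sq_density_nonneg)
  qed (simp add: chi_sq_density_def)
  have "(\<integral>\<^sup>+v. \<integral>\<^sup>+s. ennreal ((1 + v\<^sup>2 / s) powr e) \<partial>chi_sq a \<partial>std_normal) =
     (\<integral>\<^sup>+s. \<integral>\<^sup>+v. ennreal ((1 + v\<^sup>2 / s) powr e) \<partial>std_normal \<partial>chi_sq a)"
    by (rule P.Fubini') measurable
  also have "\<dots> = (\<integral>\<^sup>+s. \<integral>\<^sup>+v. ennreal (chi_sq_density a s) * (ennreal (std_normal_density v) * ennreal ((1 + v\<^sup>2 / s) powr e)) \<partial>lborel \<partial>lborel)"
    unfolding chi_sq_def
    by (simp add: nn_integral_density nn_integral_cmult[symmetric])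
  also have "\<dots> = (\<integral>\<^sup>+s. ennreal C * (\<integral>\<^sup>+v. ennreal (indicator {0<..} s * s powr (- \<alpha> - 1)) * ?G (s + v\<^sup>2) \<partial>lborel) \<partial>lborel)"
    unfolding d by (intro nn_integral_cong nn_integral_cmult) measurable
  also have "\<dots> = ennreal C * (\<integral>\<^sup>+s. \<integral>\<^sup>+v. ennreal (indicator {0<..} s * s powr (- \<alpha> - 1)) * ?G (s + v\<^sup>2) \<partial>lborel \<partial>lborel)"
    by (rule nn_integral_cmult) measurable
  also have "\<dots> = ennreal C * (ennreal (sqrt pi * Gamma (- \<alpha>) / Gamma (- \<alpha> + 1 / 2)) *
      (\<integral>\<^sup>+r. ennreal (indicator {0<..} r * r powr (- \<alpha> - 1 / 2)) * ?G r \<partial>lborel))"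
    using \<alpha> by (subst nn_integral_plus_square_powr) auto
  also have "(\<integral>\<^sup>+r. ennreal (indicator {0<..} r * r powr (- \<alpha> - 1 / 2)) * ?G r \<partial>lborel) =
     (\<integral>\<^sup>+r. ennreal (indicator {0<..} r * r powr (a + 1 / 2 - 1) * exp (- r * (1 / 2))) \<partial>lborel)"
  proof (intro nn_integral_cong)
    fix r :: real
    have "r powr (- \<alpha> - 1 / 2) * r powr e = r powr (a + 1 / 2 - 1)"
      by (simp add: powr_add[symmetric] a)
    then have "indicator {0<..} r * r powr (- \<alpha> - 1 / 2) * (r powr e * exp (- r / 2)) =
        indicator {0<..} r * r powr (a + 1 / 2 - 1) * exp (- r * (1 / 2))"
      by (simp add: mult.assoc[symmetric])
    then show "ennreal (indicator {0<..} r * r powr (- \<alpha> - 1 / 2)) * ?G r =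
       ennreal (indicator {0<..} r * r powr (a + 1 / 2 - 1) * exp (- r * (1 / 2)))"
      by (subst ennreal_mult[symmetric]) auto
  qed
  also have "\<dots> = ennreal (Gamma (a + 1 / 2) / (1 / 2) powr (a + 1 / 2))"
    by (rule Gamma_nn_integral_scaled) (use a in auto)
  also have "ennreal C * (ennreal (sqrt pi * Gamma (- \<alpha>) / Gamma (- \<alpha> + 1 / 2)) * \<dots>) =
     ennreal (C * (sqrt pi * Gamma (- \<alpha>) / Gamma (- \<alpha> + 1 / 2) * (Gamma (a + 1 / 2) / (1 / 2) powr (a + 1 / 2))))"
    using C a \<alpha> by (simp add: ennreal_mult[symmetric] Gamma_real_pos less_imp_le del: ennreal_mult'')
  also have "\<dots> \<le> ennreal (Gamma (- \<alpha>) / Gamma (1 / 2 - \<alpha>) * sqrt (real n))"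
  proof (rule ennreal_leI)
    have K: "0 < Gamma (- \<alpha>) / Gamma (1 / 2 - \<alpha>)" using \<alpha> by (simp add: Gamma_real_pos)
    have h: "(1 / 2) powr (a + 1 / 2) = 1 / (2 powr a * sqrt (2::real))"
      by (simp add: powr_add powr_half_sqrt powr_divide)
    have "C * (sqrt pi * Gamma (- \<alpha>) / Gamma (- \<alpha> + 1 / 2) * (Gamma (a + 1 / 2) / (1 / 2) powr (a + 1 / 2))) =
       Gamma (- \<alpha>) / Gamma (1 / 2 - \<alpha>) * (Gamma (a + 1 / 2) / Gamma a)"
      unfolding h using Gamma_real_pos[OF a(1)] by (simp add: C_def real_sqrt_mult add.commute)
    also have "\<dots> \<le> Gamma (- \<alpha>) / Gamma (1 / 2 - \<alpha>) * sqrt (real n)"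
    proof (intro mult_left_mono)
      have "Gamma (a + 1 / 2) / Gamma a \<le> sqrt a"
        using Gamma_half_shift_le[OF a(1)] Gamma_real_pos[OF a(1)] by (simp add: field_simps)
      also have "\<dots> \<le> sqrt (real n)" by (simp add: a_def)
      finally show "Gamma (a + 1 / 2) / Gamma a \<le> sqrt (real n)" .
    qed (use K in auto)
    finally show "C * (sqrt pi * Gamma (- \<alpha>) / Gamma (- \<alpha> + 1 / 2) * (Gamma (a + 1 / 2) / (1 / 2) powr (a + 1 / 2))) \<le>
       Gamma (- \<alpha>) / Gamma (1 / 2 - \<alpha>) * sqrt (real n)" .
  qed
  finally show ?thesis unfolding a_def e_def .
qed

text \<open>
  An explicit majorant of the odds \<open>(1 - p) / p\<close>, where \<open>p\<close> is the posterior probability of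
  \<open>{c..}\<close>. Unlike the odds themselves it is evidently measurable in the statistics.
\<close>

definition odds_bound :: "real \<Rightarrow> nat \<Rightarrow> real \<Rightarrow> real \<Rightarrow> real \<Rightarrow> real" where
  "odds_bound \<alpha> n c x S =
    (if x < c then 2 * pi * sqrt (real n / 2 + \<alpha>) * (1 + real n * (x - c)\<^sup>2 / S) powr ((real n + 2 * \<alpha> - 1) / 2)
     else (1 + real n * (x - c)\<^sup>2 / S) powr (- (real n + 2 * \<alpha> - 1) / 2))"

lemma odds_bound_measurable [measurable]:
  "case_prod (odds_bound \<alpha> n c) \<in> borel_measurable (borel \<Otimes>\<^sub>M borel)"
  unfolding odds_bound_def by measurable

lemma odds_bound_nonneg: "1 \<le> real n / 2 + \<alpha> \<Longrightarrow> 0 \<le> odds_bound \<alpha> n c x S"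
  by (simp add: odds_bound_def)

lemma posterior_odds_le:
  assumes n: "0 < n" and S: "0 < S" and a: "1 \<le> real n / 2 + \<alpha>"
  shows "measure (posterior \<alpha> n x S) {..<c} \<le> odds_bound \<alpha> n c x S * measure (posterior \<alpha> n x S) {c..}"
proof -
  interpret prob_space "posterior \<alpha> n x S" by (rule prob_space_posterior[OF n S a])
  have [simp]: "sets (posterior \<alpha> n x S) = sets borel" "space (posterior \<alpha> n x S) = UNIV"
    by (auto simp: posterior_def)
  define q where "q = 1 + real n * (x - c)\<^sup>2 / S"
  define e where "e = (real n + 2 * \<alpha> - 1) / 2"
  have q: "1 \<le> q" using S by (simp add: q_def)
  have e: "0 \<le> e" using a by (simp add: e_def field_simps)
  have ee: "- (real n + 2 * \<alpha> - 1) / 2 = - e" unfolding e_def by (simp add: minus_divide_left)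
  show ?thesis
  proof (cases "x < c")
    case True
    define k where "k = 2 * pi * sqrt (real n / 2 + \<alpha>)"
    have k: "0 < k" using a by (simp add: k_def)
    have "q powr (- e) / k \<le> prob {c..}"
      using posterior_upper_tail_ge[OF n S a, of "c - x" x] True unfolding ee
      by (simp add: q_def k_def power2_commute)
    then have "1 \<le> k * q powr e * prob {c..}"
      using k q by (simp add: powr_minus field_simps)
    then have "prob {..<c} \<le> k * q powr e * prob {c..}" by (rule order_trans[OF prob_le_1])
    then show ?thesis using True unfolding odds_bound_def q_def[symmetric] e_def[symmetric] k_def[symmetric] by simp
  next
    case False
    have "prob {..<c} \<le> prob {..x - (x - c)}" by (intro finite_measure_mono) auto
    also have "\<dots> \<le> q powr (- e) / 2"
      using posterior_upper_tail[OF n S a, of "x - c" x] False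
      unfolding posterior_symmetric[OF n S a] ee by (simp add: q_def)
    finally have 1: "prob {..<c} \<le> q powr (- e) / 2" .
    have "UNIV - {..<c} = {c..}" by auto
    then have 2: "prob {c..} = 1 - prob {..<c}"
      using prob_compl[of "{..<c}"] by simp
    have "q powr (- e) \<le> 1" using q e by (simp add: powr_le_one_le powr_minus ge_one_powr_ge_zero inverse_le_1_iff)
    with 1 2 have "1 / 2 \<le> prob {c..}" by simp
    then have "q powr (- e) * (1 / 2) \<le> q powr (- e) * prob {c..}" by (intro mult_left_mono) auto
    moreover have "odds_bound \<alpha> n c x S = q powr (- e)"
      using False by (simp only: odds_bound_def q_def ee if_False)
    ultimately show ?thesis using 1 by simp
  qed
qed

text \<open>
  If the sample mean is below \<open>c = \<mu> - \<epsilon>\<close>, the bound is \<open>O(sqrt n)\<close> times the integrand of the beta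
  moment, shifted by \<open>e = sqrt n \<epsilon> / \<sigma>\<close>; the shift gains \<open>exp (- e\<^sup>2 / 2)\<close>. Otherwise the odds are at
  most 1, and they are exponentially small unless the sample mean is below \<open>\<mu> - \<epsilon> / 2\<close> or the
  sum of squares exceeds \<open>2 n \<sigma>\<^sup>2\<close>, which has exponentially small probability.
\<close>

lemma nn_integral_odds_bound_le:
  assumes \<alpha>: "\<alpha> < 0" and n: "2 \<le> n" and a: "1 \<le> real n / 2 + \<alpha>" and \<epsilon>: "0 < \<epsilon>" "\<epsilon> \<le> \<sigma>"
  shows "(\<integral>\<^sup>+u. \<integral>\<^sup>+s. ennreal (odds_bound \<alpha> n (\<mu> - \<epsilon>) (\<mu> + \<sigma> * u / sqrt (real n)) (\<sigma>\<^sup>2 * s))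
      \<partial>chi_sq ((real n - 1) / 2) \<partial>std_normal) \<le>
    ennreal ((2 * pi * (Gamma (- \<alpha>) / Gamma (1 / 2 - \<alpha>)) + 2 + exp (1 - 2 * \<alpha>)) *
      (real n * exp (- real n * (\<epsilon>\<^sup>2 / (32 * \<sigma>\<^sup>2)))))"
proof -
  define k where "k = (real n - 1) / 2"
  define \<nu> where "\<nu> = real n + 2 * \<alpha> - 1"
  (* The rate is chosen small enough for all error terms; the slowest of them is the Student tail
     at distance \<epsilon> / 2 with S = 2 n \<sigma>\<^sup>2. *)
  define \<beta> where "\<beta> = \<epsilon>\<^sup>2 / (32 * \<sigma>\<^sup>2)"
  define e where "e = sqrt (real n) * \<epsilon> / \<sigma>"
  define A where "A = 2 * pi * sqrt (real n / 2 + \<alpha>)"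
  define K where "K = Gamma (- \<alpha>) / Gamma (1 / 2 - \<alpha>)"
  have k: "0 < k" using n by (simp add: k_def)
  have \<sigma>: "0 < \<sigma>" using \<epsilon> by simp
  have \<nu>: "0 \<le> \<nu>" using a by (simp add: \<nu>_def)
  have K: "0 \<le> K" using \<alpha> by (simp add: K_def Gamma_real_pos less_imp_le)
  have A: "0 \<le> A" using a by (simp add: A_def)
  have rn: "0 < sqrt (real n)" using n by simp
  have e: "0 < e" using \<epsilon> \<sigma> rn by (simp add: e_def)
  have e2: "e\<^sup>2 = 32 * (real n * \<beta>)"
    using \<sigma> by (simp add: e_def \<beta>_def power_divide power_mult_distrib)
  have "\<epsilon>\<^sup>2 \<le> \<sigma>\<^sup>2" using \<epsilon> by (intro power_mono) auto
  then have \<beta>: "0 < \<beta>" "\<beta> \<le> 1 / 32" using \<sigma> \<epsilon> by (auto simp: \<beta>_def field_simps)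
  interpret chi: prob_space "chi_sq k" using k by (intro prob_space_chi_sq)
  let ?f = "\<lambda>v s. ennreal ((1 + v\<^sup>2 / s) powr (\<nu> / 2))"
  let ?g = "\<lambda>v. \<integral>\<^sup>+s. ?f v s \<partial>chi_sq k"
  let ?H = "\<lambda>u s. odds_bound \<alpha> n (\<mu> - \<epsilon>) (\<mu> + \<sigma> * u / sqrt (real n)) (\<sigma>\<^sup>2 * s)"
  have pt: "ennreal (?H u s) \<le> ennreal A * (?f (u + e) s * indicator {..< - e} u) +
      (indicator {..< - (e / 2)} u + (indicator {2 * (real n / 2) * (1 + 1)..} s + ennreal ((1 + 4 * \<beta>) powr (- \<nu> / 2))))"
    if s: "0 < s" for u s
  proof -
    have lt: "\<mu> + \<sigma> * u / sqrt (real n) < \<mu> - \<epsilon> \<longleftrightarrow> u < - e"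
      using \<sigma> rn by (auto simp: e_def field_simps)
    have xc: "\<mu> + \<sigma> * u / sqrt (real n) - (\<mu> - \<epsilon>) = \<sigma> / sqrt (real n) * (u + e)"
      using \<sigma> rn by (simp add: e_def field_simps)
    have sq: "real n * (\<mu> + \<sigma> * u / sqrt (real n) - (\<mu> - \<epsilon>))\<^sup>2 / (\<sigma>\<^sup>2 * s) = (u + e)\<^sup>2 / s"
      unfolding xc using \<sigma> n by (simp add: power_mult_distrib power_divide)
    show ?thesis
    proof (cases "u < - e")
      case True
      then have "ennreal (?H u s) = ennreal A * (?f (u + e) s * indicator {..< - e} u)"
        unfolding odds_bound_def sq using A by (simp add: lt A_def[symmetric] \<nu>_def[symmetric] ennreal_mult)
      then show ?thesis by (simp add: add_increasing2)
    next
      case False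
      then have H: "?H u s = (1 + (u + e)\<^sup>2 / s) powr (- \<nu> / 2)"
        unfolding odds_bound_def sq by (simp add: lt \<nu>_def)
      have H1: "?H u s \<le> 1"
        unfolding H using \<nu> s by (simp add: powr_minus_divide[of _ "\<nu> / 2", simplified] powr_minus ge_one_powr_ge_zero inverse_le_1_iff)
      show ?thesis
      proof (cases "u < - (e / 2) \<or> 2 * (real n / 2) * (1 + 1) \<le> s")
        case True
        then have "(1::ennreal) \<le> indicator {..< - (e / 2)} u + indicator {2 * (real n / 2) * (1 + 1)..} s"
          by (auto simp: indicator_def)
        moreover have "ennreal (?H u s) \<le> 1" using H1 by (simp add: ennreal_le_1)
        ultimately have "ennreal (?H u s) \<le> indicator {..< - (e / 2)} u + indicator {2 * (real n / 2) * (1 + 1)..} s"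
          by (rule order_trans[rotated])
        then show ?thesis
          by (rule order_trans) (intro add_increasing[OF zero_le] add_left_mono add_increasing2 zero_le order_refl)
      next
        case False
        then have u: "e / 2 \<le> u + e" and s2: "s \<le> 2 * real n" by auto
        have "4 * \<beta> = (e / 2)\<^sup>2 / (2 * real n)" using n by (simp add: power_divide e2)
        also have "\<dots> \<le> (u + e)\<^sup>2 / s"
          using u s2 s e n by (intro frac_le power_mono) auto
        finally have "?H u s \<le> (1 + 4 * \<beta>) powr (- \<nu> / 2)"
          unfolding H using \<beta> \<nu> by (intro powr_mono2') auto
        then have "ennreal (?H u s) \<le> ennreal ((1 + 4 * \<beta>) powr (- \<nu> / 2))" by (rule ennreal_leI)
        then show ?thesis by (simp add: add_increasing)
      qed
    qed
  qed
  have 1: "(\<integral>\<^sup>+u. ?g (u + e) * indicator {..< - e} u \<partial>std_normal) \<le> ennreal (K * sqrt (real n) * exp (- real n * \<beta>))"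
  proof -
    have "(\<integral>\<^sup>+u. ?g (u + e) * indicator {..< - e} u \<partial>std_normal) \<le> ennreal (exp (- e\<^sup>2 / 2)) * (\<integral>\<^sup>+v. ?g v \<partial>std_normal)"
      using e by (intro std_normal_shift_le) auto
    also have "\<dots> \<le> ennreal (exp (- real n * \<beta>)) * ennreal (K * sqrt (real n))"
      using nn_integral_inverse_beta_moment[OF \<alpha> n] \<beta> unfolding K_def k_def \<nu>_def
      by (intro mult_mono ennreal_leI) (auto simp: e2)
    finally show ?thesis using K by (simp add: ennreal_mult[symmetric] mult_ac)
  qed
  have 2: "emeasure std_normal {..< - (e / 2)} \<le> ennreal (exp (- real n * \<beta>))"
  proof -
    have "emeasure std_normal {..< - (e / 2)} \<le> ennreal (exp (- (e / 2)\<^sup>2 / 2))"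
      using e by (intro std_normal_lower_tail) auto
    also have "\<dots> \<le> ennreal (exp (- real n * \<beta>))"
      using \<beta> by (intro ennreal_leI) (auto simp: power_divide e2)
    finally show ?thesis .
  qed
  have 3: "emeasure (chi_sq k) {2 * (real n / 2) * (1 + 1)..} \<le> ennreal (exp (- real n * \<beta>))"
  proof -
    have "emeasure (chi_sq k) {2 * (real n / 2) * (1 + 1)..} \<le> ennreal (exp (- (real n / 2) * 1\<^sup>2 / 8))"
      using k by (intro chi_sq_upper_tail) (auto simp: k_def)
    also have "\<dots> \<le> ennreal (exp (- real n * \<beta>))"
      using mult_left_mono[OF \<beta>(2), of "real n"] by (intro ennreal_leI) auto
    finally show ?thesis .
  qed
  have 4: "(1 + 4 * \<beta>) powr (- \<nu> / 2) \<le> exp (1 - 2 * \<alpha>) * exp (- real n * \<beta>)"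
  proof -
    have "4 * \<beta> - (4 * \<beta>)\<^sup>2 \<le> ln (1 + 4 * \<beta>)"
      using \<beta> by (intro ln_one_plus_pos_lower_bound) auto
    moreover have "(4 * \<beta>)\<^sup>2 \<le> 2 * \<beta>" using \<beta> by (simp add: power2_eq_square)
    ultimately have "2 * \<beta> \<le> ln (1 + 4 * \<beta>)" by simp
    then have "\<nu> / 2 * (2 * \<beta>) \<le> \<nu> / 2 * ln (1 + 4 * \<beta>)" using \<nu> by (intro mult_left_mono) auto
    then have "- \<nu> / 2 * ln (1 + 4 * \<beta>) \<le> - \<nu> * \<beta>" by simp
    also have "\<dots> = (1 - 2 * \<alpha>) * \<beta> - real n * \<beta>" by (simp add: \<nu>_def algebra_simps)
    also have "\<dots> \<le> (1 - 2 * \<alpha>) * 1 - real n * \<beta>" using \<beta> \<alpha> by (intro diff_right_mono mult_left_mono) auto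
    finally show ?thesis using \<beta> by (simp add: powr_def exp_add[symmetric])
  qed
  have "(\<integral>\<^sup>+u. \<integral>\<^sup>+s. ennreal (?H u s) \<partial>chi_sq k \<partial>std_normal) \<le>
     (\<integral>\<^sup>+u. \<integral>\<^sup>+s. ennreal A * (?f (u + e) s * indicator {..< - e} u) +
      (indicator {..< - (e / 2)} u + (indicator {2 * (real n / 2) * (1 + 1)..} s + ennreal ((1 + 4 * \<beta>) powr (- \<nu> / 2)))) \<partial>chi_sq k \<partial>std_normal)"
    by (intro nn_integral_mono nn_integral_mono_AE eventually_mono[OF AE_chi_sq_pos[OF k]] pt)
  also have "\<dots> = (\<integral>\<^sup>+u. ennreal A * (?g (u + e) * indicator {..< - e} u) +
      (indicator {..< - (e / 2)} u + (emeasure (chi_sq k) {2 * (real n / 2) * (1 + 1)..} + ennreal ((1 + 4 * \<beta>) powr (- \<nu> / 2)))) \<partial>std_normal)"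
    using chi.emeasure_space_1
    by (intro nn_integral_cong) (simp add: nn_integral_add nn_integral_cmult nn_integral_multc)
  also have "\<dots> = ennreal A * (\<integral>\<^sup>+u. ?g (u + e) * indicator {..< - e} u \<partial>std_normal) +
      (emeasure std_normal {..< - (e / 2)} + (emeasure (chi_sq k) {2 * (real n / 2) * (1 + 1)..} + ennreal ((1 + 4 * \<beta>) powr (- \<nu> / 2))))"
    using std_normal.emeasure_space_1
    by (simp add: nn_integral_add nn_integral_cmult)
  also have "\<dots> \<le> ennreal A * ennreal (K * sqrt (real n) * exp (- real n * \<beta>)) +
      (ennreal (exp (- real n * \<beta>)) + (ennreal (exp (- real n * \<beta>)) + ennreal (exp (1 - 2 * \<alpha>) * exp (- real n * \<beta>))))"
    by (intro add_mono mult_left_mono 1 2 3 ennreal_leI 4) auto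
  also have "\<dots> = ennreal ((A * (K * sqrt (real n)) + (2 + exp (1 - 2 * \<alpha>))) * exp (- real n * \<beta>))"
    using A K by (simp add: ennreal_mult[symmetric] ennreal_plus[symmetric] algebra_simps del: ennreal_plus)
  also have "\<dots> \<le> ennreal ((2 * pi * K + 2 + exp (1 - 2 * \<alpha>)) * (real n * exp (- real n * \<beta>)))"
  proof (rule ennreal_leI)
    have "sqrt (real n / 2 + \<alpha>) * sqrt (real n) \<le> sqrt (real n) * sqrt (real n)"
      using \<alpha> by (intro mult_right_mono) auto
    then have "2 * pi * K * (sqrt (real n / 2 + \<alpha>) * sqrt (real n)) \<le> 2 * pi * K * real n"
      using K by (intro mult_left_mono) auto
    then have "A * (K * sqrt (real n)) \<le> 2 * pi * K * real n" by (simp add: A_def mult_ac)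
    moreover have "(2 + exp (1 - 2 * \<alpha>)) * 1 \<le> (2 + exp (1 - 2 * \<alpha>)) * real n"
      using n by (intro mult_left_mono) (auto simp: add_nonneg_nonneg)
    ultimately have "A * (K * sqrt (real n)) + (2 + exp (1 - 2 * \<alpha>)) \<le> (2 * pi * K + 2 + exp (1 - 2 * \<alpha>)) * real n"
      by (simp add: algebra_simps)
    then show "(A * (K * sqrt (real n)) + (2 + exp (1 - 2 * \<alpha>))) * exp (- real n * \<beta>) \<le>
       (2 * pi * K + 2 + exp (1 - 2 * \<alpha>)) * (real n * exp (- real n * \<beta>))"
      unfolding mult.assoc[symmetric] by (rule mult_right_mono) simp
  qed
  finally show ?thesis unfolding k_def K_def \<beta>_def .
qed

text \<open>
  The derivative of the geometric series. The bound is quadratic in \<open>1 / \<beta>\<close>, so for \<open>\<beta>\<close>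
  proportional to \<open>\<epsilon>\<^sup>2\<close> it is \<open>O(\<epsilon> powr - 4)\<close>.
\<close>

lemma sum_mult_exp_le:
  assumes "0 < \<beta>" "\<beta> \<le> 1"
  shows "(\<Sum>n = 1..N. real n * exp (- real n * \<beta>)) \<le> 4 / \<beta>\<^sup>2"
proof -
  define q where "q = exp (- \<beta>)"
  have q: "0 < q" "q < 1" using assms by (auto simp: q_def)
  have qb: "\<beta> / 2 \<le> 1 - q"
  proof -
    have "1 - q \<ge> 1 - 1 / (1 + \<beta>)"
      using assms exp_ge_add_one_self[of \<beta>] by (simp add: q_def exp_minus inverse_eq_divide frac_le)
    moreover have "\<beta> / 2 \<le> 1 - 1 / (1 + \<beta>)" using assms by (simp add: field_simps)
    ultimately show ?thesis by simp
  qed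
  have s: "(\<lambda>n. real (Suc n) * q ^ n) sums (1 / (1 - q)\<^sup>2)"
    using geometric_deriv_sums[of q] q by simp
  have "(\<Sum>n = 1..N. real n * exp (- real n * \<beta>)) = (\<Sum>n<N. real (Suc n) * (q ^ Suc n))"
    unfolding One_nat_def sum.atLeast1_atMost_eq q_def exp_of_nat_mult[symmetric] by (simp only: mult_minus_left mult_minus_right)
  also have "\<dots> \<le> (\<Sum>n<N. real (Suc n) * q ^ n)"
    using q by (intro sum_mono mult_left_mono) (auto simp: mult_le_cancel_right1)
  also have "\<dots> \<le> 1 / (1 - q)\<^sup>2"
    using s q by (intro sum_le_suminf[OF sums_summable[OF s], of "{..<N}", unfolded sums_unique[OF s, symmetric]]) auto
  also have "\<dots> \<le> 1 / (\<beta> / 2)\<^sup>2"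
    using qb assms q by (intro divide_left_mono power_mono mult_pos_pos) auto
  finally show ?thesis by (simp add: power_divide)
qed

lemma D_inf_pos: "d \<noteq> 0 \<Longrightarrow> 0 < v \<Longrightarrow> 0 < D_inf d v"
  unfolding D_inf_def by (intro mult_pos_pos ln_gt_zero) auto

text \<open>
  The left-hand side is a differentiable function of \<open>\<epsilon>\<close> at 0.
\<close>

lemma inverse_D_inf_perturbation:
  assumes \<Delta>: "0 < \<Delta>" and v: "0 < v"
  obtains K \<epsilon>\<^sub>0 where "0 \<le> K" "0 < \<epsilon>\<^sub>0"
    "\<And>\<epsilon>. 0 < \<epsilon> \<Longrightarrow> \<epsilon> < \<epsilon>\<^sub>0 \<Longrightarrow> 1 / D_inf (\<Delta> - 2 * \<epsilon>) (v + \<epsilon>) \<le> 1 / D_inf \<Delta> v + K * \<epsilon>"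
proof -
  define h where "h \<epsilon> = 1 + (\<Delta> - 2 * \<epsilon>)\<^sup>2 / (v + \<epsilon>)" for \<epsilon>
  define g where "g \<epsilon> = 2 / ln (h \<epsilon>)" for \<epsilon>
  have g: "g \<epsilon> = 1 / D_inf (\<Delta> - 2 * \<epsilon>) (v + \<epsilon>)" for \<epsilon>
    by (simp add: g_def h_def D_inf_def)
  have h0: "1 < h 0" using \<Delta> v by (simp add: h_def)
  then have ln0: "0 < ln (h 0)" by (rule ln_gt_zero)
  define h' where "h' = (- 4 * \<Delta> * v - \<Delta>\<^sup>2) / v\<^sup>2"
  have "(h has_real_derivative h') (at 0)"
    unfolding h_def h'_def using v by (auto intro!: derivative_eq_intros simp: power2_eq_square)
  then have lnh: "((\<lambda>\<epsilon>. ln (h \<epsilon>)) has_real_derivative h' / h 0) (at 0)"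
    using h0 by (auto intro!: derivative_eq_intros)
  have "((\<lambda>\<epsilon>. 2 / ln (h \<epsilon>)) has_real_derivative (0 * ln (h 0) - 2 * (h' / h 0)) / (ln (h 0) * ln (h 0))) (at 0)"
    by (rule DERIV_divide[OF DERIV_const lnh]) (use ln0 in simp)
  then have "(g has_real_derivative (0 * ln (h 0) - 2 * (h' / h 0)) / (ln (h 0) * ln (h 0))) (at 0)"
    by (simp only: g_def[abs_def])
  then obtain D where "(g has_real_derivative D) (at 0)" by blast
  then have "((\<lambda>\<epsilon>. (g \<epsilon> - g 0) / \<epsilon>) \<longlongrightarrow> D) (at 0)"
    by (simp add: has_field_derivative_iff)
  then have "\<forall>\<^sub>F \<epsilon> in at 0. (g \<epsilon> - g 0) / \<epsilon> < \<bar>D\<bar> + 1"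
    by (rule order_tendstoD(2)) linarith
  then obtain \<epsilon>\<^sub>0 where e0: "0 < \<epsilon>\<^sub>0" "\<And>\<epsilon>. \<epsilon> \<noteq> 0 \<Longrightarrow> \<bar>\<epsilon>\<bar> < \<epsilon>\<^sub>0 \<Longrightarrow> (g \<epsilon> - g 0) / \<epsilon> < \<bar>D\<bar> + 1"
    by (auto simp: eventually_at)
  show ?thesis
  proof (rule that[OF _ e0(1), of "\<bar>D\<bar> + 1"])
    fix \<epsilon> :: real assume "0 < \<epsilon>" "\<epsilon> < \<epsilon>\<^sub>0"
    then show "1 / D_inf (\<Delta> - 2 * \<epsilon>) (v + \<epsilon>) \<le> 1 / D_inf \<Delta> v + (\<bar>D\<bar> + 1) * \<epsilon>"
      using e0(2)[of \<epsilon>] g[of \<epsilon>] g[of 0] by (simp add: field_simps)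
  qed simp
qed

section \<open>Histories and pull counts\<close>

lemma pulls_Suc: "1 \<le> t \<Longrightarrow> pulls J i (Suc t) \<omega> = pulls J i t \<omega> + (if J t \<omega> = i then 1 else 0)"
proof -
  assume t: "1 \<le> t"
  have "{s \<in> {1..<Suc t}. J s \<omega> = i} = (if J t \<omega> = i then insert t {s \<in> {1..<t}. J s \<omega> = i} else {s \<in> {1..<t}. J s \<omega> = i})"
    using t by (auto simp: less_Suc_eq)
  then show ?thesis by (simp add: pulls_def)
qed

lemma pulls_mono: "s \<le> t \<Longrightarrow> pulls J i s \<omega> \<le> pulls J i t \<omega>"
  unfolding pulls_def by (intro card_mono) auto

lemma pulls_less: "1 \<le> t \<Longrightarrow> pulls J i t \<omega> < t"
proof -
  assume "1 \<le> t"
  have "pulls J i t \<omega> \<le> card {1..<t}" unfolding pulls_def by (intro card_mono) auto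
  then show ?thesis using \<open>1 \<le> t\<close> by simp
qed

text \<open>
  A pull of arm \<open>i\<close> increases its count, so the count takes the value \<open>n\<close> at most once at a
  round where \<open>i\<close> is pulled.
\<close>

lemma card_pull_times_le_1:
  "card {t \<in> {1..T}. J t \<omega> = i \<and> pulls J i t \<omega> = n} \<le> Suc 0"
proof -
  have False if "1 \<le> s" "s < t" "J s \<omega> = i" "pulls J i s \<omega> = n" "pulls J i t \<omega> = n" for s t
    using pulls_Suc[of s J i \<omega>] pulls_mono[of "Suc s" t J i \<omega>] that by simp
  then have "s = t" if "s \<in> {t \<in> {1..T}. J t \<omega> = i \<and> pulls J i t \<omega> = n}"
    "t \<in> {t \<in> {1..T}. J t \<omega> = i \<and> pulls J i t \<omega> = n}" for s t
    using that by (cases s t rule: linorder_cases) auto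
  then show ?thesis by (subst card_le_Suc0_iff_eq) auto
qed

text \<open>
  The length of the initialization is chosen such that the Student laws of all posteriors have at
  least one degree of freedom.
\<close>

lemma init_pulls_bounds:
  assumes "\<alpha> < 0" "init_pulls \<alpha> \<le> n"
  shows "2 \<le> n" "1 \<le> real n / 2 + \<alpha>"
proof -
  have n: "max 2 (3 - \<lceil>2 * \<alpha>\<rceil>) \<le> int n" using assms(2) unfolding init_pulls_def nat_le_iff .
  then show "2 \<le> n" by simp
  have "of_int \<lceil>2 * \<alpha>\<rceil> < 2 * \<alpha> + 1" by linarith
  moreover have "of_int (3 - \<lceil>2 * \<alpha>\<rceil>) \<le> real n" using n by linarith
  ultimately show "1 \<le> real n / 2 + \<alpha>" by simp
qed

definition odds_constant :: "real \<Rightarrow> real" where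
  "odds_constant \<alpha> = 2 * pi * (Gamma (- \<alpha>) / Gamma (1 / 2 - \<alpha>)) + 2 + exp (1 - 2 * \<alpha>)"

lemma odds_constant_nonneg: "\<alpha> < 0 \<Longrightarrow> 0 \<le> odds_constant \<alpha>"
  unfolding odds_constant_def by (intro add_nonneg_nonneg mult_nonneg_nonneg divide_nonneg_nonneg)
    (auto simp: Gamma_real_pos less_imp_le)

context gaussian_thompson_sampling
begin

abbreviation history :: "nat \<Rightarrow> 'a measure" where "history \<equiv> past M \<alpha> X J \<mu>s"

lemma X_measurable: "1 \<le> n \<Longrightarrow> X i n \<in> borel_measurable M"
  using distributed_measurable[OF rewards_normal[of n i]] by simp

lemma history_generators:
  "{X i n -` B \<inter> space M | i n B. 1 \<le> n \<and> B \<in> sets borel}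
      \<union> {J s -` A \<inter> space M | s A. 1 \<le> s \<and> s < t}
      \<union> {\<mu>s i s -` B \<inter> space M | i s B. init_rounds TYPE('k) \<alpha> < s \<and> s < t \<and> B \<in> sets borel} \<subseteq> sets M"
  using X_measurable J_measurable samples_measurable
  by (auto intro!: measurable_sets[where M=M])

lemma sets_history:
  "sets (history t) = sigma_sets (space M) ({X i n -` B \<inter> space M | i n B. 1 \<le> n \<and> B \<in> sets borel}
      \<union> {J s -` A \<inter> space M | s A. 1 \<le> s \<and> s < t}
      \<union> {\<mu>s i s -` B \<inter> space M | i s B. init_rounds TYPE('k) \<alpha> < s \<and> s < t \<and> B \<in> sets borel})"
  unfolding past_def by (rule sets_measure_of) blast

lemma space_history [simp]: "space (history t) = space M"
  unfolding past_def by (rule space_measure_of) blast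

lemma subalgebra_history: "subalgebra M (history t)"
  unfolding subalgebra_def sets_history
  by (intro conjI space_history sets.sigma_sets_subset history_generators)

lemma X_measurable_history: "1 \<le> n \<Longrightarrow> X i n \<in> borel_measurable (history t)"
  by (intro measurableI) (auto simp: sets_history intro!: sigma_sets.Basic)

lemma J_measurable_history: "1 \<le> s \<Longrightarrow> s < t \<Longrightarrow> J s \<in> measurable (history t) (count_space UNIV)"
  by (intro measurableI, simp, unfold sets_history space_history, rule sigma_sets.Basic) blast

text \<open>
  The counts before round \<open>t\<close> belong to the history, and so do the statistics of all arms for every
  number \<open>n\<close> of rewards, observed or not. Hence a weight that depends on the statistics for a fixed
  \<open>n\<close> is a constant when conditioning on the history.
\<close>

lemma pulls_measurable_history [measurable]: "pulls J i t \<in> measurable (history t) (count_space UNIV)"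
proof -
  have "(\<lambda>\<omega>. \<Sum>s\<in>{1..<t}. if J s \<omega> = i then 1 else 0 :: nat) \<in> measurable (history t) (count_space UNIV)"
  proof (rule measurable_sum_nat)
    fix s assume "s \<in> {1..<t}"
    then have [measurable]: "J s \<in> measurable (history t) (count_space UNIV)" by (auto intro!: J_measurable_history)
    show "(\<lambda>\<omega>. if J s \<omega> = i then 1 else 0 :: nat) \<in> measurable (history t) (count_space UNIV)" by measurable
  qed
  moreover have "(\<Sum>s\<in>{1..<t}. if J s \<omega> = i then 1 else 0 :: nat) = pulls J i t \<omega>" for \<omega>
    unfolding pulls_def by (subst sum.inter_filter[symmetric]) auto
  ultimately show ?thesis by simp
qed

lemma sample_mean_measurable_history [measurable]: "sample_mean X i n \<in> borel_measurable (history t)"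
  unfolding sample_mean_def
  by (intro borel_measurable_divide borel_measurable_sum X_measurable_history) auto

lemma sum_sq_dev_measurable_history [measurable]: "sum_sq_dev X i n \<in> borel_measurable (history t)"
  unfolding sum_sq_dev_def
  by (intro borel_measurable_power borel_measurable_diff borel_measurable_sum X_measurable_history
      sample_mean_measurable_history) auto

lemmas [measurable] =
  measurable_from_subalg[OF subalgebra_history pulls_measurable_history]
  measurable_from_subalg[OF subalgebra_history sample_mean_measurable_history[where t=0]]
  measurable_from_subalg[OF subalgebra_history sum_sq_dev_measurable_history[where t=0]]

lemma init_ge_1: "1 \<le> init_rounds TYPE('k) \<alpha>"
  by (simp add: init_rounds_def init_pulls_def)

lemma pulls_ge_init: "init_rounds TYPE('k) \<alpha> < t \<Longrightarrow> \<omega> \<in> space M \<Longrightarrow> init_pulls \<alpha> \<le> pulls J i t \<omega>"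
  using pulls_mono[of "init_rounds TYPE('k) \<alpha> + 1" t J i \<omega>] initialization[of \<omega> i] by simp

definition pull_event :: "'k \<Rightarrow> nat \<Rightarrow> nat \<Rightarrow> 'a set" where
  "pull_event i n t = {\<omega> \<in> space M. J t \<omega> = i \<and> pulls J i t \<omega> = n}"

lemma pull_event_sets: "1 \<le> t \<Longrightarrow> pull_event i n t \<in> sets M"
proof -
  assume "1 \<le> t"
  then have [measurable]: "J t \<in> measurable M (count_space UNIV)" by (rule J_measurable)
  show ?thesis unfolding pull_event_def by measurable
qed

text \<open>
  The events over which the sum extends are disjoint.
\<close>

lemma sum_integral_pull_event_le:
  fixes h :: "'a \<Rightarrow> real"
  assumes h: "integrable M h" "\<And>\<omega>. 0 \<le> h \<omega>" and A: "A \<subseteq> {1..T}"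
  shows "(\<Sum>t\<in>A. \<integral>\<omega>. indicator (pull_event i n t) \<omega> * h \<omega> \<partial>M) \<le> (\<integral>\<omega>. h \<omega> \<partial>M)"
proof -
  have int: "integrable M (\<lambda>\<omega>. indicator (pull_event i n t) \<omega> * h \<omega>)" if "t \<in> A" for t
    using integrable_mult_indicator[OF _ h(1), of "pull_event i n t"] pull_event_sets[of t i n] that A by auto
  have "(\<Sum>t\<in>A. \<integral>\<omega>. indicator (pull_event i n t) \<omega> * h \<omega> \<partial>M) =
      (\<integral>\<omega>. (\<Sum>t\<in>A. indicator (pull_event i n t) \<omega> * h \<omega>) \<partial>M)"
    by (rule Bochner_Integration.integral_sum[symmetric], rule int)
  also have "\<dots> \<le> (\<integral>\<omega>. h \<omega> \<partial>M)"
  proof (rule integral_mono)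
    fix \<omega> assume \<omega>: "\<omega> \<in> space M"
    have "(\<Sum>t\<in>A. indicator (pull_event i n t) \<omega> :: real) \<le> (\<Sum>t\<in>{1..T}. indicator (pull_event i n t) \<omega>)"
      using A by (intro sum_mono2) auto
    also have "\<dots> = (\<Sum>t\<in>{1..T}. if J t \<omega> = i \<and> pulls J i t \<omega> = n then 1 else 0)"
      using \<omega> by (intro sum.cong) (auto simp: pull_event_def)
    also have "\<dots> = real (card {t \<in> {1..T}. J t \<omega> = i \<and> pulls J i t \<omega> = n})"
      by (subst sum.inter_filter[symmetric]) auto
    also have "\<dots> \<le> 1" using card_pull_times_le_1[of T J \<omega> i n] by simp
    finally show "(\<Sum>t\<in>A. indicator (pull_event i n t) \<omega> * h \<omega>) \<le> h \<omega>"
      using h(2)[of \<omega>] by (simp add: sum_distrib_right[symmetric] mult_left_le_one_le sum_nonneg)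
  qed (use h int in auto)
  finally show ?thesis .
qed

lemma sum_prob_pull_event_le:
  assumes "P \<in> sets M" "A \<subseteq> {1..T}"
  shows "(\<Sum>t\<in>A. prob (pull_event i n t \<inter> P)) \<le> prob P"
proof -
  have "(\<integral>\<omega>. indicator (pull_event i n t) \<omega> * indicator P \<omega> \<partial>M) = prob (pull_event i n t \<inter> P)" if "t \<in> A" for t
    using pull_event_sets[of t i n] that assms by (auto simp: indicator_inter_arith[symmetric])
  then show ?thesis
    using sum_integral_pull_event_le[of "indicator P :: 'a \<Rightarrow> real" A T i n] assms
    by (simp add: integrable_real_indicator less_top[symmetric] cong: sum.cong)
qed

lemma AE_sum_sq_dev_pos:
  assumes "0 < \<sigma> i" "2 \<le> n"
  shows "AE \<omega> in M. 0 < sum_sq_dev X i n \<omega>"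
proof -
  define k where "k = (real n - 1) / 2"
  have k: "0 < k" using assms by (simp add: k_def)
  have "(\<integral>\<^sup>+\<omega>. indicator {..0} (sum_sq_dev X i n \<omega>) \<partial>M) =
     (\<integral>\<^sup>+u. \<integral>\<^sup>+s. indicator {..0} ((\<sigma> i)\<^sup>2 * s) \<partial>chi_sq k \<partial>std_normal)"
    unfolding k_def using assms by (intro arm_statistics_law) auto
  also have "\<dots> = (\<integral>\<^sup>+u. \<integral>\<^sup>+s. 0 \<partial>chi_sq k \<partial>std_normal)"
  proof (rule nn_integral_cong, rule nn_integral_cong_AE, rule eventually_mono[OF AE_chi_sq_pos[OF k]])
    fix s :: real assume "0 < s"
    then have "0 < (\<sigma> i)\<^sup>2 * s" using assms by simp
    then show "indicator {..0} ((\<sigma> i)\<^sup>2 * s) = (0::ennreal)" by simp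
  qed
  finally have "(\<integral>\<^sup>+\<omega>. indicator {..0} (sum_sq_dev X i n \<omega>) \<partial>M) = 0" by simp
  then have "AE \<omega> in M. indicator {..0} (sum_sq_dev X i n \<omega>) = (0::ennreal)"
    by (subst (asm) nn_integral_0_iff_AE) auto
  then show ?thesis by eventually_elim (auto simp: indicator_def split: if_splits)
qed

lemma sampling_event_sets:
  assumes "init_rounds TYPE('k) \<alpha> < t" "\<And>j. B j \<in> sets borel"
  shows "{\<omega> \<in> space M. \<forall>j. \<mu>s j t \<omega> \<in> B j} \<in> sets M"
proof -
  have [measurable]: "\<mu>s j t \<in> borel_measurable M" for j using assms by (simp add: samples_measurable)
  have [measurable]: "B j \<in> sets borel" for j by (rule assms)
  show ?thesis by measurable
qed

text \<open>
  The form in which the conditional law of the posterior samples is used: integrals over a sampling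
  event, weighted by a function of the history. The weight may be unbounded, as the odds are.
\<close>

lemma integral_sampling_event:
  assumes "init_rounds TYPE('k) \<alpha> < t" "\<And>j. B j \<in> sets borel" "f \<in> borel_measurable (history t)" "integrable M f"
  defines "E \<equiv> {\<omega> \<in> space M. \<forall>j. \<mu>s j t \<omega> \<in> B j}"
  shows "integrable M (\<lambda>\<omega>. f \<omega> * real_cond_exp M (history t) (indicator E) \<omega>)"
    "(\<integral>\<omega>. f \<omega> * real_cond_exp M (history t) (indicator E) \<omega> \<partial>M) = (\<integral>\<omega>. f \<omega> * indicator E \<omega> \<partial>M)"
proof -
  interpret F: finite_measure_subalgebra M "history t"
    by unfold_locales (rule subalgebra_history)
  have E[measurable]: "E \<in> sets M" unfolding E_def using assms(1,2) by (rule sampling_event_sets)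
  have "integrable M (\<lambda>\<omega>. f \<omega> * indicator E \<omega>)"
    using integrable_mult_indicator[OF E assms(4)] by (simp add: mult.commute)
  from F.real_cond_exp_intg[OF this assms(3)] E
  show "integrable M (\<lambda>\<omega>. f \<omega> * real_cond_exp M (history t) (indicator E) \<omega>)"
    "(\<integral>\<omega>. f \<omega> * real_cond_exp M (history t) (indicator E) \<omega> \<partial>M) = (\<integral>\<omega>. f \<omega> * indicator E \<omega> \<partial>M)"
    by auto
qed

section \<open>Rounds in which every sample is low\<close>

definition low_samples :: "real \<Rightarrow> nat \<Rightarrow> 'a set" where
  "low_samples c t = {\<omega> \<in> space M. \<forall>j. \<mu>s j t \<omega> < c}"

lemma low_samples_sets: "init_rounds TYPE('k) \<alpha> < t \<Longrightarrow> low_samples c t \<in> sets M"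
  unfolding low_samples_def using sampling_event_sets[of t "\<lambda>_. {..<c}"] by simp

definition inaccurate :: "'k \<Rightarrow> real \<Rightarrow> nat \<Rightarrow> 'a set" where
  "inaccurate i \<epsilon> n = {\<omega> \<in> space M. \<mu> i + \<epsilon> < sample_mean X i n \<omega> \<or> real n * ((\<sigma> i)\<^sup>2 + \<epsilon>) \<le> sum_sq_dev X i n \<omega>}"

context
  assumes \<sigma>_pos: "\<And>i. 0 < \<sigma> i" and \<alpha>_neg: "\<alpha> < 0"
begin

lemma AE_all_sum_sq_dev_pos: "AE \<omega> in M. \<forall>i n. 2 \<le> n \<longrightarrow> 0 < sum_sq_dev X i n \<omega>"
  using AE_sum_sq_dev_pos[OF \<sigma>_pos] by (intro AE_all_countable[THEN iffD2] allI AE_impI) auto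

text \<open>
  Let \<open>lo\<close> be the event that all samples are below \<open>c\<close>, and \<open>hit\<close> the event that only the sample
  of arm \<open>i\<close> is not. By conditional independence their conditional probabilities are \<open>(1 - p) Q\<close>
  and \<open>p Q\<close>, with the same factor \<open>Q\<close> from the other arms, so the first is at most the odds times
  the second. On \<open>hit\<close> the maximal sample is that of arm \<open>i\<close>, hence \<open>i\<close> is pulled.
\<close>

lemma prob_low_samples_le:
  assumes t: "init_rounds TYPE('k) \<alpha> < t" and n: "init_pulls \<alpha> \<le> n"
    and H: "integrable M (\<lambda>\<omega>. odds_bound \<alpha> n c (sample_mean X i n \<omega>) (sum_sq_dev X i n \<omega>))"
  shows "prob (low_samples c t \<inter> {\<omega> \<in> space M. pulls J i t \<omega> = n}) \<le>
    (\<integral>\<omega>. indicator (pull_event i n t) \<omega> * odds_bound \<alpha> n c (sample_mean X i n \<omega>) (sum_sq_dev X i n \<omega>) \<partial>M)"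
proof -
  note n2 = init_pulls_bounds[OF \<alpha>_neg n]
  define h where "h \<omega> = odds_bound \<alpha> n c (sample_mean X i n \<omega>) (sum_sq_dev X i n \<omega>)" for \<omega>
  have h0: "0 \<le> h \<omega>" for \<omega> unfolding h_def using n2 by (intro odds_bound_nonneg)
  have hm[measurable]: "h \<in> borel_measurable (history t)" unfolding h_def by measurable
  have hi: "integrable M h" using H by (simp add: h_def[abs_def])
  define N where "N = {\<omega> \<in> space M. pulls J i t \<omega> = n}"
  have N[measurable]: "N \<in> sets (history t)" unfolding N_def space_history[of t, symmetric] by measurable
  have NM[measurable]: "N \<in> sets M" unfolding N_def by measurable
  define B where "B = (\<lambda>j. if j = i then {c..} else {..<c})"
  define lo where "lo = {\<omega> \<in> space M. \<forall>j. \<mu>s j t \<omega> \<in> {..<c}}"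
  define hit where "hit = {\<omega> \<in> space M. \<forall>j. \<mu>s j t \<omega> \<in> B j}"
  have Bb: "B j \<in> sets borel" for j by (simp add: B_def)
  have lo: "low_samples c t = lo" by (simp add: low_samples_def lo_def)
  have sm: "lo \<in> sets M" "hit \<in> sets M"
    unfolding lo_def hit_def by (rule sampling_event_sets[OF t], simp add: Bb)+
  let ?ce = "\<lambda>E. real_cond_exp M (history t) (indicator E)"
  note ce_lo = integral_sampling_event[OF t, of "\<lambda>_. {..<c}", OF lessThan_borel, folded lo_def]
  note ce_hit = integral_sampling_event[OF t, of B, OF Bb, folded hit_def]
  have Ni: "integrable M (indicator N :: 'a \<Rightarrow> real)" by (simp add: integrable_real_indicator less_top[symmetric])
  have Nhi: "integrable M (\<lambda>\<omega>. indicator N \<omega> * h \<omega>)"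
    using integrable_mult_indicator[OF NM hi] by simp
  have "prob (lo \<inter> N) = (\<integral>\<omega>. indicator N \<omega> * indicator lo \<omega> \<partial>M)"
    using sm by (simp add: indicator_inter_arith[symmetric] Int_commute)
  also have "\<dots> = (\<integral>\<omega>. indicator N \<omega> * ?ce lo \<omega> \<partial>M)"
    using ce_lo(2)[of "indicator N"] Ni by simp
  also have "\<dots> \<le> (\<integral>\<omega>. (indicator N \<omega> * h \<omega>) * ?ce hit \<omega> \<partial>M)"
  proof (rule integral_mono_AE)
    show "integrable M (\<lambda>\<omega>. indicator N \<omega> * ?ce lo \<omega>)" using Ni by (intro ce_lo(1)) auto
    show "integrable M (\<lambda>\<omega>. (indicator N \<omega> * h \<omega>) * ?ce hit \<omega>)" using Nhi by (intro ce_hit(1)) auto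
    show "AE \<omega> in M. indicator N \<omega> * ?ce lo \<omega> \<le> (indicator N \<omega> * h \<omega>) * ?ce hit \<omega>"
      using posterior_sampling[OF t, of "\<lambda>_. {..<c}", OF lessThan_borel, folded lo_def]
        posterior_sampling[OF t, of B, OF Bb, folded hit_def] AE_all_sum_sq_dev_pos
    proof eventually_elim
      case (elim \<omega>)
      show ?case
      proof (cases "\<omega> \<in> N")
        case True
        define p where "p j = posterior \<alpha> (pulls J j t \<omega>) (sample_mean X j (pulls J j t \<omega>) \<omega>) (sum_sq_dev X j (pulls J j t \<omega>) \<omega>)" for j
        define Q where "Q = (\<Prod>j\<in>UNIV - {i}. measure (p j) {..<c})"
        have Q0: "0 \<le> Q" unfolding Q_def by (intro prod_nonneg) auto
        have lo': "?ce lo \<omega> = measure (p i) {..<c} * Q"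
          unfolding Q_def using elim(1) by (simp add: p_def prod.remove[of UNIV i])
        have hit': "?ce hit \<omega> = measure (p i) {c..} * Q"
          unfolding Q_def using elim(2) by (simp add: p_def B_def prod.remove[of UNIV i])
        have "measure (p i) {..<c} \<le> h \<omega> * measure (p i) {c..}"
          using True elim(3) n2 posterior_odds_le[of n "sum_sq_dev X i n \<omega>" \<alpha> "sample_mean X i n \<omega>" c]
          by (simp add: p_def N_def h_def)
        then have "measure (p i) {..<c} * Q \<le> h \<omega> * measure (p i) {c..} * Q"
          using Q0 by (rule mult_right_mono)
        then show ?thesis using True by (simp add: lo' hit' mult.assoc)
      qed simp
    qed
  qed
  also have "\<dots> = (\<integral>\<omega>. (indicator N \<omega> * h \<omega>) * indicator hit \<omega> \<partial>M)"
    using Nhi by (intro ce_hit(2)) auto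
  also have "\<dots> \<le> (\<integral>\<omega>. indicator (pull_event i n t) \<omega> * h \<omega> \<partial>M)"
  proof (rule integral_mono)
    show "integrable M (\<lambda>\<omega>. (indicator N \<omega> * h \<omega>) * indicator hit \<omega>)"
      using integrable_mult_indicator[OF sm(2) Nhi] by (simp add: mult.commute)
    show "integrable M (\<lambda>\<omega>. indicator (pull_event i n t) \<omega> * h \<omega>)"
      using integrable_mult_indicator[OF _ hi, of "pull_event i n t"] pull_event_sets[of t i n] t by simp
    fix \<omega> assume \<omega>: "\<omega> \<in> space M"
    have "J t \<omega> = i" if "\<omega> \<in> hit"
    proof (rule ccontr)
      assume ne: "J t \<omega> \<noteq> i"
      have "\<mu>s j t \<omega> \<in> B j" for j using that by (auto simp: hit_def)
      from this[of i] this[of "J t \<omega>"] have "c \<le> \<mu>s i t \<omega>" "\<mu>s (J t \<omega>) t \<omega> < c"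
        using ne by (auto simp: B_def)
      with pull_maximizer[OF t \<omega>, of i] show False by simp
    qed
    then show "(indicator N \<omega> * h \<omega>) * indicator hit \<omega> \<le> indicator (pull_event i n t) \<omega> * h \<omega>"
      using h0[of \<omega>] \<omega> by (auto simp: N_def pull_event_def indicator_def)
  qed
  finally show ?thesis unfolding lo N_def h_def .
qed

lemma space_partition_pulls:
  assumes "init_rounds TYPE('k) \<alpha> < t" "t \<le> T" "P \<in> sets M"
  shows "prob P \<le> (\<Sum>n = init_pulls \<alpha>..T. prob (P \<inter> {\<omega> \<in> space M. pulls J i t \<omega> = n}))"
proof -
  have "pulls J i t \<omega> \<in> {init_pulls \<alpha>..T}" if "\<omega> \<in> space M" for \<omega>
    using pulls_ge_init[OF assms(1) that, of i] pulls_less[of t J i \<omega>] assms(1,2) by simp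
  then have "P = (\<Union>n\<in>{init_pulls \<alpha>..T}. P \<inter> {\<omega> \<in> space M. pulls J i t \<omega> = n})"
    using sets.sets_into_space[OF assms(3)] by fast
  also have "prob \<dots> \<le> (\<Sum>n = init_pulls \<alpha>..T. prob (P \<inter> {\<omega> \<in> space M. pulls J i t \<omega> = n}))"
    using assms by (intro measure_UNION_le) auto
  finally show ?thesis .
qed

lemma integral_odds_bound_le:
  assumes n: "init_pulls \<alpha> \<le> n" and \<epsilon>: "0 < \<epsilon>" "\<epsilon> \<le> \<sigma> i"
  defines "h \<equiv> \<lambda>\<omega>. odds_bound \<alpha> n (\<mu> i - \<epsilon>) (sample_mean X i n \<omega>) (sum_sq_dev X i n \<omega>)"
  shows "integrable M h"
    "(\<integral>\<omega>. h \<omega> \<partial>M) \<le> odds_constant \<alpha> * (real n * exp (- real n * (\<epsilon>\<^sup>2 / (32 * (\<sigma> i)\<^sup>2))))"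
proof -
  note n2 = init_pulls_bounds[OF \<alpha>_neg n]
  have h0: "0 \<le> h \<omega>" for \<omega> unfolding h_def using n2 by (intro odds_bound_nonneg)
  have hm[measurable]: "h \<in> borel_measurable M" unfolding h_def by measurable
  have "(\<integral>\<^sup>+\<omega>. ennreal (h \<omega>) \<partial>M) = (\<integral>\<^sup>+u. \<integral>\<^sup>+s. ennreal (odds_bound \<alpha> n (\<mu> i - \<epsilon>) (\<mu> i + \<sigma> i * u / sqrt (real n)) ((\<sigma> i)\<^sup>2 * s))
      \<partial>chi_sq ((real n - 1) / 2) \<partial>std_normal)"
    unfolding h_def using n2 \<sigma>_pos by (intro arm_statistics_law) auto
  also have "\<dots> \<le> ennreal (odds_constant \<alpha> * (real n * exp (- real n * (\<epsilon>\<^sup>2 / (32 * (\<sigma> i)\<^sup>2)))))"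
    unfolding odds_constant_def by (rule nn_integral_odds_bound_le[OF \<alpha>_neg n2 \<epsilon>])
  finally have le: "(\<integral>\<^sup>+\<omega>. ennreal (h \<omega>) \<partial>M) \<le> ennreal (odds_constant \<alpha> * (real n * exp (- real n * (\<epsilon>\<^sup>2 / (32 * (\<sigma> i)\<^sup>2)))))" .
  show "integrable M h"
    using le h0 by (intro integrableI_nonneg) (auto simp: le_less_trans)
  then have "ennreal (\<integral>\<omega>. h \<omega> \<partial>M) = (\<integral>\<^sup>+\<omega>. ennreal (h \<omega>) \<partial>M)"
    using h0 by (intro nn_integral_eq_integral[symmetric]) auto
  with le have "ennreal (\<integral>\<omega>. h \<omega> \<partial>M) \<le> ennreal (odds_constant \<alpha> * (real n * exp (- real n * (\<epsilon>\<^sup>2 / (32 * (\<sigma> i)\<^sup>2)))))"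
    by (simp only:)
  then show "(\<integral>\<omega>. h \<omega> \<partial>M) \<le> odds_constant \<alpha> * (real n * exp (- real n * (\<epsilon>\<^sup>2 / (32 * (\<sigma> i)\<^sup>2))))"
    using odds_constant_nonneg[OF \<alpha>_neg] by (subst (asm) ennreal_le_iff) auto
qed

text \<open>
  Each value \<open>n\<close> of the pull count of arm \<open>i\<close> is left by a single pull, so summing the previous
  bound over all rounds leaves one expected value of the odds for every \<open>n\<close>, however large
  \<open>T\<close> is.
\<close>

lemma sum_prob_low_samples_le:
  assumes \<epsilon>: "0 < \<epsilon>" "\<epsilon> \<le> \<sigma> i"
  shows "(\<Sum>t\<in>{init_rounds TYPE('k) \<alpha><..T}. prob (low_samples (\<mu> i - \<epsilon>) t)) \<le> odds_constant \<alpha> * (4 / (\<epsilon>\<^sup>2 / (32 * (\<sigma> i)\<^sup>2))\<^sup>2)"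
proof -
  define \<beta> where "\<beta> = \<epsilon>\<^sup>2 / (32 * (\<sigma> i)\<^sup>2)"
  have "\<epsilon>\<^sup>2 \<le> (\<sigma> i)\<^sup>2" using \<epsilon> by (intro power_mono) auto
  then have "\<epsilon>\<^sup>2 \<le> 32 * (\<sigma> i)\<^sup>2" using zero_le_power2[of "\<sigma> i"] by linarith
  then have \<beta>: "0 < \<beta>" "\<beta> \<le> 1" using \<sigma>_pos[of i] \<epsilon> by (auto simp: \<beta>_def)
  let ?c = "\<mu> i - \<epsilon>"
  let ?h = "\<lambda>n \<omega>. odds_bound \<alpha> n ?c (sample_mean X i n \<omega>) (sum_sq_dev X i n \<omega>)"
  have "(\<Sum>t\<in>{init_rounds TYPE('k) \<alpha><..T}. prob (low_samples ?c t)) \<le>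
      (\<Sum>t\<in>{init_rounds TYPE('k) \<alpha><..T}. \<Sum>n = init_pulls \<alpha>..T. prob (low_samples ?c t \<inter> {\<omega> \<in> space M. pulls J i t \<omega> = n}))"
    by (intro sum_mono space_partition_pulls low_samples_sets) auto
  also have "\<dots> \<le> (\<Sum>t\<in>{init_rounds TYPE('k) \<alpha><..T}. \<Sum>n = init_pulls \<alpha>..T. \<integral>\<omega>. indicator (pull_event i n t) \<omega> * ?h n \<omega> \<partial>M)"
    using \<epsilon> by (intro sum_mono prob_low_samples_le integral_odds_bound_le) auto
  also have "\<dots> = (\<Sum>n = init_pulls \<alpha>..T. \<Sum>t\<in>{init_rounds TYPE('k) \<alpha><..T}. \<integral>\<omega>. indicator (pull_event i n t) \<omega> * ?h n \<omega> \<partial>M)"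
    by (rule sum.swap)
  also have "\<dots> \<le> (\<Sum>n = init_pulls \<alpha>..T. \<integral>\<omega>. ?h n \<omega> \<partial>M)"
    using \<epsilon> init_pulls_bounds[OF \<alpha>_neg] init_ge_1
    by (intro sum_mono sum_integral_pull_event_le[where T=T] integral_odds_bound_le odds_bound_nonneg) auto
  also have "\<dots> \<le> (\<Sum>n = init_pulls \<alpha>..T. odds_constant \<alpha> * (real n * exp (- real n * \<beta>)))"
    using \<epsilon> unfolding \<beta>_def by (intro sum_mono integral_odds_bound_le) auto
  also have "\<dots> \<le> (\<Sum>n = 1..T. odds_constant \<alpha> * (real n * exp (- real n * \<beta>)))"
    using odds_constant_nonneg[OF \<alpha>_neg] init_pulls_bounds[OF \<alpha>_neg] by (intro sum_mono2) fastforce+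
  also have "\<dots> \<le> odds_constant \<alpha> * (4 / \<beta>\<^sup>2)"
    unfolding sum_distrib_left[symmetric]
    using odds_constant_nonneg[OF \<alpha>_neg] \<beta> by (intro mult_left_mono sum_mult_exp_le) auto
  finally show ?thesis unfolding \<beta>_def .
qed

section \<open>Inaccurate statistics and optimistic samples\<close>

lemma prob_inaccurate_le:
  assumes n: "2 \<le> n" and \<epsilon>: "0 < \<epsilon>" "\<epsilon> \<le> (\<sigma> i)\<^sup>2"
  shows "prob (inaccurate i \<epsilon> n) \<le> exp (- real n * (\<epsilon>\<^sup>2 / (2 * (\<sigma> i)\<^sup>2))) + exp (- real n * (\<epsilon>\<^sup>2 / (16 * (\<sigma> i) ^ 4)))"
proof -
  define k where "k = (real n - 1) / 2"
  define e where "e = sqrt (real n) * \<epsilon> / \<sigma> i"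
  define \<delta> where "\<delta> = \<epsilon> / (\<sigma> i)\<^sup>2"
  have k: "0 < k" "k \<le> real n / 2" using n by (auto simp: k_def)
  have s: "0 < \<sigma> i" by (rule \<sigma>_pos)
  have rn: "0 < sqrt (real n)" using n by simp
  have e: "0 \<le> e" using \<epsilon> s by (simp add: e_def)
  have \<delta>: "0 \<le> \<delta>" "\<delta> \<le> 1" using \<epsilon> s by (auto simp: \<delta>_def)
  interpret chi: prob_space "chi_sq k" using k by (intro prob_space_chi_sq)
  let ?I = "\<lambda>x S. indicator ({\<mu> i + \<epsilon> <..} \<times> UNIV \<union> UNIV \<times> {real n * ((\<sigma> i)\<^sup>2 + \<epsilon>)..}) (x, S) :: ennreal"
  have [measurable]: "inaccurate i \<epsilon> n \<in> sets M" unfolding inaccurate_def by measurable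
  have "emeasure M (inaccurate i \<epsilon> n) = (\<integral>\<^sup>+\<omega>. ?I (sample_mean X i n \<omega>) (sum_sq_dev X i n \<omega>) \<partial>M)"
    unfolding nn_integral_indicator[symmetric, OF \<open>inaccurate i \<epsilon> n \<in> sets M\<close>]
    by (rule nn_integral_cong) (auto simp: inaccurate_def indicator_def)
  also have "\<dots> = (\<integral>\<^sup>+u. \<integral>\<^sup>+s. ?I (\<mu> i + \<sigma> i * u / sqrt (real n)) ((\<sigma> i)\<^sup>2 * s) \<partial>chi_sq k \<partial>std_normal)"
    unfolding k_def by (rule arm_statistics_law[OF s n]) measurable
  also have "\<dots> \<le> (\<integral>\<^sup>+u. \<integral>\<^sup>+s. indicator {e <..} u + indicator {2 * (real n / 2) * (1 + \<delta>)..} s \<partial>chi_sq k \<partial>std_normal)"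
  proof (intro nn_integral_mono)
    fix u t :: real
    have "\<mu> i + \<epsilon> < \<mu> i + \<sigma> i * u / sqrt (real n) \<longleftrightarrow> e < u"
      using s rn by (simp add: e_def field_simps)
    moreover have eq: "real n * ((\<sigma> i)\<^sup>2 + \<epsilon>) = (\<sigma> i)\<^sup>2 * (2 * (real n / 2) * (1 + \<delta>))"
      using s by (simp add: \<delta>_def field_simps)
    have "real n * ((\<sigma> i)\<^sup>2 + \<epsilon>) \<le> (\<sigma> i)\<^sup>2 * t \<longleftrightarrow> 2 * (real n / 2) * (1 + \<delta>) \<le> t"
      unfolding eq using s by (intro mult_le_cancel_left_pos) simp
    ultimately show "?I (\<mu> i + \<sigma> i * u / sqrt (real n)) ((\<sigma> i)\<^sup>2 * t) \<le>
        indicator {e <..} u + indicator {2 * (real n / 2) * (1 + \<delta>)..} t"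
      by (auto simp: indicator_def)
  qed
  also have "\<dots> = emeasure std_normal {e <..} + emeasure (chi_sq k) {2 * (real n / 2) * (1 + \<delta>)..}"
    using chi.emeasure_space_1 std_normal.emeasure_space_1 by (simp add: nn_integral_add)
  also have "\<dots> \<le> ennreal (exp (- e\<^sup>2 / 2)) + ennreal (exp (- (real n / 2) * \<delta>\<^sup>2 / 8))"
    using e k \<delta> by (intro add_mono std_normal_upper_tail chi_sq_upper_tail) auto
  also have "- e\<^sup>2 / 2 = - real n * (\<epsilon>\<^sup>2 / (2 * (\<sigma> i)\<^sup>2))"
    using n by (simp add: e_def power_divide power_mult_distrib)
  also have "- (real n / 2) * \<delta>\<^sup>2 / 8 = - real n * (\<epsilon>\<^sup>2 / (16 * (\<sigma> i) ^ 4))"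
    by (simp add: \<delta>_def power_divide)
  finally show ?thesis
    by (simp add: emeasure_eq_measure ennreal_plus[symmetric] del: ennreal_plus)
qed

text \<open>
  If the statistics of arm \<open>i\<close> are accurate, a sample above \<open>c\<close> lies at distance at least \<open>d\<close> from
  the sample mean, and the Student tail at this distance is
  \<open>exp (- (n + 2 \<alpha> - 1) D_inf d (\<sigma>\<^sup>2 + \<epsilon>)) / 2\<close> or less.
\<close>

lemma prob_optimistic_sample_le:
  assumes t: "init_rounds TYPE('k) \<alpha> < t" and n: "init_pulls \<alpha> \<le> n" and \<epsilon>: "0 < \<epsilon>"
    and d: "0 < d" "d = c - (\<mu> i + \<epsilon>)"
    and q: "ln T \<le> (real n + 2 * \<alpha> - 1) * D_inf d ((\<sigma> i)\<^sup>2 + \<epsilon>)" "0 < T"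
  shows "prob ({\<omega> \<in> space M. c \<le> \<mu>s i t \<omega>} \<inter> ({\<omega> \<in> space M. pulls J i t \<omega> = n} - inaccurate i \<epsilon> n)) \<le>
    1 / T * prob {\<omega> \<in> space M. pulls J i t \<omega> = n}"
proof -
  note n2 = init_pulls_bounds[OF \<alpha>_neg n]
  define N where "N = {\<omega> \<in> space M. pulls J i t \<omega> = n} - inaccurate i \<epsilon> n"
  have "N \<in> sets (history t)" unfolding N_def inaccurate_def space_history[of t, symmetric] by measurable
  then have N[measurable]: "N \<in> sets (history t)" "N \<in> sets M"
    using subalgebra_history[of t] by (auto simp: subalgebra_def)
  define B where "B = (\<lambda>j. if j = i then {c..} else UNIV)"
  define hit where "hit = {\<omega> \<in> space M. \<forall>j. \<mu>s j t \<omega> \<in> B j}"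
  have Bb: "B j \<in> sets borel" for j by (simp add: B_def)
  have hit: "hit = {\<omega> \<in> space M. c \<le> \<mu>s i t \<omega>}" by (auto simp: hit_def B_def split: if_splits)
  have sm: "hit \<in> sets M" unfolding hit_def by (rule sampling_event_sets[OF t Bb])
  let ?ce = "\<lambda>E. real_cond_exp M (history t) (indicator E)"
  note ce_hit = integral_sampling_event[OF t, of B, OF Bb, folded hit_def]
  have Ni: "integrable M (indicator N :: 'a \<Rightarrow> real)" by (simp add: integrable_real_indicator less_top[symmetric])
  have "prob (hit \<inter> N) = (\<integral>\<omega>. indicator N \<omega> * indicator hit \<omega> \<partial>M)"
    using sm by (simp add: indicator_inter_arith[symmetric] Int_commute)
  also have "\<dots> = (\<integral>\<omega>. indicator N \<omega> * ?ce hit \<omega> \<partial>M)"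
    using ce_hit(2)[of "indicator N"] Ni by simp
  also have "\<dots> \<le> (\<integral>\<omega>. 1 / T * indicator N \<omega> \<partial>M)"
  proof (rule integral_mono_AE)
    show "integrable M (\<lambda>\<omega>. indicator N \<omega> * ?ce hit \<omega>)" using Ni by (intro ce_hit(1)) auto
    show "integrable M (\<lambda>\<omega>. 1 / T * indicator N \<omega>)" using Ni by simp
    show "AE \<omega> in M. indicator N \<omega> * ?ce hit \<omega> \<le> 1 / T * indicator N \<omega>"
      using posterior_sampling[OF t, of B, OF Bb, folded hit_def] AE_all_sum_sq_dev_pos AE_space
    proof eventually_elim
      case (elim \<omega>)
      show ?case
      proof (cases "\<omega> \<in> N")
        case True
        define p where "p j = posterior \<alpha> (pulls J j t \<omega>) (sample_mean X j (pulls J j t \<omega>) \<omega>) (sum_sq_dev X j (pulls J j t \<omega>) \<omega>)" for j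
        define x where "x = sample_mean X i n \<omega>"
        define S where "S = sum_sq_dev X i n \<omega>"
        have pi: "p i = posterior \<alpha> n x S" using True by (simp add: p_def N_def x_def S_def)
        have S: "0 < S" using elim(2) n2 by (simp add: S_def)
        have xS: "x \<le> \<mu> i + \<epsilon>" "S \<le> real n * ((\<sigma> i)\<^sup>2 + \<epsilon>)"
          using True elim(3) by (auto simp: N_def inaccurate_def x_def S_def)
        have "measure (p j) (B j) \<le> 1" for j
        proof -
          have "init_pulls \<alpha> \<le> pulls J j t \<omega>" using elim(3) t by (intro pulls_ge_init)
          note m = init_pulls_bounds[OF \<alpha>_neg this]
          interpret p: prob_space "p j"
            unfolding p_def using m elim(2) by (intro prob_space_posterior) auto
          show ?thesis by simp
        qed
        then have Q: "(\<Prod>j\<in>UNIV - {i}. measure (p j) (B j)) \<le> 1" by (intro prod_le_1) auto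
        have "?ce hit \<omega> = measure (p i) {c..} * (\<Prod>j\<in>UNIV - {i}. measure (p j) (B j))"
          using elim(1) by (simp add: p_def[symmetric] prod.remove[of UNIV i] B_def)
        also have "\<dots> \<le> measure (p i) {c..} * 1" using Q by (intro mult_left_mono) auto
        also have "measure (p i) {c..} * 1 = measure (posterior \<alpha> n x S) {x + (c - x)..}" by (simp add: pi)
        also have "\<dots> \<le> (1 + real n * (c - x)\<^sup>2 / S) powr (- (real n + 2 * \<alpha> - 1) / 2) / 2"
          using n2 S xS d by (intro posterior_upper_tail) auto
        also have "\<dots> \<le> (1 + real n * (c - x)\<^sup>2 / S) powr (- (real n + 2 * \<alpha> - 1) / 2)" by simp
        also have "\<dots> \<le> (1 + d\<^sup>2 / ((\<sigma> i)\<^sup>2 + \<epsilon>)) powr (- (real n + 2 * \<alpha> - 1) / 2)"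
        proof (rule powr_mono2')
          have "d\<^sup>2 / ((\<sigma> i)\<^sup>2 + \<epsilon>) = real n * d\<^sup>2 / (real n * ((\<sigma> i)\<^sup>2 + \<epsilon>))" using n2 by simp
          also have "\<dots> \<le> real n * (c - x)\<^sup>2 / S"
            using xS S d by (intro frac_le mult_left_mono power_mono) auto
          finally show "1 + d\<^sup>2 / ((\<sigma> i)\<^sup>2 + \<epsilon>) \<le> 1 + real n * (c - x)\<^sup>2 / S" by simp
          show "0 < 1 + d\<^sup>2 / ((\<sigma> i)\<^sup>2 + \<epsilon>)" using \<epsilon> by (intro add_pos_nonneg divide_nonneg_nonneg) auto
          show "- (real n + 2 * \<alpha> - 1) / 2 \<le> 0" using n2 by simp
        qed
        also have "\<dots> = exp (- ((real n + 2 * \<alpha> - 1) * D_inf d ((\<sigma> i)\<^sup>2 + \<epsilon>)))"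
        proof -
          have "0 < 1 + d\<^sup>2 / ((\<sigma> i)\<^sup>2 + \<epsilon>)" using \<epsilon> by (intro add_pos_nonneg divide_nonneg_nonneg) auto
          then show ?thesis by (simp add: powr_def D_inf_def field_simps)
        qed
        also have "\<dots> \<le> exp (- ln T)" using q by simp
        also have "\<dots> = 1 / T" using q by (simp add: exp_minus inverse_eq_divide)
        finally show ?thesis using True by simp
      qed simp
    qed
  qed
  also have "\<dots> = 1 / T * prob N" by simp
  also have "\<dots> \<le> 1 / T * prob {\<omega> \<in> space M. pulls J i t \<omega> = n}"
    using q by (intro mult_left_mono finite_measure_mono) (auto simp: N_def)
  finally show ?thesis unfolding hit N_def .
qed

text \<open>
  Both tail bounds have exponents proportional to \<open>n \<epsilon>\<^sup>2\<close>; the number \<open>\<rho>\<close> is the smaller rate. The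
  extra factor \<open>n\<close> in the estimate only serves to reuse the sum already evaluated.
\<close>

lemma sum_prob_inaccurate_le:
  assumes \<epsilon>: "0 < \<epsilon>" "\<epsilon> \<le> (\<sigma> i)\<^sup>2"
  defines "\<rho> \<equiv> min (1 / (2 * (\<sigma> i)\<^sup>2)) (1 / (16 * (\<sigma> i) ^ 4))"
  shows "(\<Sum>n = init_pulls \<alpha>..T. prob (inaccurate i \<epsilon> n)) \<le> 8 / (\<rho> * \<epsilon>\<^sup>2)\<^sup>2"
proof -
  define \<beta> where "\<beta> = \<rho> * \<epsilon>\<^sup>2"
  have s: "0 < \<sigma> i" by (rule \<sigma>_pos)
  have \<rho>: "0 < \<rho>" using s by (simp add: \<rho>_def)
  have le1: "\<beta> \<le> \<epsilon>\<^sup>2 / (2 * (\<sigma> i)\<^sup>2)"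
    unfolding \<beta>_def \<rho>_def using mult_right_mono[OF min.cobounded1, of "\<epsilon>\<^sup>2"] by (simp add: min_mult_distrib_right)
  have le2: "\<beta> \<le> \<epsilon>\<^sup>2 / (16 * (\<sigma> i) ^ 4)"
    unfolding \<beta>_def \<rho>_def using mult_right_mono[OF min.cobounded2, of "\<epsilon>\<^sup>2"] by (simp add: min_mult_distrib_right)
  have "\<epsilon>\<^sup>2 \<le> ((\<sigma> i)\<^sup>2)\<^sup>2" using \<epsilon> by (intro power_mono) auto
  then have "\<epsilon>\<^sup>2 \<le> (\<sigma> i) ^ 4" by simp
  then have "\<epsilon>\<^sup>2 \<le> 16 * (\<sigma> i) ^ 4" using zero_less_power[OF s, of 4] by linarith
  then have "\<epsilon>\<^sup>2 / (16 * (\<sigma> i) ^ 4) \<le> 1" using s by (simp add: divide_le_eq)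
  with le2 have \<beta>: "0 < \<beta>" "\<beta> \<le> 1" using \<rho> \<epsilon> by (auto simp: \<beta>_def)
  have "(\<Sum>n = init_pulls \<alpha>..T. prob (inaccurate i \<epsilon> n)) \<le> (\<Sum>n = init_pulls \<alpha>..T. 2 * (real n * exp (- real n * \<beta>)))"
  proof (rule sum_mono)
    fix n assume "n \<in> {init_pulls \<alpha>..T}"
    then have n: "2 \<le> n" using init_pulls_bounds[OF \<alpha>_neg, of n] by simp
    have "prob (inaccurate i \<epsilon> n) \<le> exp (- real n * (\<epsilon>\<^sup>2 / (2 * (\<sigma> i)\<^sup>2))) + exp (- real n * (\<epsilon>\<^sup>2 / (16 * (\<sigma> i) ^ 4)))"
      by (rule prob_inaccurate_le[OF n \<epsilon>])
    also have "\<dots> \<le> exp (- real n * \<beta>) + exp (- real n * \<beta>)"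
      unfolding exp_le_cancel_iff using le1 le2
      by (intro add_mono exp_le_cancel_iff[THEN iffD2] mult_left_mono_neg) auto
    also have "\<dots> \<le> 2 * (real n * exp (- real n * \<beta>))" using n by simp
    finally show "prob (inaccurate i \<epsilon> n) \<le> 2 * (real n * exp (- real n * \<beta>))" .
  qed
  also have "\<dots> \<le> (\<Sum>n = 1..T. 2 * (real n * exp (- real n * \<beta>)))"
    using init_pulls_bounds[OF \<alpha>_neg order_refl] by (intro sum_mono2) auto
  also have "\<dots> \<le> 2 * (4 / \<beta>\<^sup>2)"
    unfolding sum_distrib_left[symmetric] using \<beta> by (intro mult_left_mono sum_mult_exp_le) auto
  finally show ?thesis by (simp add: \<beta>_def)
qed

text \<open>
  The three reasons for a pull of arm \<open>i\<close> are summed over the rounds after the initialization.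
  For optimistic samples with accurate statistics, the first \<open>L\<close> pulls are counted in full, where
  \<open>L\<close> is about \<open>ln T / D_inf\<close>; from then on each round has probability at most \<open>1 / T\<close>.
\<close>

lemma expected_pulls_le:
  assumes \<epsilon>: "0 < \<epsilon>" "\<epsilon> \<le> \<sigma> k" "\<epsilon> \<le> (\<sigma> i)\<^sup>2" and d: "0 < d" "d = \<mu> k - \<mu> i - 2 * \<epsilon>" and T: "1 \<le> T"
  shows "(\<Sum>t = 1..T. prob {\<omega> \<in> space M. J t \<omega> = i}) \<le>
    ln (real T) / D_inf d ((\<sigma> i)\<^sup>2 + \<epsilon>) + real (init_rounds TYPE('k) \<alpha>) + (3 - 2 * \<alpha>) +
    odds_constant \<alpha> * (4 / (\<epsilon>\<^sup>2 / (32 * (\<sigma> k)\<^sup>2))\<^sup>2) +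
    8 / (min (1 / (2 * (\<sigma> i)\<^sup>2)) (1 / (16 * (\<sigma> i) ^ 4)) * \<epsilon>\<^sup>2)\<^sup>2"
proof -
  define n0 where "n0 = init_rounds TYPE('k) \<alpha>"
  define c where "c = \<mu> k - \<epsilon>"
  define D where "D = D_inf d ((\<sigma> i)\<^sup>2 + \<epsilon>)"
  have D: "0 < D" unfolding D_def using d \<epsilon> by (intro D_inf_pos) (auto intro: add_nonneg_pos)
  have lnT: "0 \<le> ln (real T)" using T by simp
  (* The summand 1 - 2 * \<alpha> turns a number of pulls into n + 2 * \<alpha> - 1 degrees of freedom. *)
  define L where "L = nat \<lceil>ln (real T) / D + 1 - 2 * \<alpha>\<rceil>"
  have "0 \<le> ln (real T) / D + 1 - 2 * \<alpha>"
    using divide_nonneg_pos[OF lnT D] \<alpha>_neg by linarith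
  then have L: "real L \<le> ln (real T) / D + 2 - 2 * \<alpha>" unfolding L_def by linarith
  have Lq: "ln (real T) \<le> (real n + 2 * \<alpha> - 1) * D" if "L \<le> n" for n
  proof -
    have "ln (real T) / D + 1 - 2 * \<alpha> \<le> real n" using that unfolding L_def by linarith
    then have "ln (real T) / D \<le> real n + 2 * \<alpha> - 1" by simp
    then show ?thesis using D by (simp add: pos_divide_le_eq)
  qed
  define opt where "opt n t = {\<omega> \<in> space M. c \<le> \<mu>s i t \<omega>} \<inter> ({\<omega> \<in> space M. pulls J i t \<omega> = n} - inaccurate i \<epsilon> n)" for n t
  have sets_opt: "opt n t \<in> sets M" if "n0 < t" for n t
  proof -
    have [measurable]: "\<mu>s i t \<in> borel_measurable M" using that by (intro samples_measurable) (simp add: n0_def)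
    show ?thesis unfolding opt_def inaccurate_def by measurable
  qed
  have sets_in: "inaccurate i \<epsilon> n \<in> sets M" for n
    unfolding inaccurate_def by measurable
  have sets_pe: "pull_event i n t \<in> sets M" if "n0 < t" for n t using that by (intro pull_event_sets) simp
  have sets_low: "low_samples c t \<in> sets M" if "n0 < t" for t
    using that low_samples_sets by (simp add: n0_def)
  have round: "prob {\<omega> \<in> space M. J t \<omega> = i} \<le> prob (low_samples c t) + (\<Sum>n<L. prob (pull_event i n t)) +
      (\<Sum>n = init_pulls \<alpha>..T. prob (pull_event i n t \<inter> inaccurate i \<epsilon> n)) +
      (\<Sum>n\<in>{max L (init_pulls \<alpha>)..T}. prob (opt n t))"
    if t: "t \<in> {n0<..T}" for t
  proof -
    have sub: "{\<omega> \<in> space M. J t \<omega> = i} \<subseteq> low_samples c t \<union> (\<Union>n<L. pull_event i n t) \<union>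
      (\<Union>n\<in>{init_pulls \<alpha>..T}. pull_event i n t \<inter> inaccurate i \<epsilon> n) \<union> (\<Union>n\<in>{max L (init_pulls \<alpha>)..T}. opt n t)"
    proof
      fix \<omega> assume "\<omega> \<in> {\<omega> \<in> space M. J t \<omega> = i}"
      then have \<omega>: "\<omega> \<in> space M" and J: "J t \<omega> = i" by auto
      define n where "n = pulls J i t \<omega>"
      have n: "init_pulls \<alpha> \<le> n" "n \<le> T"
        using pulls_ge_init[of t \<omega> i] pulls_less[of t J i \<omega>] t \<omega> by (auto simp: n_def n0_def)
      have pe: "\<omega> \<in> pull_event i n t" using \<omega> J by (simp add: pull_event_def n_def)
      have "c \<le> \<mu>s i t \<omega>" if high: "\<omega> \<notin> low_samples c t"
      proof -
        obtain j where "c \<le> \<mu>s j t \<omega>" using high \<omega> by (auto simp: low_samples_def not_less)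
        also have "\<dots> \<le> \<mu>s i t \<omega>" using pull_maximizer[of t \<omega> j] t \<omega> J by (simp add: n0_def)
        finally show ?thesis .
      qed
      then have "\<omega> \<in> low_samples c t \<or> n < L \<or> \<omega> \<in> inaccurate i \<epsilon> n \<or> L \<le> n \<and> \<omega> \<in> opt n t"
        using \<omega> by (auto simp: opt_def n_def)
      then show "\<omega> \<in> low_samples c t \<union> (\<Union>n<L. pull_event i n t) \<union>
        (\<Union>n\<in>{init_pulls \<alpha>..T}. pull_event i n t \<inter> inaccurate i \<epsilon> n) \<union> (\<Union>n\<in>{max L (init_pulls \<alpha>)..T}. opt n t)"
        using pe n by fastforce
    qed
    have "prob {\<omega> \<in> space M. J t \<omega> = i} \<le> prob (low_samples c t \<union> (\<Union>n<L. pull_event i n t) \<union>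
      (\<Union>n\<in>{init_pulls \<alpha>..T}. pull_event i n t \<inter> inaccurate i \<epsilon> n) \<union> (\<Union>n\<in>{max L (init_pulls \<alpha>)..T}. opt n t))"
      using sub sets_opt sets_in sets_pe sets_low t by (intro finite_measure_mono) auto
    also have "\<dots> \<le> prob (low_samples c t) + prob (\<Union>n<L. pull_event i n t) +
      prob (\<Union>n\<in>{init_pulls \<alpha>..T}. pull_event i n t \<inter> inaccurate i \<epsilon> n) + prob (\<Union>n\<in>{max L (init_pulls \<alpha>)..T}. opt n t)"
      using sets_opt sets_in sets_pe sets_low t
      by (intro order_trans[OF measure_Un_le] add_mono order_refl) auto
    also have "\<dots> \<le> prob (low_samples c t) + (\<Sum>n<L. prob (pull_event i n t)) +
      (\<Sum>n = init_pulls \<alpha>..T. prob (pull_event i n t \<inter> inaccurate i \<epsilon> n)) +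
      (\<Sum>n\<in>{max L (init_pulls \<alpha>)..T}. prob (opt n t))"
      using sets_opt sets_in sets_pe t by (intro add_mono order_refl measure_UNION_le) auto
    finally show ?thesis .
  qed
  have part2: "(\<Sum>t\<in>{n0<..T}. \<Sum>n<L. prob (pull_event i n t)) \<le> real L"
  proof -
    have "(\<Sum>t\<in>{n0<..T}. \<Sum>n<L. prob (pull_event i n t)) = (\<Sum>n<L. \<Sum>t\<in>{n0<..T}. prob (pull_event i n t))"
      by (rule sum.swap)
    also have "\<dots> \<le> (\<Sum>n<L. 1)"
    proof (rule sum_mono)
      fix n
      have "pull_event i n t \<inter> space M = pull_event i n t" for t by (auto simp: pull_event_def)
      moreover have "{n0<..T} \<subseteq> {1..T}" by (intro subsetI) simp
      ultimately show "(\<Sum>t\<in>{n0<..T}. prob (pull_event i n t)) \<le> 1"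
        using sum_prob_pull_event_le[of "space M" "{n0<..T}" T i n] prob_space by (simp only: sets.top)
    qed
    finally show ?thesis by simp
  qed
  have part3: "(\<Sum>t\<in>{n0<..T}. \<Sum>n = init_pulls \<alpha>..T. prob (pull_event i n t \<inter> inaccurate i \<epsilon> n)) \<le>
     8 / (min (1 / (2 * (\<sigma> i)\<^sup>2)) (1 / (16 * (\<sigma> i) ^ 4)) * \<epsilon>\<^sup>2)\<^sup>2"
  proof -
    have "(\<Sum>t\<in>{n0<..T}. \<Sum>n = init_pulls \<alpha>..T. prob (pull_event i n t \<inter> inaccurate i \<epsilon> n)) =
      (\<Sum>n = init_pulls \<alpha>..T. \<Sum>t\<in>{n0<..T}. prob (pull_event i n t \<inter> inaccurate i \<epsilon> n))"
      by (rule sum.swap)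
    also have "\<dots> \<le> (\<Sum>n = init_pulls \<alpha>..T. prob (inaccurate i \<epsilon> n))"
      using sets_in by (intro sum_mono sum_prob_pull_event_le[where T=T]) auto
    also have "\<dots> \<le> 8 / (min (1 / (2 * (\<sigma> i)\<^sup>2)) (1 / (16 * (\<sigma> i) ^ 4)) * \<epsilon>\<^sup>2)\<^sup>2"
      using \<epsilon> by (intro sum_prob_inaccurate_le)
    finally show ?thesis .
  qed
  have part4: "(\<Sum>t\<in>{n0<..T}. \<Sum>n\<in>{max L (init_pulls \<alpha>)..T}. prob (opt n t)) \<le> 1"
  proof -
    have "(\<Sum>n\<in>{max L (init_pulls \<alpha>)..T}. prob (opt n t)) \<le> 1 / real T" if t: "t \<in> {n0<..T}" for t
    proof -
      have "(\<Sum>n\<in>{max L (init_pulls \<alpha>)..T}. prob (opt n t)) \<le>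
         (\<Sum>n\<in>{max L (init_pulls \<alpha>)..T}. 1 / real T * prob {\<omega> \<in> space M. pulls J i t \<omega> = n})"
        unfolding opt_def using t \<epsilon> d T Lq
        by (intro sum_mono prob_optimistic_sample_le[where d=d]) (auto simp: n0_def c_def D_def)
      also have "\<dots> = 1 / real T * prob (\<Union>n\<in>{max L (init_pulls \<alpha>)..T}. {\<omega> \<in> space M. pulls J i t \<omega> = n})"
        unfolding sum_distrib_left[symmetric]
        by (subst finite_measure_finite_Union) (auto simp: disjoint_family_on_def)
      also have "\<dots> \<le> 1 / real T * 1" by (intro mult_left_mono) auto
      finally show ?thesis by simp
    qed
    then have "(\<Sum>t\<in>{n0<..T}. \<Sum>n\<in>{max L (init_pulls \<alpha>)..T}. prob (opt n t)) \<le> (\<Sum>t\<in>{n0<..T}. 1 / real T)"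
      by (rule sum_mono)
    also have "\<dots> = real (T - n0) / real T" by simp
    also have "\<dots> \<le> 1" using T by (simp add: divide_le_eq)
    finally show ?thesis .
  qed
  have part1: "(\<Sum>t\<in>{n0<..T}. prob (low_samples c t)) \<le> odds_constant \<alpha> * (4 / (\<epsilon>\<^sup>2 / (32 * (\<sigma> k)\<^sup>2))\<^sup>2)"
    unfolding n0_def c_def using \<epsilon> by (intro sum_prob_low_samples_le)
  have "(\<Sum>t = 1..T. prob {\<omega> \<in> space M. J t \<omega> = i}) \<le> (\<Sum>t\<in>{1..n0} \<union> {n0<..T}. prob {\<omega> \<in> space M. J t \<omega> = i})"
    by (intro sum_mono2) auto
  also have "\<dots> = (\<Sum>t\<in>{1..n0}. prob {\<omega> \<in> space M. J t \<omega> = i}) + (\<Sum>t\<in>{n0<..T}. prob {\<omega> \<in> space M. J t \<omega> = i})"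
    by (rule sum.union_disjoint) auto
  also have "(\<Sum>t\<in>{1..n0}. prob {\<omega> \<in> space M. J t \<omega> = i}) \<le> (\<Sum>t\<in>{1..n0}. 1)"
    by (intro sum_mono) auto
  also have "(\<Sum>t\<in>{n0<..T}. prob {\<omega> \<in> space M. J t \<omega> = i}) \<le>
     (\<Sum>t\<in>{n0<..T}. prob (low_samples c t) + (\<Sum>n<L. prob (pull_event i n t)) +
      (\<Sum>n = init_pulls \<alpha>..T. prob (pull_event i n t \<inter> inaccurate i \<epsilon> n)) +
      (\<Sum>n\<in>{max L (init_pulls \<alpha>)..T}. prob (opt n t)))"
    by (rule sum_mono) (rule round)
  finally show ?thesis
    using part1 part2 part3 part4 L by (simp add: sum.distrib n0_def D_def)
qed

end

section \<open>From pulls to regret\<close>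

lemma expected_regret_eq:
  "expectation (regret \<mu> J T) = (\<Sum>i\<in>UNIV. gap \<mu> i * (\<Sum>t = 1..T. prob {\<omega> \<in> space M. J t \<omega> = i}))"
proof -
  have sets: "{\<omega> \<in> space M. J t \<omega> = i} \<in> sets M" if "1 \<le> t" for t i
  proof -
    have [measurable]: "J t \<in> measurable M (count_space UNIV)" by (rule J_measurable[OF that])
    show ?thesis by measurable
  qed
  have int: "integrable M (\<lambda>\<omega>. gap \<mu> i * indicator {\<omega> \<in> space M. J t \<omega> = i} \<omega>)" if "1 \<le> t" for t i
    using sets[OF that, of i] by (simp add: integrable_real_indicator less_top[symmetric])
  have "expectation (regret \<mu> J T) =
     (\<integral>\<omega>. (\<Sum>t = 1..T. \<Sum>i\<in>UNIV. gap \<mu> i * indicator {\<omega> \<in> space M. J t \<omega> = i} \<omega>) \<partial>M)"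
  proof (intro Bochner_Integration.integral_cong refl)
    fix \<omega> assume "\<omega> \<in> space M"
    then show "regret \<mu> J T \<omega> = (\<Sum>t = 1..T. \<Sum>i\<in>UNIV. gap \<mu> i * indicator {\<omega> \<in> space M. J t \<omega> = i} \<omega>)"
      by (simp add: regret_def indicator_def of_bool_def if_distrib[of "\<lambda>x. _ * x"] sum.delta cong: if_cong)
  qed
  also have "\<dots> = (\<Sum>t = 1..T. \<Sum>i\<in>UNIV. gap \<mu> i * prob {\<omega> \<in> space M. J t \<omega> = i})"
  proof (subst Bochner_Integration.integral_sum)
    fix t assume "t \<in> {1..T}"
    then show "integrable M (\<lambda>\<omega>. \<Sum>i\<in>UNIV. gap \<mu> i * indicator {\<omega> \<in> space M. J t \<omega> = i} \<omega>)"
      using int by (intro Bochner_Integration.integrable_sum) auto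
  next
    show "(\<Sum>t = 1..T. \<integral>\<omega>. (\<Sum>i\<in>UNIV. gap \<mu> i * indicator {\<omega> \<in> space M. J t \<omega> = i} \<omega>) \<partial>M) =
      (\<Sum>t = 1..T. \<Sum>i\<in>UNIV. gap \<mu> i * prob {\<omega> \<in> space M. J t \<omega> = i})"
    proof (intro sum.cong refl)
      fix t assume t: "t \<in> {1..T}"
      have "(\<integral>\<omega>. (\<Sum>i\<in>UNIV. gap \<mu> i * indicator {\<omega> \<in> space M. J t \<omega> = i} \<omega>) \<partial>M) =
         (\<Sum>i\<in>UNIV. \<integral>\<omega>. gap \<mu> i * indicator {\<omega> \<in> space M. J t \<omega> = i} \<omega> \<partial>M)"
        using int t by (intro Bochner_Integration.integral_sum) auto
      also have "\<dots> = (\<Sum>i\<in>UNIV. gap \<mu> i * prob {\<omega> \<in> space M. J t \<omega> = i})"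
        using sets t by (intro sum.cong) (auto simp: Int_absorb2 subset_eq)
      finally show "(\<integral>\<omega>. (\<Sum>i\<in>UNIV. gap \<mu> i * indicator {\<omega> \<in> space M. J t \<omega> = i} \<omega>) \<partial>M) =
         (\<Sum>i\<in>UNIV. gap \<mu> i * prob {\<omega> \<in> space M. J t \<omega> = i})" .
    qed
  qed
  also have "\<dots> = (\<Sum>i\<in>UNIV. \<Sum>t = 1..T. gap \<mu> i * prob {\<omega> \<in> space M. J t \<omega> = i})"
    by (rule sum.swap)
  finally show ?thesis by (simp add: sum_distrib_left)
qed

end

text \<open>
  With \<open>\<epsilon> = ln T powr (- 1 / 5)\<close>, both \<open>\<epsilon> ln T\<close> and \<open>\<epsilon> powr - 4\<close> equal \<open>ln T powr (4 / 5)\<close>. The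
  constants depend on the parameters of the arms and the prior, but not on the probability space.
\<close>

lemma expected_pulls_asymptotics:
  fixes \<mu> \<sigma> :: "'k::finite \<Rightarrow> real"
  assumes \<sigma>: "\<And>i. 0 < \<sigma> i" and \<alpha>: "\<alpha> < 0" and less: "\<mu> i < \<mu> k"
  shows "\<exists>C T\<^sub>0. \<forall>(M :: 'a measure) X J \<mu>s. gaussian_thompson_sampling M \<mu> \<sigma> \<alpha> X J \<mu>s \<longrightarrow>
    (\<forall>T\<ge>T\<^sub>0. (\<Sum>t = 1..T. measure M {\<omega> \<in> space M. J t \<omega> = i}) \<le>
       ln (real T) / D_inf (\<mu> k - \<mu> i) ((\<sigma> i)\<^sup>2) + C * ln (real T) powr (4 / 5))"
proof -
  define \<Delta> where "\<Delta> = \<mu> k - \<mu> i"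
  define v where "v = (\<sigma> i)\<^sup>2"
  have \<Delta>: "0 < \<Delta>" and v: "0 < v" using less \<sigma>[of i] by (auto simp: \<Delta>_def v_def)
  obtain K \<epsilon>\<^sub>0 where K: "0 \<le> K" "0 < \<epsilon>\<^sub>0"
    "\<And>\<epsilon>. 0 < \<epsilon> \<Longrightarrow> \<epsilon> < \<epsilon>\<^sub>0 \<Longrightarrow> 1 / D_inf (\<Delta> - 2 * \<epsilon>) (v + \<epsilon>) \<le> 1 / D_inf \<Delta> v + K * \<epsilon>"
    using inverse_D_inf_perturbation[OF \<Delta> v] by blast
  (* Below this threshold every tolerance meets the conditions of the bound on the expected pulls;
     the last entry keeps the perturbed gap positive. *)
  define \<epsilon>\<^sub>1 where "\<epsilon>\<^sub>1 = Min {\<epsilon>\<^sub>0, \<sigma> k, v, \<Delta> / 2}"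
  have \<epsilon>\<^sub>1: "0 < \<epsilon>\<^sub>1" using K \<sigma> v \<Delta> by (simp add: \<epsilon>\<^sub>1_def)
  define n0 where "n0 = real (init_rounds TYPE('k) \<alpha>) + (3 - 2 * \<alpha>)"
  define A where "A = odds_constant \<alpha> * (4 * (32 * (\<sigma> k)\<^sup>2)\<^sup>2)"
  define B where "B = 8 / (min (1 / (2 * (\<sigma> i)\<^sup>2)) (1 / (16 * (\<sigma> i) ^ 4)))\<^sup>2"
  have "filterlim (\<lambda>T::nat. ln (real T)) at_top sequentially"
    by (rule filterlim_compose[OF ln_at_top filterlim_real_sequentially])
  then have "((\<lambda>T::nat. ln (real T) powr (- 1 / 5)) \<longlongrightarrow> 0) sequentially"
    by (intro tendsto_neg_powr) auto
  then have "\<forall>\<^sub>F T::nat in sequentially. ln (real T) powr (- 1 / 5) < \<epsilon>\<^sub>1"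
    using \<epsilon>\<^sub>1 by (rule order_tendstoD)
  then obtain T1 where T1: "\<And>T::nat. T1 \<le> T \<Longrightarrow> ln (real T) powr (- 1 / 5) < \<epsilon>\<^sub>1"
    by (auto simp: eventually_sequentially)
  show ?thesis
  proof (intro exI[of _ "K + n0 + A + B"] exI[of _ "max T1 3"] allI impI)
    fix M :: "'a measure" and X J \<mu>s and T :: nat
    assume "gaussian_thompson_sampling M \<mu> \<sigma> \<alpha> X J \<mu>s" and T: "max T1 3 \<le> T"
    interpret gaussian_thompson_sampling M \<mu> \<sigma> \<alpha> X J \<mu>s by fact
    define l where "l = ln (real T)"
    define \<epsilon> where "\<epsilon> = l powr (- 1 / 5)"
    define P where "P = l powr (4 / 5)"
    have l: "1 \<le> l"
    proof -
      have "exp 1 \<le> (3::real)" by (rule exp_le)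
      then have "exp 1 \<le> real T" using T by simp
      then show ?thesis unfolding l_def using T by (subst ln_ge_iff) auto
    qed
    have \<epsilon>: "0 < \<epsilon>" "\<epsilon> < \<epsilon>\<^sub>1" using T1[of T] T l by (auto simp: \<epsilon>_def l_def)
    then have \<epsilon>': "\<epsilon> < \<epsilon>\<^sub>0" "\<epsilon> \<le> \<sigma> k" "\<epsilon> \<le> (\<sigma> i)\<^sup>2" "0 < \<Delta> - 2 * \<epsilon>"
      by (auto simp: \<epsilon>\<^sub>1_def v_def)
    have P1: "1 \<le> P" using l by (simp add: P_def ge_one_powr_ge_zero)
    have lP: "l * \<epsilon> = P" using l by (simp add: \<epsilon>_def P_def powr_mult_base)
    have "\<epsilon> ^ 4 = l powr (- 4 / 5)" using l by (simp add: \<epsilon>_def powr_power)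
    then have eP: "1 / (\<epsilon>\<^sup>2)\<^sup>2 = P" using l by (simp add: P_def powr_minus_divide)
    have "(\<Sum>t = 1..T. prob {\<omega> \<in> space M. J t \<omega> = i}) \<le> l / D_inf (\<Delta> - 2 * \<epsilon>) ((\<sigma> i)\<^sup>2 + \<epsilon>) +
       real (init_rounds TYPE('k) \<alpha>) + (3 - 2 * \<alpha>) +
       odds_constant \<alpha> * (4 / (\<epsilon>\<^sup>2 / (32 * (\<sigma> k)\<^sup>2))\<^sup>2) +
       8 / (min (1 / (2 * (\<sigma> i)\<^sup>2)) (1 / (16 * (\<sigma> i) ^ 4)) * \<epsilon>\<^sup>2)\<^sup>2"
      unfolding l_def using \<epsilon> \<epsilon>' T
      by (intro expected_pulls_le[OF \<sigma> \<alpha>]) (auto simp: \<Delta>_def)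
    also have "odds_constant \<alpha> * (4 / (\<epsilon>\<^sup>2 / (32 * (\<sigma> k)\<^sup>2))\<^sup>2) = A * (1 / (\<epsilon>\<^sup>2)\<^sup>2)"
      by (simp add: A_def power_divide)
    also have "8 / (min (1 / (2 * (\<sigma> i)\<^sup>2)) (1 / (16 * (\<sigma> i) ^ 4)) * \<epsilon>\<^sup>2)\<^sup>2 = B * (1 / (\<epsilon>\<^sup>2)\<^sup>2)"
      by (simp add: B_def power_mult_distrib)
    also have "l / D_inf (\<Delta> - 2 * \<epsilon>) ((\<sigma> i)\<^sup>2 + \<epsilon>) \<le> l * (1 / D_inf \<Delta> v + K * \<epsilon>)"
      using mult_left_mono[OF K(3)[OF \<epsilon>(1) \<epsilon>'(1)], of l] l by (simp add: v_def)
    also have "l * (1 / D_inf \<Delta> v + K * \<epsilon>) = l / D_inf \<Delta> v + K * P"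
      using lP by (simp add: algebra_simps)
    finally have "(\<Sum>t = 1..T. prob {\<omega> \<in> space M. J t \<omega> = i}) \<le>
       l / D_inf \<Delta> v + K * P + n0 + A * P + B * P"
      unfolding eP n0_def by simp
    moreover have "n0 \<le> n0 * P"
      using P1 \<alpha> by (simp add: n0_def mult_le_cancel_left1)
    ultimately have "(\<Sum>t = 1..T. prob {\<omega> \<in> space M. J t \<omega> = i}) \<le> l / D_inf \<Delta> v + (K + n0 + A + B) * P"
      by (simp add: algebra_simps)
    then show "(\<Sum>t = 1..T. prob {\<omega> \<in> space M. J t \<omega> = i}) \<le>
       ln (real T) / D_inf (\<mu> k - \<mu> i) ((\<sigma> i)\<^sup>2) + (K + n0 + A + B) * ln (real T) powr (4 / 5)"
      unfolding l_def P_def \<Delta>_def v_def .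
  qed
qed

theorem theorem1:
  fixes \<mu> \<sigma> :: "'k::finite \<Rightarrow> real" and \<alpha> :: real
  assumes "\<And>i. 0 < \<sigma> i"
    and "\<exists>!i. gap \<mu> i = 0"
    and "\<alpha> < 0"
  shows "\<exists>R \<in> O(\<lambda>T::nat. ln (real T) powr (4 / 5)).
    \<forall>(M :: 'a measure) X J \<mu>s. gaussian_thompson_sampling M \<mu> \<sigma> \<alpha> X J \<mu>s \<longrightarrow>
      (\<forall>T\<ge>1. prob_space.expectation M (regret \<mu> J T) \<le>
         (\<Sum>i | gap \<mu> i > 0. gap \<mu> i * ln (real T) / D_inf (gap \<mu> i) ((\<sigma> i)\<^sup>2)) + R T)"
proof -
  obtain k where k: "gap \<mu> k = 0" using assms(2) by blast
  have gap: "gap \<mu> i = \<mu> k - \<mu> i" for i using k by (simp add: gap_def)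
  have gap_nonneg: "0 \<le> gap \<mu> i" for i by (simp add: gap_def)
  let ?bound = "\<lambda>i C (T\<^sub>0::nat). \<forall>(M :: 'a measure) X J \<mu>s. gaussian_thompson_sampling M \<mu> \<sigma> \<alpha> X J \<mu>s \<longrightarrow>
    (\<forall>T\<ge>T\<^sub>0. (\<Sum>t = 1..T. measure M {\<omega> \<in> space M. J t \<omega> = i}) \<le>
       ln (real T) / D_inf (gap \<mu> i) ((\<sigma> i)\<^sup>2) + C * ln (real T) powr (4 / 5))"
  have "\<forall>i\<in>{i. 0 < gap \<mu> i}. \<exists>C T\<^sub>0. ?bound i C T\<^sub>0"
    using expected_pulls_asymptotics[OF assms(1,3)] by (auto simp: gap)
  from bchoice[OF this] obtain C where "\<forall>i\<in>{i. 0 < gap \<mu> i}. \<exists>T\<^sub>0. ?bound i (C i) T\<^sub>0" ..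
  from bchoice[OF this] obtain T\<^sub>0 where T\<^sub>0: "\<forall>i\<in>{i. 0 < gap \<mu> i}. ?bound i (C i) (T\<^sub>0 i)" ..
  then have bound: "?bound i (C i) (T\<^sub>0 i)" if "0 < gap \<mu> i" for i using that by simp
  (* The remainder must cover all horizons: before the asymptotic bounds of all arms hold, it is a
     trivial bound that is linear in the horizon. *)
  define T\<^sub>1 where "T\<^sub>1 = Max (range T\<^sub>0)"
  define C' where "C' = (\<Sum>i | gap \<mu> i > 0. gap \<mu> i * C i)"
  define R where "R T = (if T\<^sub>1 \<le> T then C' * ln (real T) powr (4 / 5) else (\<Sum>i\<in>UNIV. gap \<mu> i) * real T)" for T
  have pos_only: "(\<Sum>i\<in>UNIV. gap \<mu> i * f i) = (\<Sum>i | gap \<mu> i > 0. gap \<mu> i * f i)" for f :: "'k \<Rightarrow> real"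
    using gap_nonneg by (intro sum.mono_neutral_right) (auto simp: order.strict_iff_order)
  have "R \<in> O(\<lambda>T::nat. ln (real T) powr (4 / 5))"
  proof (rule bigoI)
    show "\<forall>\<^sub>F T in sequentially. norm (R T) \<le> \<bar>C'\<bar> * norm (ln (real T) powr (4 / 5))"
      using eventually_ge_at_top[of T\<^sub>1] by eventually_elim (simp add: R_def abs_mult)
  qed
  moreover have "prob_space.expectation M (regret \<mu> J T) \<le>
      (\<Sum>i | gap \<mu> i > 0. gap \<mu> i * ln (real T) / D_inf (gap \<mu> i) ((\<sigma> i)\<^sup>2)) + R T"
    if TS: "gaussian_thompson_sampling M \<mu> \<sigma> \<alpha> X J \<mu>s" and T: "1 \<le> T" for M :: "'a measure" and X J \<mu>s T
  proof -
    interpret gaussian_thompson_sampling M \<mu> \<sigma> \<alpha> X J \<mu>s by (rule TS)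
    define N where "N i = (\<Sum>t = 1..T. prob {\<omega> \<in> space M. J t \<omega> = i})" for i
    have E: "expectation (regret \<mu> J T) = (\<Sum>i\<in>UNIV. gap \<mu> i * N i)"
      unfolding N_def by (rule expected_regret_eq)
    show ?thesis
    proof (cases "T\<^sub>1 \<le> T")
      case True
      have "expectation (regret \<mu> J T) = (\<Sum>i | gap \<mu> i > 0. gap \<mu> i * N i)"
        unfolding E by (rule pos_only)
      also have "\<dots> \<le> (\<Sum>i | gap \<mu> i > 0. gap \<mu> i *
          (ln (real T) / D_inf (gap \<mu> i) ((\<sigma> i)\<^sup>2) + C i * ln (real T) powr (4 / 5)))"
      proof (intro sum_mono mult_left_mono gap_nonneg)
        fix i assume i: "i \<in> {i. 0 < gap \<mu> i}"
        have "T\<^sub>0 i \<le> T" using True by (auto simp: T\<^sub>1_def)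
        with bound[of i] TS i show "N i \<le> ln (real T) / D_inf (gap \<mu> i) ((\<sigma> i)\<^sup>2) + C i * ln (real T) powr (4 / 5)"
          unfolding N_def by blast
      qed
      also have "\<dots> = (\<Sum>i | gap \<mu> i > 0. gap \<mu> i * ln (real T) / D_inf (gap \<mu> i) ((\<sigma> i)\<^sup>2)) + R T"
        using True by (simp add: R_def C'_def distrib_left sum.distrib sum_distrib_right mult.assoc)
      finally show ?thesis .
    next
      case False
      have "N i \<le> real T" for i
        using sum_bounded_above[of "{1..T}" "\<lambda>t. prob {\<omega> \<in> space M. J t \<omega> = i}" 1] by (simp add: N_def)
      then have "expectation (regret \<mu> J T) \<le> (\<Sum>i\<in>UNIV. gap \<mu> i * real T)"
        unfolding E using gap_nonneg by (intro sum_mono mult_left_mono) auto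
      also have "\<dots> = R T" using False by (simp add: R_def sum_distrib_right)
      also have "\<dots> \<le> (\<Sum>i | gap \<mu> i > 0. gap \<mu> i * ln (real T) / D_inf (gap \<mu> i) ((\<sigma> i)\<^sup>2)) + R T"
      proof -
        have "0 \<le> gap \<mu> i * ln (real T) / D_inf (gap \<mu> i) ((\<sigma> i)\<^sup>2)" if "0 < gap \<mu> i" for i
          using D_inf_pos[of "gap \<mu> i" "(\<sigma> i)\<^sup>2"] assms(1)[of i] that T
          by (intro divide_nonneg_nonneg mult_nonneg_nonneg) auto
        then have "0 \<le> (\<Sum>i | gap \<mu> i > 0. gap \<mu> i * ln (real T) / D_inf (gap \<mu> i) ((\<sigma> i)\<^sup>2))"
          by (intro sum_nonneg) simp
        then show ?thesis by simp
      qed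
      finally show ?thesis .
    qed
  qed
  ultimately show ?thesis by blast
qed

end
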